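(* Consider a finite MDP satisfying the standing assumptions below, a function $f$ satisfying the stated conditions, and the iteration, started from arbitrary $\xi_0\in\mathbb{R}$ and $Q_0\in\mathbb{R}^{|\mathcal S\times\mathcal A|}$: for $k=0,1,2,\dots$, $$\xi_{k+1}=\xi_k+a(k)\big(f(Q_k;X_k)-\xi_k\big),$$ $$Q_{k+1}(s,a)=Q_k(s,a)+b(\nu(k,s,a))\Big(r(s,a)-g_\eta(\xi_k)+\max_{a'}Q_k(s'_k,a')-Q_k(s,a)\Big)\mathbb{1}\big((s,a)=\phi_k\big)\quad\forall (s,a),$$ where $\phi_k\in\mathcal S\times\mathcal A$ is the state-action pair updated at time $k$, $s'_k\sim p(\cdot\mid\phi_k)$ is the sampled next state, $\nu(k,s,a)=\sum_{m=0}^k\mathbb{1}((s,a)=\phi_m)$, $\eta>0$ is fixed, and $$g_\eta(x)=\begin{cases}\|r\|_\infty+\eta & x\ge \|r\|_\infty+\eta,\\ x & -\|r\|_\infty-\eta<x<\|r\|_\infty+\eta,\\ -\|r\|_\infty-\eta & x\le-\|r\|_\infty-\eta.\end{cases}$$ Assume (A1)–(A5) below. Then, almost surely, $Q_k\to q^*$ and $\xi_k\to f(q^* )$, where $q^*$ is the unique function $q:\mathcal S\times\mathcal A\to\mathbb R$ satisfying $$q(s,a)=r(s,a)-\rho^*+\sum_{s'}p(s'\mid s,a)\max_{a'}q(s',a')\ \ \forall (s,a),\qquad \rho^*=f(q),$$ with $\rho^*=\max_\pi\rho^\pi$ the optimal average reward. Assumptions: (A1) Let $\mathcal F_k=\sigma(\xi_n,Q_n,\,n\le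 k;\ w_{n,1},w_{n,2},\,n<k)$, where $w_{n,1}=f(Q_n;X_n)-f(Q_n)$ and $w_{n,2}(s,a)=r(s,a)-g_\eta(\xi_n)+\max_{a'}Q_n(s'_n,a')-\big(r(s,a)-g_\eta(\xi_n)+\sum_{s''}p(s''\mid s,a)\max_{a'}Q_n(s'',a')\big)$. It holds that $\mathbb E[f(Q_k;X_k)-f(Q_k)\mid\mathcal F_k]=0$ and $\mathbb E[\|f(Q_k;X_k)-f(Q_k)\|^2\mid\mathcal F_k]\le K(1+\|Q_k\|^2)$ for some constant $K$. (A2) There is a state $s$ and an integer $m$ such that, for all initial states and all stationary policies, $s$ is visited with positive probability at least once within the first $m$ time steps. (A3) For $c=a$ and for $c=b$: $\sum_k c(k)=\infty$, $\sum_k c(k)^2<\infty$; for every $x\in(0,1)$, $\sup_k c(\lfloor xk\rfloor)/c(k)<\infty$; and for every $x\in(0,1)$, with $C(k)=\sum_{i=0}^k c(i)$, $C(\lfloor yk\rfloor)/C(k)\to1$ uniformly in $y\in[x,1]$. (A4) $\limsup_{k\to\infty} b(k)/a(k)=0$. (A5) There is $\Delta>0$ with $\liminf_{k\to\infty}\nu(k,s,a)/(k+1)\ge\Delta$ almost surely for all $(s,a)$; moreover, defining for $x>0$, $N'(k,x)=\min\{m>k:\sum_{i=k+1}^m b(\nu(i,\phi_i))\ge x\}$, the limits $$\lim_{k\to\infty}\frac{\sum_{m=\nu(k,s',a')}^{\nu(N'(k,x),s',a')}b(m)}{\sum_{m=\nu(k,s,a)}^{\nu(N'(k,x),s,a)}b(m)}$$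 exist almost surely for all $(s,a),(s',a')$.
   Context: A finite MDP $(\mathcal S,\mathcal A,r,p)$ with finite state and action sets, reward $r:\mathcal S\times\mathcal A\to\mathbb R$, $\|r\|_\infty=\max_{s,a}|r(s,a)|$, and transition probabilities $p(s'\mid s,a)$. Standing assumption: for every stationary policy $\pi$ the induced Markov chain is ergodic. The average reward of $\pi$ is $\rho^\pi=\lim_{T\to\infty}\frac1T\mathbb E_\pi[\sum_{t=0}^T r(S_t,A_t)]$. $e$ denotes the all-ones vector in $\mathbb R^{|\mathcal S\times\mathcal A|}$. The function $f:\mathbb R^{|\mathcal S\times\mathcal A|}\to\mathbb R$ is Lipschitz and there is $u>0$ such that $f(e)=u$, $f(x+ce)=f(x)+cu$ and $f(cx)=cf(x)$ for all $c\in\mathbb R$, $x\in\mathbb R^{|\mathcal S\times\mathcal A|}$. $(X_k)$ is a sequence of random variables and $f(\cdot;\cdot)$ a function such that $f(Q;X_k)$ is a sampled estimate of $f(Q)$ (e.g. $f(Q)=\mathbb E_{s\sim d}[\max_a Q(s,a)]$ for a state distribution $d$ and $f(Q;X)$ the empirical mean over a sampled minibatch of states). $a(\cdot),b(\cdot)$ are positive step-size sequences. *)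

theory Defs
  imports "HOL-Analysis.Analysis" "HOL-Probability.Probability"
begin

text \<open>States have type 's, actions type 'b (both finite). Q-functions are vectors
  indexed by state-action pairs: real ^ ('s \<times> 'b).\<close>

definition is_mdp :: "('s::finite \<Rightarrow> 'b::finite \<Rightarrow> 's \<Rightarrow> real) \<Rightarrow> bool" where
  "is_mdp p \<longleftrightarrow> (\<forall>s a s'. 0 \<le> p s a s') \<and> (\<forall>s a. (\<Sum>s'\<in>UNIV. p s a s') = 1)"

definition stationary_policy :: "('s::finite \<Rightarrow> 'b::finite \<Rightarrow> real) \<Rightarrow> bool" where
  "stationary_policy \<pi> \<longleftrightarrow> (\<forall>s a. 0 \<le> \<pi> s a) \<and> (\<forall>s. (\<Sum>a\<in>UNIV. \<pi> s a) = 1)"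

definition policy_chain ::
  "('s::finite \<Rightarrow> 'b::finite \<Rightarrow> 's \<Rightarrow> real) \<Rightarrow> ('s \<Rightarrow> 'b \<Rightarrow> real) \<Rightarrow> 's \<Rightarrow> 's \<Rightarrow> real" where
  "policy_chain p \<pi> s s' = (\<Sum>a\<in>UNIV. \<pi> s a * p s a s')"

fun nstep :: "('s::finite \<Rightarrow> 's \<Rightarrow> real) \<Rightarrow> nat \<Rightarrow> 's \<Rightarrow> 's \<Rightarrow> real" where
  "nstep P 0 i j = (if i = j then 1 else 0)"
| "nstep P (Suc n) i j = (\<Sum>k\<in>UNIV. P i k * nstep P n k j)"

definition irreducible_chain :: "('s::finite \<Rightarrow> 's \<Rightarrow> real) \<Rightarrow> bool" where
  "irreducible_chain P \<longleftrightarrow> (\<forall>i j. \<exists>n>0. nstep P n i j > 0)"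

definition aperiodic_chain :: "('s::finite \<Rightarrow> 's \<Rightarrow> real) \<Rightarrow> bool" where
  "aperiodic_chain P \<longleftrightarrow> (\<forall>i. Gcd {n. n > 0 \<and> nstep P n i i > 0} = 1)"

definition ergodic_chain :: "('s::finite \<Rightarrow> 's \<Rightarrow> real) \<Rightarrow> bool" where
  "ergodic_chain P \<longleftrightarrow> irreducible_chain P \<and> aperiodic_chain P"

text \<open>Average reward of policy pi from initial state s0:
  lim_T (1/T) E[sum_{t=0}^T r(S_t,A_t)].\<close>
definition avg_reward ::
  "('s::finite \<Rightarrow> 'b::finite \<Rightarrow> real) \<Rightarrow> ('s \<Rightarrow> 'b \<Rightarrow> 's \<Rightarrow> real) \<Rightarrow> ('s \<Rightarrow> 'b \<Rightarrow> real) \<Rightarrow> 's \<Rightarrow> real" where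
  "avg_reward r p \<pi> s0 = lim (\<lambda>T. (\<Sum>t\<le>T. \<Sum>s\<in>UNIV. nstep (policy_chain p \<pi>) t s0 s *
                                   (\<Sum>a\<in>UNIV. \<pi> s a * r s a)) / real T)"

definition opt_avg_reward ::
  "('s::finite \<Rightarrow> 'b::finite \<Rightarrow> real) \<Rightarrow> ('s \<Rightarrow> 'b \<Rightarrow> 's \<Rightarrow> real) \<Rightarrow> 's \<Rightarrow> real" where
  "opt_avg_reward r p s0 = (SUP \<pi>\<in>{\<pi>. stationary_policy \<pi>}. avg_reward r p \<pi> s0)"

definition rnorm :: "('s::finite \<Rightarrow> 'b::finite \<Rightarrow> real) \<Rightarrow> real" where
  "rnorm r = Max (range (\<lambda>(s, a). \<bar>r s a\<bar>))"

definition maxQ :: "real ^ ('s::finite \<times> 'b::finite) \<Rightarrow> 's \<Rightarrow> real" where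
  "maxQ q s = Max (range (\<lambda>a. q $ (s, a)))"

definition g_clip :: "real \<Rightarrow> real \<Rightarrow> real \<Rightarrow> real" where
  "g_clip R \<eta> x = (if x \<ge> R + \<eta> then R + \<eta> else if x \<le> - R - \<eta> then - R - \<eta> else x)"

definition ones :: "real ^ 'n::finite" where
  "ones = (\<chi> i. 1)"

definition rvi_solution ::
  "('s::finite \<Rightarrow> 'b::finite \<Rightarrow> real) \<Rightarrow> ('s \<Rightarrow> 'b \<Rightarrow> 's \<Rightarrow> real) \<Rightarrow> (real ^ ('s \<times> 'b) \<Rightarrow> real)
     \<Rightarrow> real ^ ('s \<times> 'b) \<Rightarrow> bool" where
  "rvi_solution r p f q \<longleftrightarrow>
     (\<forall>s a. q $ (s, a) = r s a - f q + (\<Sum>s'\<in>UNIV. p s a s' * maxQ q s'))"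

definition stepsize_cond :: "(nat \<Rightarrow> real) \<Rightarrow> bool" where
  "stepsize_cond c \<longleftrightarrow>
     \<not> summable c \<and> summable (\<lambda>k. (c k)\<^sup>2) \<and>
     (\<forall>x. 0 < x \<and> x < 1 \<longrightarrow> bdd_above (range (\<lambda>k. c (nat \<lfloor>x * real k\<rfloor>) / c k))) \<and>
     (\<forall>x. 0 < x \<and> x < 1 \<longrightarrow>
        uniform_limit {x..1} (\<lambda>k y. (\<Sum>i\<le>nat \<lfloor>y * real k\<rfloor>. c i) / (\<Sum>i\<le>k. c i)) (\<lambda>_. 1) sequentially)"

definition visits :: "(nat \<Rightarrow> 'w \<Rightarrow> 'i) \<Rightarrow> nat \<Rightarrow> 'w \<Rightarrow> 'i \<Rightarrow> nat" where
  "visits \<phi> k \<omega> i = card {m. m \<le> k \<and> \<phi> m \<omega> = i}"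

definition Nprime :: "(nat \<Rightarrow> real) \<Rightarrow> (nat \<Rightarrow> 'w \<Rightarrow> 'i) \<Rightarrow> nat \<Rightarrow> real \<Rightarrow> 'w \<Rightarrow> nat" where
  "Nprime b \<phi> k x \<omega> =
     (LEAST m. m > k \<and> (\<Sum>i=Suc k..m. b (visits \<phi> i \<omega> (\<phi> i \<omega>))) \<ge> x)"

definition preimgs :: "'w measure \<Rightarrow> ('w \<Rightarrow> 'v::topological_space) \<Rightarrow> 'w set set" where
  "preimgs M X = {X -` A \<inter> space M | A. A \<in> sets borel}"

definition preimgs_discr :: "'w measure \<Rightarrow> ('w \<Rightarrow> 'v) \<Rightarrow> 'w set set" where
  "preimgs_discr M X = {X -` A \<inter> space M | A. True}"

definition noise1 ::
  "(real ^ 'n \<Rightarrow> real) \<Rightarrow> (real ^ 'n \<Rightarrow> 'x \<Rightarrow> real) \<Rightarrow> (nat \<Rightarrow> 'w \<Rightarrow> real ^ 'n)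
    \<Rightarrow> (nat \<Rightarrow> 'w \<Rightarrow> 'x) \<Rightarrow> nat \<Rightarrow> 'w \<Rightarrow> real" where
  "noise1 f fs Q X n \<omega> = fs (Q n \<omega>) (X n \<omega>) - f (Q n \<omega>)"

definition noise2 ::
  "('s::finite \<Rightarrow> 'b::finite \<Rightarrow> real) \<Rightarrow> ('s \<Rightarrow> 'b \<Rightarrow> 's \<Rightarrow> real) \<Rightarrow> real
    \<Rightarrow> (nat \<Rightarrow> 'w \<Rightarrow> real) \<Rightarrow> (nat \<Rightarrow> 'w \<Rightarrow> real ^ ('s \<times> 'b)) \<Rightarrow> (nat \<Rightarrow> 'w \<Rightarrow> 's)
    \<Rightarrow> nat \<Rightarrow> 'w \<Rightarrow> real ^ ('s \<times> 'b)" where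
  "noise2 r p \<eta> \<xi> Q s' n \<omega> = (\<chi> sa.
      (r (fst sa) (snd sa) - g_clip (rnorm r) \<eta> (\<xi> n \<omega>) + maxQ (Q n \<omega>) (s' n \<omega>))
    - (r (fst sa) (snd sa) - g_clip (rnorm r) \<eta> (\<xi> n \<omega>)
         + (\<Sum>s''\<in>UNIV. p (fst sa) (snd sa) s'' * maxQ (Q n \<omega>) s'')))"

definition filtF ::
  "'w measure \<Rightarrow> (nat \<Rightarrow> 'w \<Rightarrow> real) \<Rightarrow> (nat \<Rightarrow> 'w \<Rightarrow> real ^ 'n::finite)
    \<Rightarrow> (nat \<Rightarrow> 'w \<Rightarrow> real) \<Rightarrow> (nat \<Rightarrow> 'w \<Rightarrow> real ^ 'n) \<Rightarrow> nat \<Rightarrow> 'w measure" where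
  "filtF M \<xi> Q w1 w2 k = sigma (space M)
     ((\<Union>n\<in>{..k}. preimgs M (\<xi> n) \<union> preimgs M (Q n)) \<union>
      (\<Union>n\<in>{..<k}. preimgs M (w1 n) \<union> preimgs M (w2 n)))"

text \<open>The enlarged history used to express s'_k ~ p(.|phi_k):
  H_k = sigma(F_k; phi_n, n \<le> k; s'_n, n < k).\<close>
definition filtH ::
  "'w measure \<Rightarrow> (nat \<Rightarrow> 'w \<Rightarrow> real) \<Rightarrow> (nat \<Rightarrow> 'w \<Rightarrow> real ^ 'n::finite)
    \<Rightarrow> (nat \<Rightarrow> 'w \<Rightarrow> real) \<Rightarrow> (nat \<Rightarrow> 'w \<Rightarrow> real ^ 'n)
    \<Rightarrow> (nat \<Rightarrow> 'w \<Rightarrow> 'i) \<Rightarrow> (nat \<Rightarrow> 'w \<Rightarrow> 's) \<Rightarrow> nat \<Rightarrow> 'w measure" where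
  "filtH M \<xi> Q w1 w2 \<phi> s' k = sigma (space M)
     ((\<Union>n\<in>{..k}. preimgs M (\<xi> n) \<union> preimgs M (Q n) \<union> preimgs_discr M (\<phi> n)) \<union>
      (\<Union>n\<in>{..<k}. preimgs M (w1 n) \<union> preimgs M (w2 n) \<union> preimgs_discr M (s' n)))"

end

theory Submission
  imports Defs
begin

text \<open>The noise is normalised by running maxima of the iterates, so that it forms square-integrable martingales that converge
  almost surely; everything else is deterministic along a single path. Let \<open>q\<close> be the solution and \<open>y\<close> the distance of the
  denoised \<open>Q\<close> from \<open>q\<close>. Up to a common drift \<open>f q - g(\<xi>)\<close>, \<open>y\<close> follows asynchronous averaging with an operator that is
  nonexpansive, commutes with constants and, by irreducibility of all stationary policies, contracts the span over windows
  of bounded total step size. As the drift is clipped, the span of \<open>y\<close> is bounded whatever \<open>\<xi>\<close> does. Hence \<open>\<xi>\<close> follows \<open>f Q\<close>, and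
  when \<open>f Q\<close> is large the clipped drift pushes \<open>Q\<close> back, so \<open>Q\<close> is bounded. The assumptions on visits and step sizes make
  all components move at asymptotically equal speed, so that the drift shifts \<open>y\<close> by a constant and the span of \<open>y\<close> tends to
  \<open>0\<close>. Finally every component of \<open>y\<close> follows the scalar recursion with drift \<open>f q - g(f q + u y)\<close>, which leads to \<open>0\<close>.\<close>

section \<open>Convergence of square-integrable martingales\<close>

text \<open>The Bellman operator commutes with constants and hence contracts no norm; only the span
  shrinks. Span and common level of the iterates are therefore treated separately, and the span has
  to be stabilised before anything is known about the level. This dictates two normalisers: the
  second noise is a difference of values of \<open>maxQ (Q k)\<close>, hence of the size of the
  span, and is divided by the running span \<open>Gs\<close>; the first is of the size of the norm
  and is divided by \<open>Gn\<close>. Two further obstacles shape the proof. The common drift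
  reaches the components one at a time, so it acts as a shift only over whole windows in which all
  components receive nearly the same step mass. The assumption merely provides limits of the mass
  ratios; that they equal \<open>1\<close> has to be derived. Moreover the steps of \<open>Q\<close>
  are values of \<open>b\<close> at visit counts, which are fractions of \<open>k\<close>, whereas
  the separation of time scales compares \<open>b\<close> and \<open>a\<close> at equal indices. The
  bound on \<open>b (\<lfloor>x k\<rfloor>) / b k\<close> bridges this gap once it is made uniform
  in \<open>x\<close>.\<close>

lemma integrable_mult_square:
  fixes X Y :: "'w \<Rightarrow> real"
  assumes "X \<in> borel_measurable M" "Y \<in> borel_measurable M"
    and "integrable M (\<lambda>\<omega>. (X \<omega>)\<^sup>2)" "integrable M (\<lambda>\<omega>. (Y \<omega>)\<^sup>2)"
  shows "integrable M (\<lambda>\<omega>. X \<omega> * Y \<omega>)"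
proof (rule Bochner_Integration.integrable_bound)
  show "integrable M (\<lambda>\<omega>. (X \<omega>)\<^sup>2 + (Y \<omega>)\<^sup>2)" using assms by simp
  show "(\<lambda>\<omega>. X \<omega> * Y \<omega>) \<in> borel_measurable M" using assms by simp
  have "\<bar>x * y\<bar> \<le> x\<^sup>2 + y\<^sup>2" for x y :: real
  proof -
    have "0 \<le> (\<bar>x\<bar> - \<bar>y\<bar>)\<^sup>2" by simp
    hence "2 * \<bar>x * y\<bar> \<le> x\<^sup>2 + y\<^sup>2" by (simp add: power2_eq_square algebra_simps abs_mult)
    thus ?thesis using abs_ge_zero[of "x*y"] by linarith
  qed
  thus "AE \<omega> in M. norm (X \<omega> * Y \<omega>) \<le> norm ((X \<omega>)\<^sup>2 + (Y \<omega>)\<^sup>2)" by simp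
qed

lemma cond_exp_zero_orthogonal:
  assumes M: "prob_space M" and sub: "subalgebra M F"
    and Y: "Y \<in> borel_measurable F" "integrable M (\<lambda>\<omega>. (Y \<omega>)\<^sup>2)"
    and D: "D \<in> borel_measurable M" "integrable M (\<lambda>\<omega>. (D \<omega>)\<^sup>2)"
    and mean: "AE \<omega> in M. real_cond_exp M F D \<omega> = 0"
  shows "(\<integral>\<omega>. Y \<omega> * D \<omega> \<partial>M) = 0"
proof -
  interpret prob_space M by fact
  interpret finite_measure_subalgebra M F by unfold_locales fact
  have YM: "Y \<in> borel_measurable M" using measurable_from_subalg[OF sub Y(1)] .
  have "(\<integral>\<omega>. Y \<omega> * D \<omega> \<partial>M) = (\<integral>\<omega>. Y \<omega> * real_cond_exp M F D \<omega> \<partial>M)"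
    using real_cond_exp_intg(2)[OF integrable_mult_square[OF YM D(1) Y(2) D(2)] Y(1) D(1)] by simp
  also have "\<dots> = (\<integral>\<omega>. 0 \<partial>M)"
    by (rule integral_cong_AE) (use mean YM in auto)
  finally show ?thesis by simp
qed

text \<open>Kolmogorov's inequality, by Chebyshev for the martingale stopped at the first exceedance of \<open>\<epsilon>\<close>.\<close>

lemma L2_martingale_maximal:
  fixes D :: "nat \<Rightarrow> 'w \<Rightarrow> real" and F :: "nat \<Rightarrow> 'w measure"
  assumes M: "prob_space M"
    and sub: "\<And>k. subalgebra M (F k)"
    and mono: "\<And>j k. j \<le> k \<Longrightarrow> sets (F j) \<subseteq> sets (F k)"
    and meas: "\<And>k. D k \<in> borel_measurable (F (Suc k))"
    and sq: "\<And>k. integrable M (\<lambda>\<omega>. (D k \<omega>)\<^sup>2)"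
    and mean: "\<And>k. AE \<omega> in M. real_cond_exp M (F k) (D k) \<omega> = 0"
    and e: "\<epsilon> > 0"
  shows "measure M {\<omega> \<in> space M. \<exists>k\<le>m. \<bar>\<Sum>j<k. D j \<omega>\<bar> \<ge> \<epsilon>} \<le> (\<Sum>j<m. \<integral>\<omega>. (D j \<omega>)\<^sup>2 \<partial>M) / \<epsilon>\<^sup>2"
proof -
  interpret prob_space M by fact
  have spF: "space (F k) = space M" for k using sub by (simp add: subalgebra_def)
  have sub2: "subalgebra (F k) (F j)" if "j \<le> k" for j k
    using mono[OF that] spF by (simp add: subalgebra_def)
  define S where "S k \<omega> = (\<Sum>j<k. D j \<omega>)" for k \<omega>
  have DF: "D j \<in> borel_measurable (F k)" if "j < k" for j k
    using measurable_from_subalg[OF sub2 meas] that by (metis Suc_leI)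
  have SF: "S i \<in> borel_measurable (F k)" if "i \<le> k" for i k
    unfolding S_def using that by (intro borel_measurable_sum DF) auto
  define A where "A j = {\<omega> \<in> space M. \<forall>i\<le>j. \<bar>S i \<omega>\<bar> < \<epsilon>}" for j
  have AF: "A j \<in> sets (F j)" for j
  proof -
    have [measurable]: "i \<in> {..j} \<Longrightarrow> S i \<in> borel_measurable (F j)" for i using SF by auto
    have "A j = {\<omega> \<in> space (F j). \<forall>i\<in>{..j}. \<bar>S i \<omega>\<bar> < \<epsilon>}" unfolding A_def spF by auto
    also have "\<dots> \<in> sets (F j)" by measurable
    finally show ?thesis .
  qed
  \<comment> \<open>\<open>A j\<close> is known at time \<open>j\<close>, so the factor is
    predictable: \<open>T\<close> is \<open>S\<close> stopped when the level
    \<open>\<epsilon>\<close> is first reached, and its increments remain orthogonal.\<close>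
  define D' where "D' j \<omega> = D j \<omega> * indicator (A j) \<omega>" for j \<omega>
  define T where "T k \<omega> = (\<Sum>j<k. D' j \<omega>)" for k \<omega>
  have D'F: "D' j \<in> borel_measurable (F k)" if "j < k" for j k
    unfolding D'_def using AF[of j] mono[of j k] that
    by (intro borel_measurable_times DF borel_measurable_indicator) auto
  have TF: "T k \<in> borel_measurable (F k)" for k
    unfolding T_def by (intro borel_measurable_sum D'F) auto
  have TM: "T k \<in> borel_measurable M" for k using measurable_from_subalg[OF sub TF] .
  have DM: "D k \<in> borel_measurable M" for k using measurable_from_subalg[OF sub meas] .
  have D'M: "D' k \<in> borel_measurable M" for k using measurable_from_subalg[OF sub D'F] by blast
  have D'le: "(D' k \<omega>)\<^sup>2 \<le> (D k \<omega>)\<^sup>2" for k \<omega> unfolding D'_def by (simp add: indicator_def)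
  have D'sq: "integrable M (\<lambda>\<omega>. (D' k \<omega>)\<^sup>2)" for k
    by (rule Bochner_Integration.integrable_bound[OF sq[of k]]) (use D'M D'le in auto)
  have T: "integrable M (\<lambda>\<omega>. (T k \<omega>)\<^sup>2) \<and> (\<integral>\<omega>. (T k \<omega>)\<^sup>2 \<partial>M) = (\<Sum>j<k. \<integral>\<omega>. (D' j \<omega>)\<^sup>2 \<partial>M)" for k
  proof (induction k)
    case 0 show ?case by (simp add: T_def)
  next
    case (Suc k)
    have Tind: "(\<lambda>\<omega>. T k \<omega> * indicator (A k) \<omega>) \<in> borel_measurable (F k)"
      by (intro borel_measurable_times TF borel_measurable_indicator AF)
    have i1: "integrable M (\<lambda>\<omega>. (T k \<omega> * indicator (A k) \<omega>)\<^sup>2)"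
      by (rule Bochner_Integration.integrable_bound[OF conjunct1[OF Suc]])
        (use measurable_from_subalg[OF sub Tind] in \<open>auto simp: indicator_def\<close>)
    \<comment> \<open>The indicator is attached to the past \<open>T k\<close> instead of the
      increment, so that the hypothesis on \<open>D k\<close> applies as it stands.\<close>
    have eq: "T k \<omega> * D' k \<omega> = (T k \<omega> * indicator (A k) \<omega>) * D k \<omega>" for \<omega>
      by (simp add: D'_def)
    have z: "(\<integral>\<omega>. T k \<omega> * D' k \<omega> \<partial>M) = 0" unfolding eq
      by (rule cond_exp_zero_orthogonal[OF M sub Tind i1 DM sq mean])
    have i2: "integrable M (\<lambda>\<omega>. T k \<omega> * D' k \<omega>)"
      using integrable_mult_square[OF TM D'M _ D'sq] Suc by blast
    have sqs: "(T (Suc k) \<omega>)\<^sup>2 = (T k \<omega>)\<^sup>2 + 2 * (T k \<omega> * D' k \<omega>) + (D' k \<omega>)\<^sup>2" for \<omega>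
      by (simp add: T_def power2_eq_square algebra_simps)
    show ?case unfolding sqs using Suc i2 D'sq z by simp
  qed
  have sub_ev: "{\<omega> \<in> space M. \<exists>k\<le>m. \<bar>S k \<omega>\<bar> \<ge> \<epsilon>} \<subseteq> {\<omega> \<in> space M. (T m \<omega>)\<^sup>2 \<ge> \<epsilon>\<^sup>2}"
  proof safe
    fix \<omega> k assume w: "\<omega> \<in> space M" and k: "k \<le> m" "\<bar>S k \<omega>\<bar> \<ge> \<epsilon>"
    define k0 where "k0 = (LEAST k. \<bar>S k \<omega>\<bar> \<ge> \<epsilon>)"
    have k0: "\<bar>S k0 \<omega>\<bar> \<ge> \<epsilon>" and le: "k0 \<le> k" unfolding k0_def using k by (auto intro: LeastI Least_le)
    have lt: "\<bar>S i \<omega>\<bar> < \<epsilon>" if "i < k0" for i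
      using not_less_Least[of i "\<lambda>k. \<bar>S k \<omega>\<bar> \<ge> \<epsilon>"] that unfolding k0_def by auto
    have "T m \<omega> = (\<Sum>j<m. if j < k0 then D j \<omega> else 0)" unfolding T_def
    proof (rule sum.cong[OF refl])
      fix j show "D' j \<omega> = (if j < k0 then D j \<omega> else 0)"
      proof (cases "j < k0")
        case True
        hence "\<omega> \<in> A j" using lt w unfolding A_def by auto
        thus ?thesis using True by (simp add: D'_def)
      next
        case False
        hence "\<omega> \<notin> A j" using k0 unfolding A_def by (auto simp: not_less)
        thus ?thesis using False by (simp add: D'_def)
      qed
    qed
    also have "\<dots> = (\<Sum>j\<in>{..<m} \<inter> {j. j < k0}. D j \<omega>)" by (simp add: sum.inter_restrict)
    also have "{..<m} \<inter> {j. j < k0} = {..<k0}" using le k by auto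
    finally have "T m \<omega> = S k0 \<omega>" by (simp add: S_def)
    hence "\<epsilon>\<^sup>2 \<le> \<bar>T m \<omega>\<bar>\<^sup>2" using k0 e by (intro power_mono) auto
    thus "\<epsilon>\<^sup>2 \<le> (T m \<omega>)\<^sup>2" by simp
  qed
  have "measure M {\<omega> \<in> space M. \<exists>k\<le>m. \<bar>S k \<omega>\<bar> \<ge> \<epsilon>} \<le> measure M {\<omega> \<in> space M. (T m \<omega>)\<^sup>2 \<ge> \<epsilon>\<^sup>2}"
    using TM by (intro finite_measure_mono sub_ev) simp
  also have "\<dots> \<le> (\<integral>\<omega>. (T m \<omega>)\<^sup>2 \<partial>M) / \<epsilon>\<^sup>2"
    using integral_Markov_inequality_measure[of M "\<lambda>\<omega>. (T m \<omega>)\<^sup>2" "space M" "\<epsilon>\<^sup>2"] T[of m] e TM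
    by auto
  also have "\<dots> \<le> (\<Sum>j<m. \<integral>\<omega>. (D j \<omega>)\<^sup>2 \<partial>M) / \<epsilon>\<^sup>2"
    using T[of m] e by (intro divide_right_mono) (auto intro!: sum_mono integral_mono D'sq sq D'le)
  finally show ?thesis by (simp add: S_def)
qed

text \<open>The maximal inequality, applied to the sums started at \<open>n\<close> with the
  filtration shifted by \<open>n\<close>, bounds the probability that they ever reach
  \<open>\<epsilon>\<close> by a tail of the variance series. Almost surely, therefore, each
  tolerance has a starting point beyond which all sums stay small, and the partial sums are
  Cauchy.\<close>

theorem L2_martingale_convergence:
  fixes D :: "nat \<Rightarrow> 'w \<Rightarrow> real" and F :: "nat \<Rightarrow> 'w measure"
  assumes M: "prob_space M"
    and sub: "\<And>k. subalgebra M (F k)"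
    and mono: "\<And>j k. j \<le> k \<Longrightarrow> sets (F j) \<subseteq> sets (F k)"
    and meas: "\<And>k. D k \<in> borel_measurable (F (Suc k))"
    and sq: "\<And>k. integrable M (\<lambda>\<omega>. (D k \<omega>)\<^sup>2)"
    and mean: "\<And>k. AE \<omega> in M. real_cond_exp M (F k) (D k) \<omega> = 0"
    and summ: "summable (\<lambda>k. \<integral>\<omega>. (D k \<omega>)\<^sup>2 \<partial>M)"
  shows "AE \<omega> in M. summable (\<lambda>k. D k \<omega>)"
proof -
  interpret prob_space M by fact
  have DM[measurable]: "D k \<in> borel_measurable M" for k using measurable_from_subalg[OF sub meas] .
  define V where "V k = (\<integral>\<omega>. (D k \<omega>)\<^sup>2 \<partial>M)" for k
  have V0: "V k \<ge> 0" for k unfolding V_def by simp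
  define tail where "tail n = (\<Sum>k. V (k + n))" for n
  have tl: "tail \<longlonglongrightarrow> 0" unfolding tail_def using suminf_exist_split2[of V] summ unfolding V_def[abs_def] by blast
  have ev: "AE \<omega> in M. \<exists>n. \<forall>k. \<bar>\<Sum>j<k. D (n + j) \<omega>\<bar> < \<epsilon>" if e: "\<epsilon> > 0" for \<epsilon> :: real
  proof -
    define B where "B n m = {\<omega> \<in> space M. \<exists>k\<le>m. \<bar>\<Sum>j<k. D (n + j) \<omega>\<bar> \<ge> \<epsilon>}" for n m
    have Bm[measurable]: "B n m \<in> sets M" for n m unfolding B_def by measurable
    have bnd: "measure M (B n m) \<le> tail n / \<epsilon>\<^sup>2" for n m
    proof -
      have "measure M (B n m) \<le> (\<Sum>j<m. \<integral>\<omega>. (D (n + j) \<omega>)\<^sup>2 \<partial>M) / \<epsilon>\<^sup>2" unfolding B_def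
        by (rule L2_martingale_maximal[where F="\<lambda>k. F (n + k)"])
          (use M sub mono meas sq mean e in auto)
      also have "(\<Sum>j<m. \<integral>\<omega>. (D (n + j) \<omega>)\<^sup>2 \<partial>M) = (\<Sum>j<m. V (j + n))" by (simp add: V_def add.commute)
      also have "\<dots> \<le> tail n" unfolding tail_def
        using summ V0 by (intro sum_le_suminf) (auto simp: V_def[symmetric] summable_iff_shift[of V])
      finally show ?thesis using e by (simp add: divide_right_mono)
    qed
    have bndU: "measure M (\<Union>m. B n m) \<le> tail n / \<epsilon>\<^sup>2" for n
    proof -
      have "incseq (B n)" unfolding B_def incseq_def by (auto intro: le_trans)
      hence "(\<lambda>m. measure M (B n m)) \<longlonglongrightarrow> measure M (\<Union>m. B n m)"
        by (intro finite_Lim_measure_incseq) auto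
      thus ?thesis by (rule LIMSEQ_le_const2) (use bnd in auto)
    qed
    define N where "N = (\<Inter>n. \<Union>m. B n m)"
    have Nm[measurable]: "N \<in> sets M" unfolding N_def by measurable
    have "measure M N \<le> tail n / \<epsilon>\<^sup>2" for n
      using order_trans[OF finite_measure_mono[of N "\<Union>m. B n m"] bndU[of n]] by (auto simp: N_def)
    moreover have "(\<lambda>n. tail n / \<epsilon>\<^sup>2) \<longlonglongrightarrow> 0" using tendsto_divide_zero[OF tl] .
    ultimately have "measure M N \<le> 0" by (intro LIMSEQ_le_const[of _ 0 "measure M N"]) auto
    hence "measure M N = 0" by (simp add: measure_le_0_iff)
    hence "N \<in> null_sets M" using Nm by (simp add: emeasure_eq_measure null_sets_def)
    moreover have "{\<omega> \<in> space M. \<not> (\<exists>n. \<forall>k. \<bar>\<Sum>j<k. D (n + j) \<omega>\<bar> < \<epsilon>)} \<subseteq> N"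
      unfolding N_def B_def by (clarsimp simp: not_less) (meson order_refl)
    ultimately show ?thesis by (rule AE_I')
  qed
  have "AE \<omega> in M. \<forall>r. \<exists>n. \<forall>k. \<bar>\<Sum>j<k. D (n + j) \<omega>\<bar> < 1 / real (Suc r)"
    unfolding AE_all_countable by (intro allI ev) simp
  thus ?thesis
  proof (rule AE_mp, intro AE_I2 impI)
    fix \<omega> assume H: "\<forall>r. \<exists>n. \<forall>k. \<bar>\<Sum>j<k. D (n + j) \<omega>\<bar> < 1 / real (Suc r)"
    show "summable (\<lambda>k. D k \<omega>)" unfolding summable_Cauchy
    proof (intro allI impI)
      fix e :: real assume "e > 0"
      then obtain r where r: "1 / real (Suc r) < e / 2" using nat_approx_posE[of "e/2"] by auto
      obtain n where n: "\<And>k. \<bar>\<Sum>j<k. D (n + j) \<omega>\<bar> < 1 / real (Suc r)" using H by blast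
      have part: "\<bar>\<Sum>j\<in>{n..<k}. D j \<omega>\<bar> < e / 2" if "k \<ge> n" for k
      proof -
        have "(\<Sum>j\<in>{n..<k}. D j \<omega>) = (\<Sum>j<k-n. D (n + j) \<omega>)"
          using sum.shift_bounds_nat_ivl[of "\<lambda>j. D j \<omega>" 0 n "k-n"] that
          by (simp add: add.commute atLeast0LessThan)
        thus ?thesis using n[of "k-n"] r by linarith
      qed
      show "\<exists>N. \<forall>m\<ge>N. \<forall>n. norm (\<Sum>k = m..<n. D k \<omega>) < e"
      proof (intro exI[of _ n] allI impI)
        fix m k assume m: "m \<ge> n"
        show "norm (\<Sum>j = m..<k. D j \<omega>) < e"
        proof (cases "k \<ge> m")
          case True
          have "(\<Sum>j = n..<m. D j \<omega>) + (\<Sum>j = m..<k. D j \<omega>) = (\<Sum>j = n..<k. D j \<omega>)"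
            using True m by (simp add: sum.atLeastLessThan_concat)
          thus ?thesis using part[of m] part[of k] True m by (simp add: abs_less_iff) linarith
        qed (use \<open>e > 0\<close> in auto)
      qed
    qed
  qed
qed

section \<open>Average-reward Markov decision processes\<close>

lemma maxQ_ge: "q $ (s, a) \<le> maxQ q s"
  unfolding maxQ_def by (rule Max_ge) auto

lemma maxQ_le_iff: "maxQ q s \<le> c \<longleftrightarrow> (\<forall>a. q $ (s, a) \<le> c)"
  unfolding maxQ_def by (subst Max_le_iff) auto

lemma maxQ_attained: "\<exists>a. maxQ q s = q $ (s, a)"
proof -
  have "maxQ q s \<in> range (\<lambda>a. q $ (s, a))" unfolding maxQ_def by (rule Max_in) auto
  thus ?thesis by auto
qed

lemma maxQ_eqI: "(\<And>a. q $ (s, a) = c) \<Longrightarrow> maxQ q s = c"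
  using maxQ_attained[of q s] by auto

lemma maxQ_shift: "maxQ (q + c *\<^sub>R ones) s = maxQ q s + c"
proof (rule antisym)
  show "maxQ (q + c *\<^sub>R ones) s \<le> maxQ q s + c"
    by (simp add: maxQ_le_iff ones_def maxQ_ge)
  obtain a where a: "maxQ q s = q $ (s, a)" using maxQ_attained by blast
  have "(q + c *\<^sub>R ones) $ (s, a) \<le> maxQ (q + c *\<^sub>R ones) s" by (rule maxQ_ge)
  thus "maxQ q s + c \<le> maxQ (q + c *\<^sub>R ones) s" using a by (simp add: ones_def)
qed

lemma maxQ_diff_le:
  assumes "\<And>a. q $ (s, a) - q' $ (s, a) \<le> c"
  shows "maxQ q s - maxQ q' s \<le> c"
proof -
  have "q $ (s, a) \<le> maxQ q' s + c" for a
    using assms[of a] maxQ_ge[of q' s a] by linarith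
  hence "maxQ q s \<le> maxQ q' s + c" by (simp add: maxQ_le_iff)
  thus ?thesis by simp
qed

lemma maxQ_diff_abs_le:
  assumes "\<And>i. \<bar>q $ i - q' $ i\<bar> \<le> c"
  shows "\<bar>maxQ q s - maxQ q' s\<bar> \<le> c"
proof -
  have "maxQ q s - maxQ q' s \<le> c"
    by (rule maxQ_diff_le) (use assms in \<open>smt (verit)\<close>)
  moreover have "maxQ q' s - maxQ q s \<le> c"
    by (rule maxQ_diff_le) (use assms in \<open>smt (verit)\<close>)
  ultimately show ?thesis by simp
qed

lemma maxQ_lipschitz: "\<bar>maxQ q s - maxQ q' s\<bar> \<le> norm (q - q')"
  by (rule maxQ_diff_abs_le) (metis component_le_norm_cart vector_minus_component)

lemma isCont_maxQ: "isCont (\<lambda>q. maxQ q s) q"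
  unfolding isCont_def
proof (rule LIM_I)
  fix e :: real assume "e > 0"
  thus "\<exists>d>0. \<forall>x'. x' \<noteq> q \<and> norm (x' - q) < d \<longrightarrow> norm (maxQ x' s - maxQ q s) < e"
    using maxQ_lipschitz[of _ s q] by (intro exI[of _ e]) (auto intro: le_less_trans)
qed

lemma tendsto_maxQ [tendsto_intros]:
  assumes "(g \<longlongrightarrow> l) F"
  shows "((\<lambda>x. maxQ (g x) s) \<longlongrightarrow> maxQ l s) F"
  using isCont_maxQ assms by (rule isCont_tendsto_compose)

lemma continuous_on_maxQ [continuous_intros]:
  assumes "continuous_on A g"
  shows "continuous_on A (\<lambda>x. maxQ (g x) s)"
  using assms unfolding continuous_on_def by (auto intro: tendsto_maxQ)

lemma rnorm_ge: "\<bar>r s a\<bar> \<le> rnorm r"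
  unfolding rnorm_def by (rule Max_ge) (auto intro!: image_eqI[of _ _ "(s, a)"])

lemma rnorm_nonneg: "0 \<le> rnorm r"
  using rnorm_ge[of r undefined undefined] by linarith

lemma mdp_nonneg: "is_mdp p \<Longrightarrow> 0 \<le> p s a s'"
  by (simp add: is_mdp_def)

lemma mdp_sum: "is_mdp p \<Longrightarrow> (\<Sum>s'\<in>UNIV. p s a s') = 1"
  by (simp add: is_mdp_def)

lemma mdp_avg_le:
  assumes "is_mdp p" "\<And>s'. w s' \<le> c"
  shows "(\<Sum>s'\<in>UNIV. p s a s' * w s') \<le> c"
proof -
  have "(\<Sum>s'\<in>UNIV. p s a s' * w s') \<le> (\<Sum>s'\<in>UNIV. p s a s' * c)"
    using assms by (intro sum_mono mult_left_mono) (auto simp: mdp_nonneg)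
  thus ?thesis using assms by (simp add: sum_distrib_right[symmetric] mdp_sum)
qed

lemma mdp_avg_ge:
  assumes "is_mdp p" "\<And>s'. c \<le> w s'"
  shows "c \<le> (\<Sum>s'\<in>UNIV. p s a s' * w s')"
  using mdp_avg_le[of p "\<lambda>s'. - w s'" "- c" s a] assms by (simp add: sum_negf)

lemma mdp_avg_abs_le:
  assumes "is_mdp p" "\<And>s'. \<bar>w s'\<bar> \<le> c"
  shows "\<bar>\<Sum>s'\<in>UNIV. p s a s' * w s'\<bar> \<le> c"
proof -
  have "(\<Sum>s'\<in>UNIV. p s a s' * w s') \<le> c"
    by (rule mdp_avg_le[OF assms(1)]) (use assms(2) abs_le_D1 in blast)
  moreover have "- c \<le> (\<Sum>s'\<in>UNIV. p s a s' * w s')"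
    by (rule mdp_avg_ge[OF assms(1)]) (use assms(2) in \<open>simp add: abs_le_iff minus_le_iff\<close>)
  ultimately show ?thesis by simp
qed

lemma mdp_avg_shift:
  assumes "is_mdp p"
  shows "(\<Sum>s'\<in>UNIV. p s a s' * (w s' + c)) = (\<Sum>s'\<in>UNIV. p s a s' * w s') + c"
  using mdp_sum[OF assms] by (simp add: distrib_left sum.distrib sum_distrib_right[symmetric])

text \<open>The least of finitely many positive probabilities; \<open>1\<close> is inserted so that
  the set is nonempty and \<open>c \<le> 1\<close>. This constant turns reachability of a state into
  quantitative estimates.\<close>

lemma mdp_pos_lower_bound:
  fixes p :: "'s::finite \<Rightarrow> 'b::finite \<Rightarrow> 's \<Rightarrow> real"
  shows "\<exists>c>0. c \<le> 1 \<and> (\<forall>s a s'. p s a s' > 0 \<longrightarrow> c \<le> p s a s')"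
proof -
  define V where "V = insert 1 {p s a s' | s a s'. p s a s' > 0}"
  have "V \<subseteq> insert 1 (range (\<lambda>(s, a, s'). p s a s'))" 
  proof
    fix x assume "x \<in> V"
    then consider "x = 1" | s a s' where "x = p s a s'" unfolding V_def by blast
    thus "x \<in> insert 1 (range (\<lambda>(s, a, s'). p s a s'))"
      by cases (auto intro: range_eqI[where x="(_, _, _)"])
  qed
  hence fin: "finite V" by (rule finite_subset) auto
  have "Min V \<in> V" using fin by (intro Min_in) (auto simp: V_def)
  hence "Min V > 0" by (auto simp: V_def)
  moreover have "Min V \<le> x" if "x \<in> V" for x using fin that by simp
  moreover have "1 \<in> V" "\<And>s a s'. p s a s' > 0 \<Longrightarrow> p s a s' \<in> V" unfolding V_def by auto
  ultimately show ?thesis by (intro exI[of _ "Min V"]) auto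
qed

text \<open>Each application adds at least one element until nothing is missing. The lemma bounds
  the number of rounds, later of time windows, in which an estimate spreads from some states to
  all.\<close>

lemma iterate_to_UNIV:
  fixes F :: "'a::finite set \<Rightarrow> 'a set"
  assumes infl: "\<And>G. G \<subseteq> F G"
    and full: "\<And>G. G \<noteq> {} \<Longrightarrow> F G = G \<Longrightarrow> G = UNIV"
    and ne: "G \<noteq> {}"
  shows "(F ^^ CARD('a)) G = UNIV"
proof -
  have ne': "(F ^^ n) G \<noteq> {}" for n
    by (induction n) (use ne infl in auto)
  have "(F ^^ n) G = UNIV \<or> n \<le> card ((F ^^ n) G)" for n
  proof (induction n)
    case (Suc n)
    show ?case
    proof (cases "(F ^^ n) G = UNIV")
      case True
      thus ?thesis using infl[of UNIV] by auto
    next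
      case False
      hence "F ((F ^^ n) G) \<noteq> (F ^^ n) G" using full[OF ne'] by blast
      hence "(F ^^ n) G \<subset> F ((F ^^ n) G)" using infl by blast
      hence "card ((F ^^ n) G) < card (F ((F ^^ n) G))" by (intro psubset_card_mono) auto
      thus ?thesis using Suc False by auto
    qed
  qed simp
  from this[of "CARD('a)"] show ?thesis
    using card_seteq[of UNIV "(F ^^ CARD('a)) G"] by auto
qed

section \<open>Irreducible chains and sets closed under a policy\<close>

lemma nstep_nonneg:
  assumes "\<And>i j. 0 \<le> P i j"
  shows "0 \<le> nstep P n i j"
  by (induction n arbitrary: i) (auto intro!: sum_nonneg mult_nonneg_nonneg assms)

lemma nstep_Suc_right: "nstep P (Suc n) i j = (\<Sum>k\<in>UNIV. nstep P n i k * P k j)"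
proof (induction n arbitrary: i)
  case 0
  have "(\<Sum>k\<in>UNIV. P i k * (if k = j then 1 else 0)) = P i j"
    by (simp add: if_distrib cong: if_cong)
  moreover have "(\<Sum>k\<in>UNIV. (if i = k then 1 else 0) * P k j) = P i j"
  proof -
    have "(\<Sum>k\<in>UNIV. (if i = k then 1 else 0) * P k j) = (\<Sum>k\<in>UNIV. if i = k then P k j else 0)"
      by (intro sum.cong) auto
    thus ?thesis by simp
  qed
  ultimately show ?case by simp
next
  case (Suc n)
  have "nstep P (Suc (Suc n)) i j = (\<Sum>k\<in>UNIV. \<Sum>l\<in>UNIV. P i k * (nstep P n k l * P l j))"
    by (subst nstep.simps(2)) (simp only: Suc sum_distrib_left)
  also have "\<dots> = (\<Sum>l\<in>UNIV. \<Sum>k\<in>UNIV. P i k * (nstep P n k l * P l j))" by (rule sum.swap)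
  also have "\<dots> = (\<Sum>l\<in>UNIV. nstep P (Suc n) i l * P l j)"
    by (simp add: sum_distrib_right sum_distrib_left mult.assoc)
  finally show ?case .
qed

lemma nstep_sum:
  assumes "\<And>i. (\<Sum>j\<in>UNIV. P i j) = 1"
  shows "(\<Sum>j\<in>UNIV. nstep P n i j) = 1"
proof (induction n arbitrary: i)
  case 0 show ?case by simp
next
  case (Suc n)
  have "(\<Sum>j\<in>UNIV. nstep P (Suc n) i j) = (\<Sum>k\<in>UNIV. \<Sum>j\<in>UNIV. P i k * nstep P n k j)"
    unfolding nstep.simps by (rule sum.swap)
  also have "\<dots> = 1" by (simp add: sum_distrib_left[symmetric] Suc assms)
  finally show ?case .
qed

lemma irreducible_forward_closed:
  assumes irr: "irreducible_chain P" and nn: "\<And>i j. 0 \<le> P i j"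
    and ne: "G \<noteq> {}" and cl: "\<And>s s'. s \<in> G \<Longrightarrow> P s s' > 0 \<Longrightarrow> s' \<in> G"
  shows "G = UNIV"
proof (rule ccontr)
  assume "G \<noteq> UNIV"
  then obtain j where j: "j \<notin> G" by auto
  obtain i where i: "i \<in> G" using ne by auto
  have "nstep P n i j = 0" if "i \<in> G" for n i using that
  proof (induction n arbitrary: i)
    case 0 thus ?case using j by auto
  next
    case (Suc n)
    have "P i k * nstep P n k j = 0" for k
      using Suc cl[of i k] nn[of i k] by (cases "P i k = 0") auto
    thus ?case unfolding nstep.simps by (intro sum.neutral ballI)
  qed
  thus False using irr i unfolding irreducible_chain_def by (metis less_irrefl)
qed

lemma irreducible_backward_closed:
  assumes irr: "irreducible_chain P" and nn: "\<And>i j. 0 \<le> P i j"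
    and ne: "G \<noteq> {}" and cl: "\<And>s s'. s' \<in> G \<Longrightarrow> P s s' > 0 \<Longrightarrow> s \<in> G"
  shows "G = UNIV"
proof -
  have "- G = {} \<or> - G = UNIV"
    using irreducible_forward_closed[OF irr nn, of "- G"] cl by blast
  thus ?thesis using ne by auto
qed

definition det_policy :: "('s \<Rightarrow> 'b) \<Rightarrow> 's \<Rightarrow> 'b \<Rightarrow> real" where
  "det_policy d s a = (if a = d s then 1 else 0)"

lemma stationary_det_policy: "stationary_policy (det_policy d)"
  unfolding stationary_policy_def det_policy_def by simp

lemma policy_chain_det: "policy_chain p (det_policy d) s s' = p s (d s) s'"
proof -
  have "policy_chain p (det_policy d) s s' = (\<Sum>a\<in>UNIV. if a = d s then p s a s' else 0)"
    unfolding policy_chain_def det_policy_def by (intro sum.cong) auto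
  thus ?thesis by simp
qed

text \<open>The form in which ergodicity is used. It speaks of all stationary policies because the
  closure arguments choose their policy afterwards: greedy for some \<open>q\<close>, or avoiding
  some set.\<close>

definition policy_irreducible :: "('s::finite \<Rightarrow> 'b::finite \<Rightarrow> 's \<Rightarrow> real) \<Rightarrow> bool" where
  "policy_irreducible p \<longleftrightarrow> (\<forall>\<pi>. stationary_policy \<pi> \<longrightarrow> irreducible_chain (policy_chain p \<pi>))"

lemma policy_irreducible_det: "policy_irreducible p \<Longrightarrow> irreducible_chain (\<lambda>s s'. p s (d s) s')"
proof -
  assume "policy_irreducible p"
  moreover have "policy_chain p (det_policy d) = (\<lambda>s s'. p s (d s) s')"
    by (intro ext policy_chain_det)
  ultimately show ?thesis using stationary_det_policy[of d] unfolding policy_irreducible_def by metis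
qed

lemma policy_forward_closed:
  assumes "is_mdp p" "policy_irreducible p" "G \<noteq> {}"
    and "\<And>s s'. s \<in> G \<Longrightarrow> p s (d s) s' > 0 \<Longrightarrow> s' \<in> G"
  shows "G = UNIV"
  using irreducible_forward_closed[OF policy_irreducible_det[OF assms(2)], of d G] assms
  by (auto simp: mdp_nonneg)

lemma policy_backward_closed:
  assumes "is_mdp p" "policy_irreducible p" "G \<noteq> {}"
    and "\<And>s s'. s' \<in> G \<Longrightarrow> p s (d s) s' > 0 \<Longrightarrow> s \<in> G"
  shows "G = UNIV"
  using irreducible_backward_closed[OF policy_irreducible_det[OF assms(2)], of d G] assms
  by (auto simp: mdp_nonneg)

text \<open>Brouwer's theorem on the box of radius \<open>B\<close>, which the Bellman operator maps
  into itself because \<open>rnorm r + \<gamma> * B = B\<close>. The explicit radius is what keeps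
  \<open>(1 - \<gamma>) * q\<close> bounded as \<open>\<gamma>\<close> tends to
  \<open>1\<close>.\<close>

lemma discounted_fixed_point:
  fixes r :: "'s::finite \<Rightarrow> 'b::finite \<Rightarrow> real"
  assumes mdp: "is_mdp p" and g: "0 \<le> \<gamma>" "\<gamma> < 1"
  shows "\<exists>q :: real ^ ('s \<times> 'b). (\<forall>s a. q $ (s, a) = r s a + \<gamma> * (\<Sum>s'\<in>UNIV. p s a s' * maxQ q s'))
     \<and> (\<forall>i. \<bar>q $ i\<bar> \<le> rnorm r / (1 - \<gamma>))"
proof -
  define B where "B = rnorm r / (1 - \<gamma>)"
  have B0: "B \<ge> 0" unfolding B_def using g rnorm_nonneg[of r] by simp
  have B: "rnorm r + \<gamma> * B = B" unfolding B_def using g by (simp add: field_simps)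
  define K :: "(real ^ ('s \<times> 'b)) set" where "K = cbox (\<chi> i. - B) (\<chi> i. B)"
  have K: "q \<in> K \<longleftrightarrow> (\<forall>i. \<bar>q $ i\<bar> \<le> B)" for q
  proof -
    have "- B \<le> x \<and> x \<le> B \<longleftrightarrow> \<bar>x\<bar> \<le> B" for x :: real by linarith
    thus ?thesis unfolding K_def by (simp add: mem_box_cart)
  qed
  define L :: "real ^ ('s \<times> 'b) \<Rightarrow> real ^ ('s \<times> 'b)" where
    "L q = (\<chi> i. r (fst i) (snd i) + \<gamma> * (\<Sum>s'\<in>UNIV. p (fst i) (snd i) s' * maxQ q s'))" for q
  obtain q where q: "q \<in> K" "L q = q"
  proof (rule brouwer)
    show "compact K" "convex K" unfolding K_def by auto
    have "0 \<in> K" unfolding K using B0 by simp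
    thus "K \<noteq> {}" by auto
    show "continuous_on K L" unfolding L_def by (intro continuous_intros)
    show "L \<in> K \<rightarrow> K"
    proof
      fix q assume q: "q \<in> K"
      have m: "\<bar>maxQ q s\<bar> \<le> B" for s using maxQ_attained[of q s] q K by metis
      show "L q \<in> K" unfolding K
      proof
        fix i
        have "\<bar>\<gamma> * (\<Sum>s'\<in>UNIV. p (fst i) (snd i) s' * maxQ q s')\<bar> \<le> \<gamma> * B"
          using mdp_avg_abs_le[OF mdp m] g by (simp add: abs_mult mult_left_mono)
        thus "\<bar>L q $ i\<bar> \<le> B" using rnorm_ge[of r "fst i" "snd i"] B unfolding L_def by simp
      qed
    qed
  qed
  have "q $ (s, a) = r s a + \<gamma> * (\<Sum>s'\<in>UNIV. p s a s' * maxQ q s')" for s a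
    using arg_cong[OF q(2), of "\<lambda>v. v $ (s, a)"] by (simp add: L_def)
  moreover have "\<bar>q $ i\<bar> \<le> rnorm r / (1 - \<gamma>)" for i using q(1) unfolding K B_def by blast
  ultimately show ?thesis by (intro exI[of _ q] conjI allI)
qed

text \<open>The bound must not deteriorate as \<open>\<gamma>\<close> tends to \<open>1\<close>.
  Values \<open>w\<close> are measured from a state \<open>s0\<close> of least value. If
  \<open>w s\<close> is small, the equation at \<open>s\<close> bounds the mean of the nonnegative
  \<open>w\<close> over the successors of \<open>s\<close> under the greedy policy, hence
  \<open>w\<close> at each successor, at the price of a factor \<open>2 / c\<close>; the
  \<open>2\<close> comes from \<open>\<gamma> \<ge> 1/2\<close>. All states are reached from
  \<open>s0\<close> in \<open>CARD('s)\<close> rounds, and \<open>C\<close> iterates the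
  price.\<close>

lemma discounted_span_bound:
  fixes r :: "'s::finite \<Rightarrow> 'b::finite \<Rightarrow> real"
  assumes mdp: "is_mdp p" and irr: "policy_irreducible p"
  shows "\<exists>K. \<forall>\<gamma> q. 1/2 \<le> \<gamma> \<longrightarrow> \<gamma> < 1 \<longrightarrow>
     (\<forall>s a. q $ (s, a) = r s a + \<gamma> * (\<Sum>s'\<in>UNIV. p s a s' * maxQ q s')) \<longrightarrow>
     (\<forall>i. \<bar>q $ i\<bar> \<le> rnorm r / (1 - \<gamma>)) \<longrightarrow> (\<forall>s s'. maxQ q s - maxQ q s' \<le> K)"
proof -
  obtain c where c: "c > 0" "\<And>s a s'. p s a s' > 0 \<Longrightarrow> c \<le> p s a s'" "c \<le> 1"
    using mdp_pos_lower_bound[of p] by auto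
  define R where "R = rnorm r"
  have R: "R \<ge> 0" "\<And>s a. \<bar>r s a\<bar> \<le> R" unfolding R_def by (auto simp: rnorm_nonneg rnorm_ge)
  define C where "C n = rec_nat 0 (\<lambda>_ x. 2 * (x + 2 * R) / c) n" for n
  have C: "C 0 = 0" "C (Suc n) = 2 * (C n + 2 * R) / c" for n unfolding C_def by auto
  have C0: "C n \<ge> 0" for n by (induction n) (use C R c in auto)
  have Cm: "C n \<le> C (Suc n)" for n
  proof -
    have "C n * c \<le> C n * 1" using c C0 by (intro mult_left_mono) auto
    also have "\<dots> \<le> 2 * (C n + 2 * R)" using C0[of n] R by simp
    finally show ?thesis using c by (simp add: C pos_le_divide_eq)
  qed
  show ?thesis
  proof (intro exI[of _ "C (CARD('s))"] allI impI)
    fix \<gamma> :: real and q :: "real ^ ('s \<times> 'b)" and s1 s2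
    assume g: "1/2 \<le> \<gamma>" "\<gamma> < 1"
      and eq: "\<forall>s a. q $ (s, a) = r s a + \<gamma> * (\<Sum>s'\<in>UNIV. p s a s' * maxQ q s')"
      and bd: "\<forall>i. \<bar>q $ i\<bar> \<le> rnorm r / (1 - \<gamma>)"
    define v where "v s = maxQ q s" for s
    obtain d where d: "\<And>s. v s = q $ (s, d s)" unfolding v_def using maxQ_attained[of q] by metis
    obtain s0 where s0: "\<And>s. v s0 \<le> v s"
    proof -
      have "Min (range v) \<in> range v" by (rule Min_in) auto
      then obtain s0 where "v s0 = Min (range v)" by (metis rangeE)
      hence "\<And>s. v s0 \<le> v s" by (simp add: Min_le)
      thus ?thesis using that by blast
    qed
    define w where "w s = v s - v s0" for s
    have w0: "w s \<ge> 0" for s unfolding w_def using s0 by simp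
    have vb: "\<bar>(1 - \<gamma>) * v s0\<bar> \<le> R"
    proof -
      have "\<bar>v s0\<bar> \<le> R / (1 - \<gamma>)" using bd d R_def by metis
      thus ?thesis using g by (simp add: abs_mult pos_le_divide_eq mult.commute)
    qed
    have weq: "w s = r s (d s) - (1 - \<gamma>) * v s0 + \<gamma> * (\<Sum>s'\<in>UNIV. p s (d s) s' * w s')" for s
    proof -
      have "(\<Sum>s'\<in>UNIV. p s (d s) s' * v s') = (\<Sum>s'\<in>UNIV. p s (d s) s' * (w s' + v s0))"
        by (simp add: w_def)
      also have "\<dots> = (\<Sum>s'\<in>UNIV. p s (d s) s' * w s') + v s0" by (rule mdp_avg_shift[OF mdp])
      finally have "v s = r s (d s) + \<gamma> * ((\<Sum>s'\<in>UNIV. p s (d s) s' * w s') + v s0)"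
        using eq d[of s] unfolding v_def by auto
      thus ?thesis unfolding w_def[of s] by (simp add: algebra_simps)
    qed
    define F where "F G = G \<union> {s'. \<exists>s\<in>G. p s (d s) s' > 0}" for G
    have "(F ^^ CARD('s)) {s0} = UNIV"
    proof (rule iterate_to_UNIV)
      show "G = UNIV" if "G \<noteq> {}" "F G = G" for G
        by (rule policy_forward_closed[OF mdp irr that(1)]) (use that F_def in auto)
    qed (auto simp: F_def)
    moreover have "\<forall>s\<in>(F ^^ n) {s0}. w s \<le> C n" for n
    proof (induction n)
      case 0 show ?case by (simp add: C w_def)
    next
      case (Suc n)
      show ?case
      proof
        fix s' assume "s' \<in> (F ^^ Suc n) {s0}"
        hence "s' \<in> (F ^^ n) {s0} \<or> (\<exists>s\<in>(F ^^ n) {s0}. p s (d s) s' > 0)" by (auto simp: F_def)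
        thus "w s' \<le> C (Suc n)"
        proof
          assume "s' \<in> (F ^^ n) {s0}" thus ?thesis using Suc Cm order_trans by blast
        next
          assume "\<exists>s\<in>(F ^^ n) {s0}. p s (d s) s' > 0"
          then obtain s where s: "w s \<le> C n" "p s (d s) s' > 0" using Suc by blast
          have "\<gamma> * (\<Sum>s'\<in>UNIV. p s (d s) s' * w s') \<le> C n + 2 * R"
            using weq[of s] s(1) vb R(2)[of s "d s"] by (simp add: abs_le_iff)
          moreover have "p s (d s) s' * w s' \<le> (\<Sum>s'\<in>UNIV. p s (d s) s' * w s')"
            by (rule member_le_sum) (use mdp_nonneg[OF mdp] w0 in auto)
          moreover have "c * w s' \<le> p s (d s) s' * w s'" using c(2)[OF s(2)] w0 by (rule mult_right_mono)
          ultimately have "c * w s' \<le> (\<Sum>s'\<in>UNIV. p s (d s) s' * w s')" by linarith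
          hence "\<gamma> * (c * w s') \<le> \<gamma> * (\<Sum>s'\<in>UNIV. p s (d s) s' * w s')"
            using g by (intro mult_left_mono) auto
          also have "\<dots> \<le> C n + 2 * R" by fact
          finally have "\<gamma> * (c * w s') \<le> C n + 2 * R" .
          moreover have "1/2 * (c * w s') \<le> \<gamma> * (c * w s')" using g c(1) w0 by (intro mult_right_mono) auto
          ultimately have "c * w s' \<le> 2 * (C n + 2 * R)" by argo
          thus ?thesis using c(1) by (simp only: C pos_le_divide_eq mult.commute[of _ c])
        qed
      qed
    qed
    ultimately have "w s1 \<le> C (CARD('s))" by blast
    thus "maxQ q s1 - maxQ q s2 \<le> C (CARD('s))" using w0[of s2] unfolding w_def v_def by linarith
  qed
qed

text \<open>Vanishing discount: a limit of the discounted fixed points, normalised at one state.\<close>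

lemma average_optimality_equation:
  fixes r :: "'s::finite \<Rightarrow> 'b::finite \<Rightarrow> real"
  assumes mdp: "is_mdp p" and irr: "policy_irreducible p"
  shows "\<exists>\<rho> (q :: real ^ ('s \<times> 'b)). \<forall>s a. q $ (s, a) = r s a - \<rho> + (\<Sum>s'\<in>UNIV. p s a s' * maxQ q s')"
proof -
  define R where "R = rnorm r"
  have R: "R \<ge> 0" "\<And>s a. \<bar>r s a\<bar> \<le> R" unfolding R_def by (auto simp: rnorm_nonneg rnorm_ge)
  define \<gamma> where "\<gamma> n = 1 - 1 / real (n + 2)" for n
  have g: "1/2 \<le> \<gamma> n" "\<gamma> n < 1" for n unfolding \<gamma>_def by (auto simp: field_simps)
  have "\<exists>q. (\<forall>s a. q $ (s, a) = r s a + \<gamma> n * (\<Sum>s'\<in>UNIV. p s a s' * maxQ q s'))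
     \<and> (\<forall>i. \<bar>q $ i\<bar> \<le> rnorm r / (1 - \<gamma> n))" for n
    using g[of n] by (intro discounted_fixed_point[OF mdp]) auto
  from choice[OF allI[OF this]] obtain q :: "nat \<Rightarrow> real ^ ('s \<times> 'b)"
    where "\<forall>n. (\<forall>s a. q n $ (s, a) = r s a + \<gamma> n * (\<Sum>s'\<in>UNIV. p s a s' * maxQ (q n) s'))
     \<and> (\<forall>i. \<bar>q n $ i\<bar> \<le> rnorm r / (1 - \<gamma> n))" ..
  hence q: "\<And>n s a. q n $ (s, a) = r s a + \<gamma> n * (\<Sum>s'\<in>UNIV. p s a s' * maxQ (q n) s')"
    and qb: "\<And>n i. \<bar>q n $ i\<bar> \<le> rnorm r / (1 - \<gamma> n)" by (simp_all del: split_paired_All)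
  from discounted_span_bound[OF mdp irr, of r] obtain K
    where K0: "\<forall>\<gamma> q. 1/2 \<le> \<gamma> \<longrightarrow> \<gamma> < 1 \<longrightarrow>
     (\<forall>s a. q $ (s, a) = r s a + \<gamma> * (\<Sum>s'\<in>UNIV. p s a s' * maxQ q s')) \<longrightarrow>
     (\<forall>i. \<bar>q $ i\<bar> \<le> rnorm r / (1 - \<gamma>)) \<longrightarrow> (\<forall>s s'. maxQ q s - maxQ q s' \<le> K)" ..
  have K: "maxQ (q n) s - maxQ (q n) s' \<le> K" for n s s'
  proof -
    have "\<forall>s s'. maxQ (q n) s - maxQ (q n) s' \<le> K"
      by (rule K0[THEN spec[of _ "\<gamma> n"], THEN spec[of _ "q n"], THEN mp, THEN mp, THEN mp, THEN mp]) (intro g allI q qb)+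
    thus ?thesis by simp
  qed
  \<comment> \<open>\<open>undefined\<close> serves as an arbitrary reference state. Subtracting its
    value leaves bounded vectors \<open>h n\<close>, and \<open>(1 - \<gamma> n) * c n\<close>,
    bounded as well, takes the place of the gain.\<close>
  define c where "c n = maxQ (q n) undefined" for n
  define h where "h n = q n + (- c n) *\<^sub>R ones" for n
  define \<rho> where "\<rho> n = (1 - \<gamma> n) * c n" for n
  have \<rho>b: "\<bar>\<rho> n\<bar> \<le> R" for n
  proof -
    have "\<bar>c n\<bar> \<le> R / (1 - \<gamma> n)" unfolding c_def R_def using maxQ_attained[of "q n" undefined] qb by metis
    thus ?thesis using g(2)[of n] unfolding \<rho>_def by (simp add: abs_mult pos_le_divide_eq mult.commute)
  qed
  have mh: "maxQ (h n) s = maxQ (q n) s - c n" for n s using maxQ_shift[of "q n" "- c n" s] by (simp add: h_def)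
  have mhb: "\<bar>maxQ (h n) s\<bar> \<le> K" for n s
    using K[of n s undefined] K[of n undefined s] unfolding mh c_def by linarith
  have h: "h n $ (s, a) = r s a - \<rho> n + \<gamma> n * (\<Sum>s'\<in>UNIV. p s a s' * maxQ (h n) s')" for n s a
  proof -
    have "(\<Sum>s'\<in>UNIV. p s a s' * maxQ (q n) s') = (\<Sum>s'\<in>UNIV. p s a s' * (maxQ (h n) s' + c n))"
      by (simp add: mh)
    also have "\<dots> = (\<Sum>s'\<in>UNIV. p s a s' * maxQ (h n) s') + c n" by (rule mdp_avg_shift[OF mdp])
    finally show ?thesis unfolding \<rho>_def using q[of n s a] by (simp add: h_def ones_def algebra_simps)
  qed
  have hb: "\<bar>h n $ i\<bar> \<le> 2 * R + K" for n i
  proof (cases i)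
    case (Pair s a)
    have "\<bar>\<gamma> n * (\<Sum>s'\<in>UNIV. p s a s' * maxQ (h n) s')\<bar> \<le> 1 * K"
      unfolding abs_mult using g[of n] mdp_avg_abs_le[OF mdp mhb[of n], of s a] by (intro mult_mono) auto
    thus ?thesis unfolding Pair using h[of n s a] R(2)[of s a] \<rho>b[of n] by linarith
  qed
  have "bounded (range (\<lambda>n. (h n, \<rho> n)))"
  proof -
    have "bounded (range h)"
    proof (rule boundedI)
      fix x assume "x \<in> range h"
      then obtain n where "x = h n" by auto
      hence "norm x \<le> (\<Sum>i\<in>UNIV. \<bar>h n $ i\<bar>)" using norm_le_l1_cart by blast
      also have "\<dots> \<le> (\<Sum>i\<in>(UNIV::('s\<times>'b) set). 2 * R + K)" by (intro sum_mono hb)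
      finally show "norm x \<le> (\<Sum>i\<in>(UNIV::('s\<times>'b) set). 2 * R + K)" .
    qed
    moreover have "bounded (range \<rho>)" using \<rho>b by (intro boundedI) auto
    ultimately have "bounded (range h \<times> range \<rho>)" by (rule bounded_Times)
    thus ?thesis by (rule bounded_subset) auto
  qed
  then obtain l \<theta> where l: "strict_mono \<theta>" "((\<lambda>n. (h n, \<rho> n)) \<circ> \<theta>) \<longlonglongrightarrow> l"
    using bounded_imp_convergent_subsequence[of "\<lambda>n. (h n, \<rho> n)"] by auto
  have l1: "(\<lambda>n. h (\<theta> n)) \<longlonglongrightarrow> fst l" and l2: "(\<lambda>n. \<rho> (\<theta> n)) \<longlonglongrightarrow> snd l"
    using tendsto_fst[OF l(2)] tendsto_snd[OF l(2)] by (simp_all add: o_def)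
  have "\<gamma> \<longlonglongrightarrow> 1 - 0" unfolding \<gamma>_def
    by (intro tendsto_intros LIMSEQ_ignore_initial_segment[of "\<lambda>n. 1 / real n" 0 2] lim_1_over_n)
  hence l3: "(\<lambda>n. \<gamma> (\<theta> n)) \<longlonglongrightarrow> 1" using LIMSEQ_subseq_LIMSEQ[OF _ l(1), of \<gamma> 1] by (simp add: o_def)
  show ?thesis
  proof (intro exI[of _ "snd l"] exI[of _ "fst l"] allI)
    fix s a
    have "(\<lambda>n. h (\<theta> n) $ (s, a)) \<longlonglongrightarrow> r s a - snd l + 1 * (\<Sum>s'\<in>UNIV. p s a s' * maxQ (fst l) s')"
      unfolding h by (intro tendsto_intros l1 l2 l3)
    moreover have "(\<lambda>n. h (\<theta> n) $ (s, a)) \<longlonglongrightarrow> fst l $ (s, a)" by (intro tendsto_intros l1)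
    ultimately show "fst l $ (s, a) = r s a - snd l + (\<Sum>s'\<in>UNIV. p s a s' * maxQ (fst l) s')"
      using LIMSEQ_unique by fastforce
  qed
qed


section \<open>Average rewards of stationary policies\<close>

lemma sum_nstep_shift:
  "(\<Sum>s\<in>UNIV. nstep P t s0 s * (\<Sum>s'\<in>UNIV. P s s' * w s')) = (\<Sum>s\<in>UNIV. nstep P (Suc t) s0 s * w s)"
proof -
  have "(\<Sum>s\<in>UNIV. nstep P t s0 s * (\<Sum>s'\<in>UNIV. P s s' * w s'))
      = (\<Sum>s\<in>UNIV. \<Sum>s'\<in>UNIV. nstep P t s0 s * P s s' * w s')"
    by (simp add: sum_distrib_left mult.assoc)
  also have "\<dots> = (\<Sum>s'\<in>UNIV. \<Sum>s\<in>UNIV. nstep P t s0 s * P s s' * w s')" by (rule sum.swap)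
  also have "\<dots> = (\<Sum>s'\<in>UNIV. nstep P (Suc t) s0 s' * w s')"
    unfolding nstep_Suc_right by (simp add: sum_distrib_right)
  finally show ?thesis .
qed

text \<open>The Poisson equation writes each expected reward as \<open>\<rho>\<close> plus the
  expected decrease of \<open>w\<close> in that step, and the decreases telescope.\<close>

lemma telescoped_reward:
  assumes st: "\<And>i. (\<Sum>j\<in>UNIV. P i j) = 1"
    and eq: "\<And>s. x s = \<rho> + w s - (\<Sum>s'\<in>UNIV. P s s' * w s')"
  shows "(\<Sum>t<n. \<Sum>s\<in>UNIV. nstep P t s0 s * x s) = real n * \<rho> + w s0 - (\<Sum>s\<in>UNIV. nstep P n s0 s * w s)"
proof (induction n)
  case 0
  have "(\<Sum>s\<in>UNIV. (if s0 = s then 1 else 0) * w s) = (\<Sum>s\<in>UNIV. if s0 = s then w s else 0)"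
    by (intro sum.cong) auto
  thus ?case by simp
next
  case (Suc n)
  have "(\<Sum>s\<in>UNIV. nstep P n s0 s * x s) = \<rho> * (\<Sum>s\<in>UNIV. nstep P n s0 s)
     + (\<Sum>s\<in>UNIV. nstep P n s0 s * w s) - (\<Sum>s\<in>UNIV. nstep P n s0 s * (\<Sum>s'\<in>UNIV. P s s' * w s'))"
    unfolding eq by (simp only: ring_distribs right_diff_distrib sum.distrib sum_subtractf sum_distrib_left mult.commute[of \<rho>])
  thus ?case using Suc unfolding sum_nstep_shift nstep_sum[OF st] by (simp add: algebra_simps)
qed

lemma average_reward_limit:
  assumes nn: "\<And>i j. 0 \<le> P i j" and st: "\<And>i. (\<Sum>j\<in>UNIV. P i j) = 1"
    and eq: "\<And>s. x s = \<rho> + w s - (\<Sum>s'\<in>UNIV. P s s' * w s')"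
  shows "(\<lambda>T. (\<Sum>t\<le>T. \<Sum>s\<in>UNIV. nstep P t s0 s * x s) / real T) \<longlonglongrightarrow> \<rho>"
proof -
  \<comment> \<open>The average has \<open>T + 1\<close> terms but is divided by \<open>T\<close>;
    the surplus \<open>\<rho>\<close> joins the bounded remainder.\<close>
  define e where "e T = \<rho> + w s0 - (\<Sum>s\<in>UNIV. nstep P (Suc T) s0 s * w s)" for T
  define W where "W = Max (range (\<lambda>s. \<bar>w s\<bar>))"
  have W: "\<bar>w s\<bar> \<le> W" for s unfolding W_def by (rule Max_ge) auto
  have "\<bar>\<Sum>s\<in>UNIV. nstep P n s0 s * w s\<bar> \<le> W" for n
  proof -
    have "\<bar>\<Sum>s\<in>UNIV. nstep P n s0 s * w s\<bar> \<le> (\<Sum>s\<in>UNIV. nstep P n s0 s * W)"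
      by (rule order_trans[OF sum_abs sum_mono]) (simp add: abs_mult nstep_nonneg[OF nn] mult_left_mono W)
    also have "\<dots> = W" by (simp only: sum_distrib_right[symmetric] nstep_sum[OF st])
    finally show ?thesis .
  qed
  note nb = this
  have eb: "\<bar>e T\<bar> \<le> \<bar>\<rho>\<bar> + W + W" for T 
  proof -
    have "\<bar>\<Sum>s\<in>UNIV. nstep P (Suc T) s0 s * w s\<bar> \<le> W" by (rule nb)
    thus ?thesis unfolding e_def using W[of s0] by linarith
  qed
  have "(\<lambda>T. e T / real T) \<longlonglongrightarrow> 0"
  proof (rule Lim_null_comparison)
    show "eventually (\<lambda>T. norm (e T / real T) \<le> (\<bar>\<rho>\<bar> + W + W) / real T) sequentially"
      using eb by (intro always_eventually allI) (simp add: divide_right_mono)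
    show "(\<lambda>T. (\<bar>\<rho>\<bar> + W + W) / real T) \<longlonglongrightarrow> 0"
      by (rule lim_const_over_n)
  qed
  hence "(\<lambda>T. \<rho> + e T / real T) \<longlonglongrightarrow> \<rho> + 0" by (intro tendsto_intros)
  moreover have "eventually (\<lambda>T. \<rho> + e T / real T = (\<Sum>t\<le>T. \<Sum>s\<in>UNIV. nstep P t s0 s * x s) / real T) sequentially"
    using eventually_gt_at_top[of 0]
  proof eventually_elim
    case (elim T)
    have "(\<Sum>t\<le>T. \<Sum>s\<in>UNIV. nstep P t s0 s * x s) = real (Suc T) * \<rho> + w s0 - (\<Sum>s\<in>UNIV. nstep P (Suc T) s0 s * w s)"
      unfolding lessThan_Suc_atMost[symmetric] by (rule telescoped_reward[OF st eq])
    also have "\<dots> = real T * \<rho> + e T" unfolding e_def by (simp add: algebra_simps)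
    finally show ?case using elim by (simp add: field_simps)
  qed
  ultimately show ?thesis by (simp add: tendsto_cong)
qed

lemma policy_chain_nonneg: "is_mdp p \<Longrightarrow> stationary_policy \<pi> \<Longrightarrow> 0 \<le> policy_chain p \<pi> i j"
  unfolding policy_chain_def by (intro sum_nonneg mult_nonneg_nonneg) (auto simp: mdp_nonneg stationary_policy_def)

lemma policy_chain_sum:
  assumes "is_mdp p" "stationary_policy \<pi>"
  shows "(\<Sum>j\<in>UNIV. policy_chain p \<pi> i j) = 1"
proof -
  have "(\<Sum>j\<in>UNIV. policy_chain p \<pi> i j) = (\<Sum>a\<in>UNIV. \<Sum>j\<in>UNIV. \<pi> i a * p i a j)"
    unfolding policy_chain_def by (rule sum.swap)
  also have "\<dots> = 1" using assms
    by (simp add: sum_distrib_left[symmetric] mdp_sum) (simp add: stationary_policy_def)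
  finally show ?thesis .
qed

lemma avg_reward_eqI:
  assumes "is_mdp p" "stationary_policy \<pi>"
    and "\<And>s. (\<Sum>a\<in>UNIV. \<pi> s a * r s a) = \<rho> + w s - (\<Sum>s'\<in>UNIV. policy_chain p \<pi> s s' * w s')"
  shows "avg_reward r p \<pi> s0 = \<rho>"
  unfolding avg_reward_def
  by (rule limI, rule average_reward_limit[where w=w])
    (use assms in \<open>auto simp: policy_chain_nonneg policy_chain_sum\<close>)

text \<open>The optimality equation of the MDP in which every action is replaced by a draw from \<open>\<pi>\<close>.\<close>

lemma poisson_equation:
  fixes r :: "'s::finite \<Rightarrow> 'b::finite \<Rightarrow> real"
  assumes mdp: "is_mdp p" and irr: "policy_irreducible p" and pi: "stationary_policy \<pi>"
  shows "\<exists>\<rho> w. \<forall>s. (\<Sum>a\<in>UNIV. \<pi> s a * r s a) = \<rho> + w s - (\<Sum>s'\<in>UNIV. policy_chain p \<pi> s s' * w s')"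
proof -
  define p' where "p' s (a::'b) s' = policy_chain p \<pi> s s'" for s a s'
  define r' where "r' s (a::'b) = (\<Sum>a\<in>UNIV. \<pi> s a * r s a)" for s a
  have mdp': "is_mdp p'" unfolding p'_def is_mdp_def
    using policy_chain_nonneg[OF mdp pi] policy_chain_sum[OF mdp pi] by simp
  have "policy_chain p' \<pi>' = policy_chain p \<pi>" if "stationary_policy \<pi>'" for \<pi>'
    using that unfolding stationary_policy_def
    by (intro ext, subst policy_chain_def) (simp add: p'_def sum_distrib_right[symmetric])
  hence irr': "policy_irreducible p'" using irr pi unfolding policy_irreducible_def by metis
  obtain \<rho> and q :: "real ^ ('s \<times> 'b)"
    where q: "\<forall>s a. q $ (s, a) = r' s a - \<rho> + (\<Sum>s'\<in>UNIV. p' s a s' * maxQ q s')"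
    using average_optimality_equation[OF mdp' irr', of r'] by blast
  have "maxQ q s = (\<Sum>a\<in>UNIV. \<pi> s a * r s a) - \<rho> + (\<Sum>s'\<in>UNIV. policy_chain p \<pi> s s' * maxQ q s')" for s
    by (rule maxQ_eqI) (use q in \<open>simp add: r'_def p'_def\<close>)
  thus ?thesis by (intro exI[of _ \<rho>] exI[of _ "maxQ q"] allI) (simp add: algebra_simps)
qed

text \<open>Two Poisson equations for the same chain are compared. The policy's own has gain
  \<open>\<rho>'\<close>; the other has \<open>maxQ q\<close> in place of \<open>w\<close>, gain
  \<open>\<rho>\<close>, and a reward \<open>x\<close> dominating the true one, because
  \<open>maxQ q s\<close> is at least the mean of \<open>q\<close> over the actions of the
  policy.\<close>

lemma avg_reward_le:
  fixes r :: "'s::finite \<Rightarrow> 'b::finite \<Rightarrow> real"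
  assumes mdp: "is_mdp p" and irr: "policy_irreducible p" and pi: "stationary_policy \<pi>"
    and q: "\<And>s a. q $ (s, a) = r s a - \<rho> + (\<Sum>s'\<in>UNIV. p s a s' * maxQ q s')"
  shows "avg_reward r p \<pi> s0 \<le> \<rho>"
proof -
  define P where "P = policy_chain p \<pi>"
  define rp where "rp s = (\<Sum>a\<in>UNIV. \<pi> s a * r s a)" for s
  have P: "0 \<le> P i j" "(\<Sum>j\<in>UNIV. P i j) = 1" for i j
    unfolding P_def using policy_chain_nonneg[OF mdp pi] policy_chain_sum[OF mdp pi] by auto
  obtain \<rho>' w where w: "\<And>s. rp s = \<rho>' + w s - (\<Sum>s'\<in>UNIV. P s s' * w s')"
    using poisson_equation[OF mdp irr pi, of r] unfolding rp_def P_def by blast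
  have av: "avg_reward r p \<pi> s0 = \<rho>'"
    by (rule avg_reward_eqI[OF mdp pi]) (use w in \<open>simp add: rp_def P_def\<close>)
  have lim1: "(\<lambda>T. (\<Sum>t\<le>T. \<Sum>s\<in>UNIV. nstep P t s0 s * rp s) / real T) \<longlonglongrightarrow> \<rho>'"
    by (rule average_reward_limit[OF P w])
  define x where "x s = \<rho> + maxQ q s - (\<Sum>s'\<in>UNIV. P s s' * maxQ q s')" for s
  have lim2: "(\<lambda>T. (\<Sum>t\<le>T. \<Sum>s\<in>UNIV. nstep P t s0 s * x s) / real T) \<longlonglongrightarrow> \<rho>"
    by (rule average_reward_limit[OF P x_def])
  have "rp s \<le> x s" for s
  proof -
    have "r s a + (\<Sum>s'\<in>UNIV. p s a s' * maxQ q s') \<le> \<rho> + maxQ q s" for a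
      using q[of s a] maxQ_ge[of q s a] by simp
    hence "(\<Sum>a\<in>UNIV. \<pi> s a * (r s a + (\<Sum>s'\<in>UNIV. p s a s' * maxQ q s'))) \<le> (\<Sum>a\<in>UNIV. \<pi> s a * (\<rho> + maxQ q s))"
      using pi by (intro sum_mono mult_left_mono) (auto simp: stationary_policy_def)
    also have "\<dots> = \<rho> + maxQ q s" using pi by (simp add: sum_distrib_right[symmetric] stationary_policy_def)
    also have "(\<Sum>a\<in>UNIV. \<pi> s a * (r s a + (\<Sum>s'\<in>UNIV. p s a s' * maxQ q s')))
        = rp s + (\<Sum>a\<in>UNIV. \<Sum>s'\<in>UNIV. \<pi> s a * (p s a s' * maxQ q s'))"
      by (simp add: rp_def distrib_left sum.distrib sum_distrib_left)
    also have "(\<Sum>a\<in>UNIV. \<Sum>s'\<in>UNIV. \<pi> s a * (p s a s' * maxQ q s')) = (\<Sum>s'\<in>UNIV. \<Sum>a\<in>UNIV. \<pi> s a * (p s a s' * maxQ q s'))"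
      by (rule sum.swap)
    also have "\<dots> = (\<Sum>s'\<in>UNIV. P s s' * maxQ q s')"
      by (simp add: P_def policy_chain_def sum_distrib_right mult.assoc)
    finally show ?thesis unfolding x_def by simp
  qed
  hence "\<rho>' \<le> \<rho>"
    by (intro LIMSEQ_le[OF lim1 lim2] exI[of _ 0] allI impI divide_right_mono sum_mono mult_left_mono nstep_nonneg P) auto
  thus ?thesis using av by simp
qed

text \<open>The greedy policy of \<open>q\<close> attains the bound, since for it
  \<open>maxQ q\<close> solves the Poisson equation. Thus every solution of the optimality equation
  has the same gain.\<close>

lemma opt_avg_reward_eq:
  fixes r :: "'s::finite \<Rightarrow> 'b::finite \<Rightarrow> real"
  assumes mdp: "is_mdp p" and irr: "policy_irreducible p"
    and q: "\<And>s a. q $ (s, a) = r s a - \<rho> + (\<Sum>s'\<in>UNIV. p s a s' * maxQ q s')"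
  shows "opt_avg_reward r p s0 = \<rho>"
proof -
  obtain d where d: "\<And>s. maxQ q s = q $ (s, d s)" using maxQ_attained[of q] by metis
  have "avg_reward r p (det_policy d) s0 = \<rho>"
  proof (rule avg_reward_eqI[OF mdp stationary_det_policy, where w="maxQ q"])
    fix s
    have "(\<Sum>a\<in>UNIV. det_policy d s a * r s a) = (\<Sum>a\<in>UNIV. if a = d s then r s a else 0)"
      unfolding det_policy_def by (intro sum.cong) auto
    also have "\<dots> = r s (d s)" by simp
    also have "\<dots> = \<rho> + maxQ q s - (\<Sum>s'\<in>UNIV. p s (d s) s' * maxQ q s')" using d[of s] q[of s "d s"] by simp
    finally show "(\<Sum>a\<in>UNIV. det_policy d s a * r s a) = \<rho> + maxQ q s - (\<Sum>s'\<in>UNIV. policy_chain p (det_policy d) s s' * maxQ q s')"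
      by (simp add: policy_chain_det)
  qed
  thus ?thesis unfolding opt_avg_reward_def using avg_reward_le[OF mdp irr _ q] stationary_det_policy
    by (intro cSup_eq_maximum) (auto intro!: image_eqI[of _ _ "det_policy d"])
qed

text \<open>The equation is read at a state of largest and at one of smallest value. The bound
  places the target \<open>f q\<close> at distance at least \<open>\<eta>\<close> inside the
  clipping interval.\<close>

lemma avg_gain_abs_le:
  fixes r :: "'s::finite \<Rightarrow> 'b::finite \<Rightarrow> real"
  assumes mdp: "is_mdp p"
    and q: "\<And>s a. q $ (s, a) = r s a - \<rho> + (\<Sum>s'\<in>UNIV. p s a s' * maxQ q s')"
  shows "\<bar>\<rho>\<bar> \<le> rnorm r"
proof -
  have "Max (range (maxQ q)) \<in> range (maxQ q)" by (rule Max_in) auto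
  then obtain s where "maxQ q s = Max (range (maxQ q))" by (metis rangeE)
  hence s: "maxQ q s' \<le> maxQ q s" for s' by simp
  have "Min (range (maxQ q)) \<in> range (maxQ q)" by (rule Min_in) auto
  then obtain t where "maxQ q t = Min (range (maxQ q))" by (metis rangeE)
  hence t: "maxQ q t \<le> maxQ q s'" for s' by simp
  obtain a where a: "maxQ q s = q $ (s, a)" using maxQ_attained by blast
  have "\<rho> \<le> rnorm r"
    using q[of s a] mdp_avg_le[OF mdp, of "maxQ q", OF s, of s a] a rnorm_ge[of r s a] by linarith
  moreover have "- rnorm r \<le> \<rho>"
    using q[of t a] maxQ_ge[of q t a] mdp_avg_ge[OF mdp, of _ "maxQ q", OF t, of t a] rnorm_ge[of r t a] by linarith
  ultimately show ?thesis by linarith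
qed

text \<open>Minimum principle: the difference \<open>V\<close> of the state values is superharmonic
  for the greedy policy of \<open>q\<close>, so its minimisers form a set closed under that policy,
  which is everything by irreducibility.\<close>

lemma optimality_equation_unique_up_to_shift:
  fixes r :: "'s::finite \<Rightarrow> 'b::finite \<Rightarrow> real"
  assumes mdp: "is_mdp p" and irr: "policy_irreducible p"
    and q: "\<And>s a. q $ (s, a) = r s a - \<rho> + (\<Sum>s'\<in>UNIV. p s a s' * maxQ q s')"
    and q': "\<And>s a. q' $ (s, a) = r s a - \<rho> + (\<Sum>s'\<in>UNIV. p s a s' * maxQ q' s')"
  shows "\<exists>c. q' = q + c *\<^sub>R ones"
proof -
  obtain d where d: "\<And>s. maxQ q s = q $ (s, d s)" using maxQ_attained[of q] by metis
  define V where "V s = maxQ q' s - maxQ q s" for s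
  have eq: "q' $ (s, a) - q $ (s, a) = (\<Sum>s'\<in>UNIV. p s a s' * V s')" for s a
    using q[of s a] q'[of s a] by (simp add: V_def right_diff_distrib sum_subtractf)
  have "Min (range V) \<in> range V" by (rule Min_in) auto
  then obtain t where "V t = Min (range V)" by (metis rangeE)
  hence t: "V t \<le> V s'" for s' by simp
  have superharmonic: "(\<Sum>s'\<in>UNIV. p s (d s) s' * V s') \<le> V s" for s
    using eq[of s "d s"] d[of s] maxQ_ge[of q' s "d s"] unfolding V_def by simp
  have "{s. V s = V t} = UNIV"
  proof (rule policy_forward_closed[OF mdp irr])
    fix s s' assume s: "s \<in> {s. V s = V t}" and p: "p s (d s) s' > 0"
    show "s' \<in> {s. V s = V t}"
    proof (rule ccontr)
      assume "s' \<notin> {s. V s = V t}"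
      hence less: "V t < V s'" using t[of s'] by simp
      have "(\<Sum>s'\<in>UNIV. p s (d s) s' * V t) < (\<Sum>s'\<in>UNIV. p s (d s) s' * V s')"
        by (rule sum_strict_mono_ex1) (use less p t mdp_nonneg[OF mdp] in \<open>auto intro!: mult_left_mono exI[of _ s'] mult_strict_left_mono\<close>)
      hence "V t < (\<Sum>s'\<in>UNIV. p s (d s) s' * V s')" by (simp add: sum_distrib_right[symmetric] mdp_sum[OF mdp])
      thus False using superharmonic[of s] s by simp
    qed
  qed auto
  hence "\<exists>c. \<forall>s. V s = c" by blast
  then obtain c where c: "\<And>s. V s = c" by blast
  have "q' $ (s, a) - q $ (s, a) = c" for s a
    using eq[of s a] by (simp add: c sum_distrib_right[symmetric] mdp_sum[OF mdp])
  hence "q' = q + c *\<^sub>R ones" by (simp add: vec_eq_iff ones_def algebra_simps)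
  thus ?thesis ..
qed

text \<open>The solutions of the optimality equation form a line in direction \<open>ones\<close>,
  along which \<open>f\<close> grows at rate \<open>u\<close>; exactly one of its points has
  \<open>f\<close> equal to the gain.\<close>

theorem rvi_solution_exists_unique:
  fixes r :: "'s::finite \<Rightarrow> 'b::finite \<Rightarrow> real" and f :: "real ^ ('s \<times> 'b) \<Rightarrow> real"
  assumes mdp: "is_mdp p" and irr: "policy_irreducible p"
    and u: "u > 0" and f_shift: "\<And>x c. f (x + c *\<^sub>R ones) = f x + c * u"
  shows "\<exists>q. rvi_solution r p f q \<and> (\<forall>q'. rvi_solution r p f q' \<longrightarrow> q' = q)
    \<and> (\<forall>s0. f q = opt_avg_reward r p s0) \<and> \<bar>f q\<bar> \<le> rnorm r"
proof -
  obtain \<rho> and h :: "real ^ ('s \<times> 'b)"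
    where h: "\<And>s a. h $ (s, a) = r s a - \<rho> + (\<Sum>s'\<in>UNIV. p s a s' * maxQ h s')"
    using average_optimality_equation[OF mdp irr, of r] by blast
  define c where "c = (\<rho> - f h) / u"
  define q where "q = h + c *\<^sub>R ones"
  have fq: "f q = \<rho>" unfolding q_def f_shift c_def using u by simp
  have q: "q $ (s, a) = r s a - f q + (\<Sum>s'\<in>UNIV. p s a s' * maxQ q s')" for s a
  proof -
    have "(\<Sum>s'\<in>UNIV. p s a s' * maxQ q s') = (\<Sum>s'\<in>UNIV. p s a s' * maxQ h s') + c"
      unfolding q_def maxQ_shift by (rule mdp_avg_shift[OF mdp])
    thus ?thesis unfolding fq using h[of s a] by (simp add: q_def ones_def)
  qed
  have "q' = q" if "rvi_solution r p f q'" for q'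
  proof -
    have q': "q' $ (s, a) = r s a - f q' + (\<Sum>s'\<in>UNIV. p s a s' * maxQ q' s')" for s a
      using that unfolding rvi_solution_def by blast
    have feq: "f q' = f q" using opt_avg_reward_eq[OF mdp irr q, of undefined] opt_avg_reward_eq[OF mdp irr q', of undefined] by simp
    obtain c where c: "q' = q + c *\<^sub>R ones"
      using optimality_equation_unique_up_to_shift[OF mdp irr q q'[unfolded feq]] by blast
    have "c = 0" using feq u unfolding c f_shift by simp
    thus ?thesis using c by simp
  qed
  thus ?thesis using q opt_avg_reward_eq[OF mdp irr q] avg_gain_abs_le[OF mdp q]
    unfolding rvi_solution_def by (intro exI[of _ q]) simp
qed

section \<open>Stochastic averaging of real sequences\<close>

text \<open>Above \<open>\<epsilon>\<close> the decrease by \<open>c * \<alpha> k\<close> cannot go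
  on for ever, as the sum of \<open>\<alpha>\<close> is infinite. After the first passage below
  \<open>\<epsilon>\<close> a single step may overshoot, but not beyond
  \<open>2 * \<epsilon>\<close>, and from there \<open>V\<close> decreases again.\<close>

lemma descent_to_zero:
  fixes V \<alpha> :: "nat \<Rightarrow> real"
  assumes V0: "\<And>k. 0 \<le> V k" and a0: "\<And>k. 0 \<le> \<alpha> k" and div: "\<not> summable \<alpha>"
    and desc: "\<And>\<epsilon>. \<epsilon> > 0 \<Longrightarrow> \<exists>c>0. eventually (\<lambda>k. (\<epsilon> \<le> V k \<longrightarrow> V (Suc k) \<le> V k - c * \<alpha> k)
        \<and> (V k < \<epsilon> \<longrightarrow> V (Suc k) \<le> 2 * \<epsilon>)) sequentially"
  shows "V \<longlonglongrightarrow> 0"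
proof (rule LIMSEQ_I)
  fix e :: real assume e: "e > 0"
  define \<epsilon> where "\<epsilon> = e / 3"
  have "\<epsilon> > 0" using e by (simp add: \<epsilon>_def)
  then obtain c K where c: "c > 0" and K: "\<And>k. k \<ge> K \<Longrightarrow> \<epsilon> \<le> V k \<Longrightarrow> V (Suc k) \<le> V k - c * \<alpha> k"
    "\<And>k. k \<ge> K \<Longrightarrow> V k < \<epsilon> \<Longrightarrow> V (Suc k) \<le> 2 * \<epsilon>"
    using desc[of \<epsilon>] unfolding eventually_sequentially by metis
  have "\<exists>k\<ge>K. V k < \<epsilon>"
  proof (rule ccontr)
    assume "\<not> (\<exists>k\<ge>K. V k < \<epsilon>)"
    hence ge: "\<epsilon> \<le> V k" if "k \<ge> K" for k using that by force
    have "V (K + n) \<le> V K - c * (\<Sum>k<n. \<alpha> (k + K))" for n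
    proof (induction n)
      case (Suc n)
      have "V (Suc (K + n)) \<le> V (K + n) - c * \<alpha> (K + n)" using K(1)[of "K+n"] ge[of "K + n"] by simp
      thus ?case using Suc by (simp add: algebra_simps)
    qed simp
    hence "(\<Sum>k<n. \<alpha> (k + K)) \<le> V K / c" for n
      using V0[of "K + n"] c by (simp add: pos_le_divide_eq mult.commute) (smt (verit))
    hence "summable (\<lambda>k. \<alpha> (k + K))" by (rule summableI_nonneg_bounded[OF a0])
    thus False using div by (simp add: summable_iff_shift)
  qed
  then obtain k0 where k0: "k0 \<ge> K" "V k0 < \<epsilon>" by blast
  have "V (k0 + n) \<le> 2 * \<epsilon>" for n
  proof (induction n)
    case 0 thus ?case using k0 V0[of k0] by simp
  next
    case (Suc n)
    have "0 \<le> c * \<alpha> (k0 + n)" using c a0[of "k0 + n"] by simp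
    thus ?case using K[of "k0 + n"] Suc k0(1) by (cases "V (k0 + n) < \<epsilon>") auto
  qed
  hence "V k \<le> 2 * \<epsilon>" if "k \<ge> k0" for k using that le_Suc_ex by metis
  moreover have "2 * \<epsilon> < e" using e by (simp add: \<epsilon>_def)
  ultimately show "\<exists>no. \<forall>n\<ge>no. norm (V n - 0) < e"
    using V0 by (intro exI[of _ k0]) (auto intro: le_less_trans)
qed

lemma averaging_tracks:
  fixes x \<alpha> \<epsilon> :: "nat \<Rightarrow> real"
  assumes a0: "\<And>k. 0 \<le> \<alpha> k" and a1: "\<alpha> \<longlonglongrightarrow> 0" and div: "\<not> summable \<alpha>"
    and rec: "eventually (\<lambda>k. \<bar>x (Suc k)\<bar> \<le> (1 - \<alpha> k) * \<bar>x k\<bar> + \<alpha> k * \<epsilon> k) sequentially" and e: "\<epsilon> \<longlonglongrightarrow> 0"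
  shows "x \<longlonglongrightarrow> 0"
proof -
  have "(\<lambda>k. \<bar>x k\<bar>) \<longlonglongrightarrow> 0"
  proof (rule descent_to_zero[OF _ a0 div])
    fix \<delta> :: real assume d: "\<delta> > 0"
    have "eventually (\<lambda>k. \<epsilon> k < \<delta> / 2) sequentially" using e d by (intro order_tendstoD) auto
    moreover have "eventually (\<lambda>k. \<alpha> k < 1) sequentially" using a1 by (intro order_tendstoD) auto
    ultimately have "eventually (\<lambda>k. (\<delta> \<le> \<bar>x k\<bar> \<longrightarrow> \<bar>x (Suc k)\<bar> \<le> \<bar>x k\<bar> - \<delta> / 2 * \<alpha> k)
        \<and> (\<bar>x k\<bar> < \<delta> \<longrightarrow> \<bar>x (Suc k)\<bar> \<le> 2 * \<delta>)) sequentially"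
      using rec
    proof eventually_elim
      case (elim k)
      have 1: "\<alpha> k * \<epsilon> k \<le> \<alpha> k * (\<delta> / 2)" using elim a0 by (intro mult_left_mono) auto
      have "\<alpha> k * \<delta> \<le> \<alpha> k * \<bar>x k\<bar>" if "\<delta> \<le> \<bar>x k\<bar>" using that a0 by (intro mult_left_mono) auto
      moreover have "(1 - \<alpha> k) * \<bar>x k\<bar> \<le> (1 - \<alpha> k) * \<delta>" if "\<bar>x k\<bar> < \<delta>" using that elim by (intro mult_left_mono) auto
      moreover have "\<alpha> k * \<delta> \<ge> 0" using a0 d by simp
      ultimately show ?case using 1 elim(3) d by (auto simp: algebra_simps)
    qed
    thus "\<exists>c>0. eventually (\<lambda>k. (\<delta> \<le> \<bar>x k\<bar> \<longrightarrow> \<bar>x (Suc k)\<bar> \<le> \<bar>x k\<bar> - c * \<alpha> k)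
        \<and> (\<bar>x k\<bar> < \<delta> \<longrightarrow> \<bar>x (Suc k)\<bar> \<le> 2 * \<delta>)) sequentially"
      using d by (intro exI[of _ "\<delta> / 2"]) auto
  qed simp
  thus ?thesis by (rule tendsto_rabs_zero_cancel)
qed

text \<open>A form of Kronecker's lemma for moving averages. The tail \<open>s\<close> of the
  convergent noise series is added to \<open>N / G\<close>; since
  \<open>z k = s k - s (Suc k)\<close>, the noise cancels, and the new value of \<open>y\<close> is
  a convex combination of the old one and of tails that tend to \<open>0\<close>. Monotonicity of
  \<open>G\<close> makes \<open>\<theta> k\<close> a weight between \<open>0\<close> and
  \<open>1\<close>.\<close>

lemma averaged_noise_vanishes:
  fixes N \<alpha> w G :: "nat \<Rightarrow> real"
  assumes a0: "\<And>k. 0 \<le> \<alpha> k" and a1: "\<alpha> \<longlonglongrightarrow> 0" and div: "\<not> summable \<alpha>"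
    and rec: "\<And>k. N (Suc k) = (1 - \<alpha> k) * N k + \<alpha> k * w k"
    and G: "incseq G" "\<And>k. 1 \<le> G k"
    and sm: "summable (\<lambda>k. \<alpha> k * w k / G k)"
  shows "(\<lambda>k. N k / G k) \<longlonglongrightarrow> 0"
proof -
  define z where "z k = \<alpha> k * w k / G k" for k
  define s where "s k = (\<Sum>j. z (j + k))" for k
  have s0: "s \<longlonglongrightarrow> 0" unfolding s_def using suminf_exist_split2[of z] sm unfolding z_def[abs_def] by blast
  have sS: "s k = z k + s (Suc k)" for k
  proof -
    have "summable (\<lambda>j. z (j + k))" using sm summable_iff_shift[of z k] unfolding z_def[abs_def] by blast
    from suminf_split_head[OF this] show ?thesis unfolding s_def by simp
  qed
  define v where "v k = N k / G k" for k
  define \<theta> where "\<theta> k = G k / G (Suc k)" for k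
  have G0: "G k > 0" for k using G(2)[of k] by linarith
  have th: "0 \<le> \<theta> k" "\<theta> k \<le> 1" for k
    unfolding \<theta>_def using G0[of k] G0[of "Suc k"] incseqD[OF G(1), of k "Suc k"] by auto
  have v: "v (Suc k) = \<theta> k * ((1 - \<alpha> k) * v k + z k)" for k
    unfolding v_def \<theta>_def z_def rec using G0[of k] G0[of "Suc k"] by (simp add: field_simps)
  define y where "y k = v k + s k" for k
  have y: "y (Suc k) = \<theta> k * ((1 - \<alpha> k) * y k + \<alpha> k * s k) + (1 - \<theta> k) * s (Suc k)" for k
    unfolding y_def v using sS[of k] by (simp add: algebra_simps)
  have "(\<lambda>k. \<bar>y k\<bar>) \<longlonglongrightarrow> 0"
  proof (rule descent_to_zero[OF _ a0 div])
    fix \<delta> :: real assume d: "\<delta> > 0"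
    have s1: "eventually (\<lambda>k. \<bar>s k\<bar> < \<delta> / 2) sequentially"
      using tendsto_rabs_zero[OF s0] d by (intro order_tendstoD) auto
    hence s2: "eventually (\<lambda>k. \<bar>s (Suc k)\<bar> < \<delta> / 2) sequentially" by (subst eventually_sequentially_Suc)
    have "eventually (\<lambda>k. \<alpha> k < 1) sequentially" using a1 by (intro order_tendstoD) auto
    with s1 s2 have "eventually (\<lambda>k. (\<delta> \<le> \<bar>y k\<bar> \<longrightarrow> \<bar>y (Suc k)\<bar> \<le> \<bar>y k\<bar> - \<delta> / 2 * \<alpha> k)
        \<and> (\<bar>y k\<bar> < \<delta> \<longrightarrow> \<bar>y (Suc k)\<bar> \<le> 2 * \<delta>)) sequentially"
    proof eventually_elim
      case (elim k)
      define X where "X = max \<bar>y k\<bar> \<delta>"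
      define Y where "Y = (1 - \<alpha> k) * X + \<alpha> k * (\<delta> / 2)"
      have X: "X \<ge> \<delta>" "X \<ge> \<bar>y k\<bar>" unfolding X_def by auto
      have aX: "\<alpha> k * \<delta> \<le> \<alpha> k * X" using X a0 by (intro mult_left_mono) auto
      have "(1 - \<alpha> k) * \<delta> \<le> (1 - \<alpha> k) * X" using X elim by (intro mult_left_mono) auto
      moreover have "\<alpha> k * \<delta> \<le> 1 * \<delta>" using elim d by (intro mult_right_mono) auto
      ultimately have Y1: "\<delta> / 2 \<le> Y" unfolding Y_def by (simp add: algebra_simps)
      have "\<bar>(1 - \<alpha> k) * y k + \<alpha> k * s k\<bar> \<le> (1 - \<alpha> k) * \<bar>y k\<bar> + \<alpha> k * \<bar>s k\<bar>"
        by (rule order_trans[OF abs_triangle_ineq]) (use elim a0 in \<open>simp add: abs_mult\<close>)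
      also have "\<dots> \<le> Y" unfolding Y_def using X elim a0 by (intro add_mono mult_left_mono) auto
      finally have 1: "\<bar>(1 - \<alpha> k) * y k + \<alpha> k * s k\<bar> \<le> Y" .
      have "\<bar>y (Suc k)\<bar> \<le> \<theta> k * \<bar>(1 - \<alpha> k) * y k + \<alpha> k * s k\<bar> + (1 - \<theta> k) * \<bar>s (Suc k)\<bar>"
        unfolding y by (rule order_trans[OF abs_triangle_ineq]) (use th in \<open>simp add: abs_mult\<close>)
      also have "\<dots> \<le> \<theta> k * Y + (1 - \<theta> k) * Y" using 1 th elim Y1 by (intro add_mono mult_left_mono) auto
      also have "\<dots> = Y" by (simp add: algebra_simps)
      finally have yY: "\<bar>y (Suc k)\<bar> \<le> Y" .
      have YX: "Y \<le> X - \<delta> / 2 * \<alpha> k" unfolding Y_def using aX by (simp add: algebra_simps)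
      have "0 \<le> \<delta> / 2 * \<alpha> k" using d a0 by simp
      thus ?case using yY YX d unfolding X_def by auto
    qed
    thus "\<exists>c>0. eventually (\<lambda>k. (\<delta> \<le> \<bar>y k\<bar> \<longrightarrow> \<bar>y (Suc k)\<bar> \<le> \<bar>y k\<bar> - c * \<alpha> k)
        \<and> (\<bar>y k\<bar> < \<delta> \<longrightarrow> \<bar>y (Suc k)\<bar> \<le> 2 * \<delta>)) sequentially"
      using d by (intro exI[of _ "\<delta> / 2"]) auto
  qed simp
  hence "y \<longlonglongrightarrow> 0" by (rule tendsto_rabs_zero_cancel)
  hence "(\<lambda>k. y k - s k) \<longlonglongrightarrow> 0 - 0" by (intro tendsto_diff s0)
  thus ?thesis unfolding y_def v_def by simp
qed

text \<open>Suited to contraction over windows whose ends are not fixed in advance: a small value is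
  found at the end of some window of a chain, and inside the windows that follow \<open>D\<close>
  exceeds its initial value by at most \<open>\<epsilon>\<close>.\<close>

lemma chain_contraction:
  fixes D :: "nat \<Rightarrow> real"
  assumes D0: "\<And>k. 0 \<le> D k" and kp: "0 \<le> \<kappa>" "\<kappa> < 1"
    and step: "\<And>\<epsilon>. \<epsilon> > 0 \<Longrightarrow> \<exists>K. \<forall>k0\<ge>K. \<exists>k1>k0. D k1 \<le> \<kappa> * D k0 + \<epsilon> \<and> (\<forall>k\<in>{k0..k1}. D k \<le> D k0 + \<epsilon>)"
  shows "D \<longlonglongrightarrow> 0"
proof (rule LIMSEQ_I)
  fix e :: real assume e: "e > 0"
  \<comment> \<open>While \<open>D > e / 2\<close>, a window contracts by at least
    \<open>(1 - \<kappa>) * e / 2 = 2 * \<epsilon>\<close> and the error returns at most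
    \<open>\<epsilon>\<close>, so \<open>\<epsilon>\<close> is gained each time.\<close>
  define \<epsilon> where "\<epsilon> = e * (1 - \<kappa>) / 4"
  have ep: "\<epsilon> > 0" "\<epsilon> \<le> e / 4" unfolding \<epsilon>_def using e kp by auto
  obtain K where K: "\<And>k0. k0 \<ge> K \<Longrightarrow> \<exists>k1>k0. D k1 \<le> \<kappa> * D k0 + \<epsilon> \<and> (\<forall>k\<in>{k0..k1}. D k \<le> D k0 + \<epsilon>)"
    using step[OF ep(1)] by blast
  have "\<exists>k\<ge>K. D k \<le> e / 2"
  proof (rule ccontr)
    assume "\<not> ?thesis"
    hence gt: "D k > e / 2" if "k \<ge> K" for k using that by force
    have "\<exists>k\<ge>K. D k \<le> D K - real n * \<epsilon>" for n
    proof (induction n)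
      case 0 thus ?case by auto
    next
      case (Suc n)
      then obtain k where k: "k \<ge> K" "D k \<le> D K - real n * \<epsilon>" by blast
      obtain k1 where k1: "k1 > k" "D k1 \<le> \<kappa> * D k + \<epsilon>" using K[OF k(1)] by blast
      have "(1 - \<kappa>) * (e / 2) \<le> (1 - \<kappa>) * D k" using gt[OF k(1)] kp by (intro mult_left_mono) auto
      hence "D k1 \<le> D k - \<epsilon>" using k1(2) unfolding \<epsilon>_def by (simp add: algebra_simps)
      thus ?case using k k1(1) by (intro exI[of _ k1]) (auto simp: algebra_simps)
    qed
    moreover obtain n where "D K < real n * \<epsilon>" using reals_Archimedean3[OF ep(1)] by blast
    ultimately show False using D0 by (smt (verit))
  qed
  then obtain k0 where k0: "k0 \<ge> K" "D k0 \<le> e / 2" by blast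
  have bnd: "D k \<le> e / 2 + \<epsilon>" if "k \<ge> k0" "k0 \<ge> K" "D k0 \<le> e / 2" for k k0
    using that
  proof (induction "k - k0" arbitrary: k0 rule: less_induct)
    case less
    obtain k1 where k1: "k1 > k0" "D k1 \<le> \<kappa> * D k0 + \<epsilon>" "\<forall>k\<in>{k0..k1}. D k \<le> D k0 + \<epsilon>"
      using K[OF less.prems(2)] by blast
    show ?case
    proof (cases "k \<le> k1")
      case True
      hence "D k \<le> D k0 + \<epsilon>" using k1(3) less.prems by simp
      thus ?thesis using less.prems by simp
    next
      case False
      have "\<kappa> * D k0 \<le> \<kappa> * (e / 2)" using less.prems kp by (intro mult_left_mono) auto
      hence "\<kappa> * D k0 \<le> (\<kappa> * e) / 2" by simp
      moreover have "\<kappa> * e \<le> e" using mult_right_mono[of \<kappa> 1 e] e kp by simp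
      moreover have "\<epsilon> = (e - \<kappa> * e) / 4" unfolding \<epsilon>_def by (simp add: algebra_simps)
      ultimately have "D k1 \<le> e / 2" using k1(2) by argo
      thus ?thesis using False k1(1) less.prems by (intro less.hyps[of k1]) auto
    qed
  qed
  show "\<exists>no. \<forall>n\<ge>no. norm (D n - 0) < e"
  proof (intro exI[of _ k0] allI impI)
    fix n assume "n \<ge> k0"
    hence "D n \<le> e / 2 + \<epsilon>" using bnd k0 by blast
    thus "norm (D n - 0) < e" using ep e D0[of n] by simp
  qed
qed

lemma window_exists:
  fixes \<beta> :: "nat \<Rightarrow> real"
  assumes b0: "\<And>k. 0 \<le> \<beta> k" and div: "\<not> summable \<beta>" and x: "x > 0"
    and small: "\<And>k. k \<ge> m \<Longrightarrow> \<beta> k \<le> x"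
  shows "\<exists>n>m. x \<le> sum \<beta> {m..<n} \<and> sum \<beta> {m..<n} \<le> 2 * x"
proof -
  have "\<exists>n. x \<le> sum \<beta> {m..<n}"
  proof (rule ccontr)
    assume "\<not> ?thesis"
    hence lt: "sum \<beta> {m..<n} < x" for n by (meson not_le)
    have "(\<Sum>k<n. \<beta> (k + m)) \<le> x" for n
      using lt[of "n + m"] sum.shift_bounds_nat_ivl[of \<beta> 0 m n] by (simp add: atLeast0LessThan)
    hence "summable (\<lambda>k. \<beta> (k + m))" using b0 by (intro summableI_nonneg_bounded) auto
    thus False using div by (simp add: summable_iff_shift)
  qed
  define n where "n = (LEAST n. x \<le> sum \<beta> {m..<n})"
  have n: "x \<le> sum \<beta> {m..<n}" unfolding n_def by (rule LeastI_ex) fact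
  hence mn: "n > m" using x by (cases "n > m") auto
  have "n - 1 < (LEAST n. x \<le> sum \<beta> {m..<n})" using mn unfolding n_def[symmetric] by simp
  from not_less_Least[OF this] have "sum \<beta> {m..<n-1} < x" by simp
  moreover have "sum \<beta> {m..<n} = sum \<beta> {m..<n-1} + \<beta> (n - 1)"
    using mn by (cases n) auto
  moreover have "\<beta> (n - 1) \<le> x" using small[of "n-1"] mn by simp
  ultimately show ?thesis using n mn by (intro exI[of _ n]) auto
qed

text \<open>The product of the factors \<open>1 - \<alpha> k\<close> is at least \<open>1\<close>
  minus the sum of the steps. Over mass at most \<open>1/4\<close>, three quarters of an excess
  survive.\<close>

lemma averaging_lower_persist:
  fixes z \<alpha> :: "nat \<Rightarrow> real"
  assumes "m \<le> n" "0 \<le> z m" "sum \<alpha> {m..<n} \<le> 1"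
    and "\<And>k. m \<le> k \<Longrightarrow> k < n \<Longrightarrow> 0 \<le> \<alpha> k \<and> \<alpha> k \<le> 1 \<and> (1 - \<alpha> k) * z k \<le> z (Suc k)"
  shows "(1 - sum \<alpha> {m..<n}) * z m \<le> z n"
  using assms
proof (induction n rule: dec_induct)
  case (step n)
  have a: "0 \<le> \<alpha> n" "\<alpha> n \<le> 1" "(1 - \<alpha> n) * z n \<le> z (Suc n)" using step.prems(3)[of n] step.hyps by auto
  have S: "sum \<alpha> {m..<Suc n} = sum \<alpha> {m..<n} + \<alpha> n" using step.hyps by simp
  have S0: "0 \<le> sum \<alpha> {m..<n}" using step.prems(3) step.hyps by (intro sum_nonneg) auto
  have IH: "(1 - sum \<alpha> {m..<n}) * z m \<le> z n" using step.IH step.prems S a by auto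
  have "(1 - sum \<alpha> {m..<Suc n}) * z m \<le> (1 - \<alpha> n) * ((1 - sum \<alpha> {m..<n}) * z m)"
    unfolding S using step.prems(1) a S0 by (simp add: algebra_simps)
  also have "\<dots> \<le> (1 - \<alpha> n) * z n" using IH a by (intro mult_left_mono) auto
  finally show ?case using a by linarith
qed simp

text \<open>Discrete relaxation towards a level of at least \<open>t\<close>, resting on
  \<open>1 - \<alpha> n \<le> exp (- \<alpha> n)\<close>.\<close>

lemma averaging_lower_growth:
  fixes z \<alpha> :: "nat \<Rightarrow> real"
  assumes "m \<le> n" "0 \<le> z m" "0 \<le> t"
    and "\<And>k. m \<le> k \<Longrightarrow> k < n \<Longrightarrow> 0 \<le> \<alpha> k \<and> \<alpha> k \<le> 1 \<and> (1 - \<alpha> k) * z k + \<alpha> k * t \<le> z (Suc k)"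
  shows "(1 - exp (- sum \<alpha> {m..<n})) * t \<le> z n"
  using assms
proof (induction n rule: dec_induct)
  case (step n)
  have a: "0 \<le> \<alpha> n" "\<alpha> n \<le> 1" "(1 - \<alpha> n) * z n + \<alpha> n * t \<le> z (Suc n)" using step.prems(3)[of n] step.hyps by auto
  have S: "sum \<alpha> {m..<Suc n} = sum \<alpha> {m..<n} + \<alpha> n" using step.hyps by simp
  define E where "E = exp (- sum \<alpha> {m..<n})"
  have IH: "(1 - E) * t \<le> z n" unfolding E_def using step.IH step.prems by auto
  have "1 - \<alpha> n \<le> exp (- \<alpha> n)" using exp_ge_add_one_self[of "- \<alpha> n"] by simp
  hence "(1 - \<alpha> n) * (E * t) \<le> exp (- \<alpha> n) * (E * t)" using step.prems(2) by (intro mult_right_mono) (auto simp: E_def)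
  moreover have "exp (- sum \<alpha> {m..<Suc n}) = exp (- \<alpha> n) * E" unfolding S E_def by (simp add: exp_add[symmetric])
  ultimately have "(1 - exp (- sum \<alpha> {m..<Suc n})) * t \<le> (1 - \<alpha> n) * ((1 - E) * t) + \<alpha> n * t"
    by (simp add: algebra_simps)
  also have "\<dots> \<le> (1 - \<alpha> n) * z n + \<alpha> n * t" using IH a by (intro add_mono mult_left_mono) auto
  finally show ?case using a by linarith
qed simp

section \<open>Span contraction of asynchronous value iteration\<close>

declare split_paired_All [simp del] split_paired_Ex [simp del]

definition spn :: "real ^ 'n::finite \<Rightarrow> real" where
  "spn y = Max (range (\<lambda>(i, j). y $ i - y $ j))"

lemma spn_ge: "y $ i - y $ j \<le> spn y"
  unfolding spn_def by (rule Max_ge) (auto intro: range_eqI[where x="(i, j)"])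

lemma spn_leI: "(\<And>i j. y $ i - y $ j \<le> c) \<Longrightarrow> spn y \<le> c"
  unfolding spn_def by (subst Max_le_iff) auto

lemma spn_nonneg: "0 \<le> spn y"
  using spn_ge[of y undefined undefined] by simp

lemma spn_bounds:
  obtains l where "\<And>i. l \<le> y $ i" "\<And>i. y $ i \<le> l + spn y"
proof -
  have "Min (range (($) y)) \<in> range (($) y)" by (rule Min_in) auto
  then obtain j where j: "y $ j = Min (range (($) y))" by (metis rangeE)
  hence "y $ j \<le> y $ i" for i by simp
  moreover have "y $ i \<le> y $ j + spn y" for i using spn_ge[of y i j] by simp
  ultimately show ?thesis using that by blast
qed

lemma spn_le_bounds: "(\<And>i. l \<le> y $ i) \<Longrightarrow> (\<And>i. y $ i \<le> h) \<Longrightarrow> spn y \<le> h - l"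
  by (rule spn_leI) (smt (verit))

lemma spn_perturb:
  assumes "\<And>i. \<bar>x $ i - y $ i\<bar> \<le> c"
  shows "spn x \<le> spn y + 2 * c"
proof (rule spn_leI)
  fix i j show "x $ i - x $ j \<le> spn y + 2 * c"
    using assms[of i] assms[of j] spn_ge[of y i j] by linarith
qed

text \<open>For the optimal \<open>q\<close>, \<open>Tq (q + y) = q + gain + PT p q y\<close>: \<open>PT\<close> is the Bellman operator seen from \<open>q\<close>.\<close>

definition tilt :: "real ^ ('s::finite \<times> 'b::finite) \<Rightarrow> real ^ ('s \<times> 'b) \<Rightarrow> 's \<Rightarrow> real" where
  "tilt q y s = maxQ (q + y) s - maxQ q s"

definition PT :: "('s::finite \<Rightarrow> 'b::finite \<Rightarrow> 's \<Rightarrow> real) \<Rightarrow> real ^ ('s \<times> 'b) \<Rightarrow> real ^ ('s \<times> 'b) \<Rightarrow> 's \<times> 'b \<Rightarrow> real" where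
  "PT p q y i = (\<Sum>s'\<in>UNIV. p (fst i) (snd i) s' * tilt q y s')"

lemma tilt_upper: "(\<And>a. y $ (s, a) \<le> h) \<Longrightarrow> tilt q y s \<le> h"
  unfolding tilt_def by (rule maxQ_diff_le) simp

lemma tilt_lower: "(\<And>a. l \<le> y $ (s, a)) \<Longrightarrow> l \<le> tilt q y s"
  using maxQ_diff_le[of q s "q + y" "- l"] unfolding tilt_def by fastforce

lemma tilt_ge_greedy: "maxQ q s = q $ (s, a) \<Longrightarrow> y $ (s, a) \<le> tilt q y s"
  using maxQ_ge[of "q + y" s a] unfolding tilt_def by simp

lemma tilt_le_iff: "tilt q y s \<le> c \<longleftrightarrow> (\<forall>a. q $ (s, a) + y $ (s, a) \<le> maxQ q s + c)"
  unfolding tilt_def using maxQ_le_iff[of "q + y" s "maxQ q s + c"] by (simp add: algebra_simps)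

lemma tilt_diff: "(\<And>i. \<bar>y $ i - z $ i\<bar> \<le> c) \<Longrightarrow> \<bar>tilt q y s - tilt q z s\<bar> \<le> c"
  using maxQ_diff_abs_le[of "q + y" "q + z" c s] unfolding tilt_def by simp

lemma PT_upper: "is_mdp p \<Longrightarrow> (\<And>i. y $ i \<le> h) \<Longrightarrow> PT p q y i \<le> h"
  unfolding PT_def by (intro mdp_avg_le tilt_upper)

lemma PT_lower: "is_mdp p \<Longrightarrow> (\<And>i. l \<le> y $ i) \<Longrightarrow> l \<le> PT p q y i"
  unfolding PT_def by (intro mdp_avg_ge tilt_lower)

lemma PT_diff:
  assumes "is_mdp p" "\<And>i. \<bar>y $ i - z $ i\<bar> \<le> c"
  shows "\<bar>PT p q y i - PT p q z i\<bar> \<le> c"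
proof -
  have "PT p q y i - PT p q z i = (\<Sum>s'\<in>UNIV. p (fst i) (snd i) s' * (tilt q y s' - tilt q z s'))"
    unfolding PT_def by (simp add: right_diff_distrib sum_subtractf)
  thus ?thesis using mdp_avg_abs_le[OF assms(1), of "\<lambda>s'. tilt q y s' - tilt q z s'"] tilt_diff[of y z c q] assms(2)
    by simp
qed

lemma PT_shift: "is_mdp p \<Longrightarrow> PT p q (y + c *\<^sub>R ones) i = PT p q y i + c"
  unfolding PT_def tilt_def add.assoc[symmetric] maxQ_shift
  using mdp_avg_shift[of p "fst i" "snd i" "\<lambda>s'. maxQ (q + y) s' - maxQ q s'" c] by (simp add: algebra_simps)

lemma mdp_avg_ge_support:
  assumes mdp: "is_mdp p" and w: "\<And>s'. l \<le> w s'" and c: "c \<le> p s a t" "0 \<le> c" and t: "l + \<delta> \<le> w t" "0 \<le> \<delta>"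
  shows "l + c * \<delta> \<le> (\<Sum>s'\<in>UNIV. p s a s' * w s')"
proof -
  have "c * \<delta> \<le> p s a t * (w t - l)" using c t by (intro mult_mono) auto
  also have "\<dots> \<le> (\<Sum>s'\<in>UNIV. p s a s' * (w s' - l))"
    by (rule member_le_sum[of t UNIV "\<lambda>s'. p s a s' * (w s' - l)"]) (use mdp_nonneg[OF mdp] w in auto)
  also have "\<dots> = (\<Sum>s'\<in>UNIV. p s a s' * w s') - l"
    using mdp_avg_shift[OF mdp, of s a w "- l"] by simp
  finally show ?thesis by simp
qed

lemma mdp_avg_le_support:
  assumes "is_mdp p" "\<And>s'. w s' \<le> h" "c \<le> p s a t" "0 \<le> c" "w t \<le> h - \<delta>" "0 \<le> \<delta>"
  shows "(\<Sum>s'\<in>UNIV. p s a s' * w s') \<le> h - c * \<delta>"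
  using mdp_avg_ge_support[of p "- h" "\<lambda>s'. - w s'" c s a t \<delta>] assms by (simp add: sum_negf)

text \<open>Asynchronous value iteration in the coordinates \<open>y = Q - q\<close>, with perturbation \<open>e\<close>.\<close>

definition avi where
  "avi p q \<alpha> e y m n \<longleftrightarrow> (\<forall>k\<in>{m..<n}. \<forall>i. y (Suc k) $ i = y k $ i + \<alpha> k i * (PT p q (y k) i - y k $ i + e k i))"

definition unit_steps :: "(nat \<Rightarrow> 'i \<Rightarrow> real) \<Rightarrow> nat \<Rightarrow> nat \<Rightarrow> bool" where
  "unit_steps \<alpha> m n \<longleftrightarrow> (\<forall>k\<in>{m..<n}. \<forall>i. 0 \<le> \<alpha> k i \<and> \<alpha> k i \<le> 1)"

abbreviation no_err :: "nat \<Rightarrow> 'i \<Rightarrow> real" where "no_err \<equiv> \<lambda>_ _. 0"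

lemma avi_no_err_step:
  assumes "avi p q \<alpha> no_err y m n" "k \<in> {m..<n}"
  shows "y (Suc k) $ i = (1 - \<alpha> k i) * y k $ i + \<alpha> k i * PT p q (y k) i"
  using assms unfolding avi_def by (simp add: algebra_simps)

lemma avi_subinterval: "avi p q \<alpha> e y m n \<Longrightarrow> m \<le> m' \<Longrightarrow> n' \<le> n \<Longrightarrow> avi p q \<alpha> e y m' n'"
  unfolding avi_def by auto

lemma unit_steps_subinterval: "unit_steps \<alpha> m n \<Longrightarrow> m \<le> m' \<Longrightarrow> n' \<le> n \<Longrightarrow> unit_steps \<alpha> m' n'"
  unfolding unit_steps_def by auto

lemma avi_bounds:
  assumes mdp: "is_mdp p" and it: "avi p q \<alpha> no_err y m n" and st: "unit_steps \<alpha> m n"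
    and lo: "\<And>i. l \<le> y m $ i" and hi: "\<And>i. y m $ i \<le> h"
    and mk: "m \<le> k" "k \<le> n"
  shows "l \<le> y k $ i \<and> y k $ i \<le> h"
proof -
  have "\<forall>i. l \<le> y k $ i \<and> y k $ i \<le> h" using mk
  proof (induction k rule: dec_induct)
    case base thus ?case using lo hi by blast
  next
    case (step k)
    hence IH: "\<And>i. l \<le> y k $ i" "\<And>i. y k $ i \<le> h" by auto
    show ?case
    proof
      fix i
      have a: "0 \<le> \<alpha> k i" "\<alpha> k i \<le> 1" using st step unfolding unit_steps_def by (meson atLeastLessThan_iff Suc_le_lessD)+
      have y: "y (Suc k) $ i = (1 - \<alpha> k i) * y k $ i + \<alpha> k i * PT p q (y k) i"
        by (rule avi_no_err_step[OF it]) (use step in auto)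
      have "(1 - \<alpha> k i) * l + \<alpha> k i * l \<le> y (Suc k) $ i" unfolding y
        using a IH PT_lower[OF mdp IH(1)] by (intro add_mono mult_left_mono) auto
      moreover have "y (Suc k) $ i \<le> (1 - \<alpha> k i) * h + \<alpha> k i * h" unfolding y
        using a IH PT_upper[OF mdp IH(2)] by (intro add_mono mult_left_mono) auto
      ultimately show "l \<le> y (Suc k) $ i \<and> y (Suc k) $ i \<le> h" by (simp add: algebra_simps)
    qed
  qed
  thus ?thesis by blast
qed

text \<open>The lower bound \<open>\<tau>\<close> makes every component move, the upper bound
  \<open>1/4\<close> preserves most of its value: long enough to pass information on, short enough
  not to erase it at its source.\<close>

definition short_window :: "(nat \<Rightarrow> 'i \<Rightarrow> real) \<Rightarrow> real \<Rightarrow> nat \<Rightarrow> nat \<Rightarrow> bool" where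
  "short_window \<alpha> \<tau> m n \<longleftrightarrow> m \<le> n \<and> unit_steps \<alpha> m n \<and>
     (\<forall>i. \<tau> \<le> (\<Sum>k\<in>{m..<n}. \<alpha> k i) \<and> (\<Sum>k\<in>{m..<n}. \<alpha> k i) \<le> 1/4)"

lemma short_window_partial_sum:
  assumes "short_window \<alpha> \<tau> m n" "k \<le> n"
  shows "(\<Sum>j\<in>{m..<k}. \<alpha> j i) \<le> 1/4"
proof -
  have "(\<Sum>j\<in>{m..<k}. \<alpha> j i) \<le> (\<Sum>j\<in>{m..<n}. \<alpha> j i)"
    using assms by (intro sum_mono2) (auto simp: short_window_def unit_steps_def)
  thus ?thesis using assms unfolding short_window_def by (meson order_trans)
qed

lemma short_windows_mono:
  assumes "\<And>j. j < J \<Longrightarrow> short_window \<alpha> \<tau> (T j) (T (Suc j))" "i \<le> j" "j \<le> J"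
  shows "T i \<le> T j"
  using assms(2,3)
proof (induction j rule: dec_induct)
  case (step j) thus ?case using assms(1)[of j] unfolding short_window_def by auto
qed simp

lemma short_windows_unit_steps:
  assumes "\<And>j. j < J \<Longrightarrow> short_window \<alpha> \<tau> (T j) (T (Suc j))" "j \<le> J"
  shows "unit_steps \<alpha> (T 0) (T j)"
  using assms(2)
proof (induction j)
  case 0 thus ?case by (simp add: unit_steps_def)
next
  case (Suc j)
  hence "unit_steps \<alpha> (T 0) (T j)" "unit_steps \<alpha> (T j) (T (Suc j))" using assms(1)[of j] by (auto simp: short_window_def)
  thus ?case unfolding unit_steps_def by (metis atLeastLessThan_iff linorder_not_le)
qed

locale contraction =
  fixes p :: "'s::finite \<Rightarrow> 'b::finite \<Rightarrow> 's \<Rightarrow> real" and q :: "real ^ ('s \<times> 'b)"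
    and d :: "'s \<Rightarrow> 'b" and pm \<tau> :: real
  assumes mdp: "is_mdp p" and irr: "policy_irreducible p"
    and d: "\<And>s. maxQ q s = q $ (s, d s)"
    and pm: "0 < pm" "pm \<le> 1" "\<And>s a s'. p s a s' > 0 \<Longrightarrow> pm \<le> p s a s'"
    and tau: "0 < \<tau>"
begin

text \<open>The share of an excess that is passed on in one window: three quarters persist at the
  source, a transition of probability at least \<open>pm\<close> leads there, and averaging of mass
  at least \<open>\<tau>\<close> absorbs the fraction \<open>1 - exp (- \<tau>)\<close>.\<close>

definition "c = 3/4 * pm * (1 - exp (- \<tau>))"

lemma c: "0 < c" "c \<le> 3/4" "c \<le> 1"
proof -
  have E: "0 < 1 - exp (- \<tau>)" "1 - exp (- \<tau>) \<le> 1" using tau by auto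
  show "0 < c" unfolding c_def using E pm by simp
  have "pm * (1 - exp (- \<tau>)) \<le> 1 * 1" using E pm by (intro mult_mono) auto
  thus "c \<le> 3/4" "c \<le> 1" unfolding c_def by auto
qed

text \<open>A state value that exceeds the minimum \<open>l\<close> by \<open>\<delta>\<close> lifts its predecessors under the greedy policy
  \<open>d\<close> of \<open>q\<close>, and this spreads backwards to all states by irreducibility. A value below the maximum lowers those
  states from which every action may lead to it; here irreducibility of all policies is needed.\<close>

lemma window_growth_lower:
  assumes w: "short_window \<alpha> \<tau> m n" and it: "avi p q \<alpha> no_err y m n"
    and lo: "\<And>i. l \<le> y m $ i" and dl: "0 \<le> \<delta>"
    and V: "\<And>k. m \<le> k \<Longrightarrow> k < n \<Longrightarrow> l + \<delta> \<le> tilt q (y k) t" and t: "p (fst i) (snd i) t > 0"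
  shows "l + pm * (1 - exp (- \<tau>)) * \<delta> \<le> y n $ i"
proof -
  have mn: "m \<le> n" and st: "unit_steps \<alpha> m n" using w unfolding short_window_def by auto
  obtain h where hi: "\<And>i. y m $ i \<le> h" using spn_bounds[of "y m"] by metis
  have lo': "l \<le> y k $ i" if "m \<le> k" "k \<le> n" for k i
    using avi_bounds[OF mdp it st lo hi that] by simp
  have "(1 - exp (- (\<Sum>k\<in>{m..<n}. \<alpha> k i))) * (pm * \<delta>) \<le> y n $ i - l"
  proof (rule averaging_lower_growth[OF mn])
    fix k assume k: "m \<le> k" "k < n"
    have a: "0 \<le> \<alpha> k i" "\<alpha> k i \<le> 1" using st k unfolding unit_steps_def by auto
    have "l + pm * \<delta> \<le> PT p q (y k) i" unfolding PT_def
      by (rule mdp_avg_ge_support[where w="tilt q (y k)", OF mdp tilt_lower pm(3)[OF t] _ V[OF k] dl]) (use lo' k pm in auto)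
    hence "\<alpha> k i * (l + pm * \<delta>) \<le> \<alpha> k i * PT p q (y k) i" using a by (intro mult_left_mono) auto
    moreover have "y (Suc k) $ i = (1 - \<alpha> k i) * y k $ i + \<alpha> k i * PT p q (y k) i"
      by (rule avi_no_err_step[OF it]) (use k in auto)
    ultimately show "0 \<le> \<alpha> k i \<and> \<alpha> k i \<le> 1 \<and> (1 - \<alpha> k i) * (y k $ i - l) + \<alpha> k i * (pm * \<delta>) \<le> y (Suc k) $ i - l"
      using a by (simp add: algebra_simps)
  qed (use lo pm dl in auto)
  moreover have "(1 - exp (- \<tau>)) * (pm * \<delta>) \<le> (1 - exp (- (\<Sum>k\<in>{m..<n}. \<alpha> k i))) * (pm * \<delta>)"
    using w pm dl by (intro mult_right_mono) (auto simp: short_window_def)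
  ultimately show ?thesis by (simp add: algebra_simps)
qed

lemma window_growth_upper:
  assumes w: "short_window \<alpha> \<tau> m n" and it: "avi p q \<alpha> no_err y m n"
    and hi: "\<And>i. y m $ i \<le> h" and dl: "0 \<le> \<delta>"
    and V: "\<And>k. m \<le> k \<Longrightarrow> k < n \<Longrightarrow> tilt q (y k) t \<le> h - \<delta>" and t: "p (fst i) (snd i) t > 0"
  shows "y n $ i \<le> h - pm * (1 - exp (- \<tau>)) * \<delta>"
proof -
  have mn: "m \<le> n" and st: "unit_steps \<alpha> m n" using w unfolding short_window_def by auto
  obtain l where lo: "\<And>i. l \<le> y m $ i" using spn_bounds[of "y m"] by metis
  have hi': "y k $ i \<le> h" if "m \<le> k" "k \<le> n" for k i
    using avi_bounds[OF mdp it st lo hi that] by simp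
  have "(1 - exp (- (\<Sum>k\<in>{m..<n}. \<alpha> k i))) * (pm * \<delta>) \<le> h - y n $ i"
  proof (rule averaging_lower_growth[OF mn])
    fix k assume k: "m \<le> k" "k < n"
    have a: "0 \<le> \<alpha> k i" "\<alpha> k i \<le> 1" using st k unfolding unit_steps_def by auto
    have "PT p q (y k) i \<le> h - pm * \<delta>" unfolding PT_def
      by (rule mdp_avg_le_support[where w="tilt q (y k)", OF mdp tilt_upper pm(3)[OF t] _ V[OF k] dl]) (use hi' k pm in auto)
    hence "\<alpha> k i * PT p q (y k) i \<le> \<alpha> k i * (h - pm * \<delta>)" using a by (intro mult_left_mono) auto
    moreover have "y (Suc k) $ i = (1 - \<alpha> k i) * y k $ i + \<alpha> k i * PT p q (y k) i"
      by (rule avi_no_err_step[OF it]) (use k in auto)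
    ultimately show "0 \<le> \<alpha> k i \<and> \<alpha> k i \<le> 1 \<and> (1 - \<alpha> k i) * (h - y k $ i) + \<alpha> k i * (pm * \<delta>) \<le> h - y (Suc k) $ i"
      using a by (simp add: algebra_simps)
  qed (use hi pm dl in auto)
  moreover have "(1 - exp (- \<tau>)) * (pm * \<delta>) \<le> (1 - exp (- (\<Sum>k\<in>{m..<n}. \<alpha> k i))) * (pm * \<delta>)"
    using w pm dl by (intro mult_right_mono) (auto simp: short_window_def)
  ultimately show ?thesis by (simp add: algebra_simps)
qed

text \<open>An excess at the greedy pair \<open>(s, d s)\<close> alone is enough to lift the tilt at
  \<open>s\<close>. It persists through the window and meanwhile lifts all pairs with a transition
  into \<open>G\<close>.\<close>

lemma window_step_lower:
  assumes w: "short_window \<alpha> \<tau> m n" and it: "avi p q \<alpha> no_err y m n"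
    and lo: "\<And>i. l \<le> y m $ i" and dl: "0 \<le> \<delta>"
    and G: "\<And>s. s \<in> G \<Longrightarrow> l + \<delta> \<le> y m $ (s, d s)"
  shows "(\<forall>s\<in>G. l + c * \<delta> \<le> y n $ (s, d s)) \<and> (\<forall>i. (\<exists>t\<in>G. p (fst i) (snd i) t > 0) \<longrightarrow> l + c * \<delta> \<le> y n $ i)"
proof -
  have mn: "m \<le> n" and st: "unit_steps \<alpha> m n" using w unfolding short_window_def by auto
  obtain h where hi: "\<And>i. y m $ i \<le> h" using spn_bounds[of "y m"] by metis
  have persist: "l + 3/4 * \<delta> \<le> y k $ (s, d s)" if s: "s \<in> G" and k: "m \<le> k" "k \<le> n" for s k
  proof -
    have "(1 - (\<Sum>j\<in>{m..<k}. \<alpha> j (s, d s))) * (y m $ (s, d s) - l) \<le> y k $ (s, d s) - l"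
    proof (rule averaging_lower_persist[OF k(1)])
      fix j assume j: "m \<le> j" "j < k"
      have a: "0 \<le> \<alpha> j (s, d s)" "\<alpha> j (s, d s) \<le> 1" using st j k unfolding unit_steps_def by auto
      have "l \<le> PT p q (y j) (s, d s)"
        by (rule PT_lower[OF mdp]) (use avi_bounds[OF mdp it st lo hi, of j] j k in auto)
      hence "\<alpha> j (s, d s) * l \<le> \<alpha> j (s, d s) * PT p q (y j) (s, d s)" using a by (intro mult_left_mono) auto
      moreover have "y (Suc j) $ (s, d s) = (1 - \<alpha> j (s, d s)) * y j $ (s, d s) + \<alpha> j (s, d s) * PT p q (y j) (s, d s)"
        by (rule avi_no_err_step[OF it]) (use j k in auto)
      ultimately show "0 \<le> \<alpha> j (s, d s) \<and> \<alpha> j (s, d s) \<le> 1 \<and> (1 - \<alpha> j (s, d s)) * (y j $ (s, d s) - l) \<le> y (Suc j) $ (s, d s) - l"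
        using a by (simp add: algebra_simps)
    qed (use short_window_partial_sum[OF w k(2), of "(s, d s)"] lo in auto)
    moreover have "3/4 * \<delta> \<le> (1 - (\<Sum>j\<in>{m..<k}. \<alpha> j (s, d s))) * (y m $ (s, d s) - l)"
      using short_window_partial_sum[OF w k(2), of "(s, d s)"] G[OF s] dl by (intro mult_mono) auto
    ultimately show ?thesis by simp
  qed
  have "l + c * \<delta> \<le> y n $ (s, d s)" if "s \<in> G" for s
    using persist[OF that mn] mult_right_mono[OF c(2) dl] by simp
  moreover have "l + c * \<delta> \<le> y n $ i" if t: "t \<in> G" "p (fst i) (snd i) t > 0" for i t
  proof -
    have "l + pm * (1 - exp (- \<tau>)) * (3/4 * \<delta>) \<le> y n $ i"
    proof (rule window_growth_lower[OF w it lo])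
      fix k assume k: "m \<le> k" "k < n"
      show "l + 3/4 * \<delta> \<le> tilt q (y k) t"
        using persist[OF t(1), of k] tilt_ge_greedy[OF d[of t], of "y k"] k by simp
    qed (use dl t in auto)
    thus ?thesis by (simp add: c_def mult_ac)
  qed
  ultimately show ?thesis by blast
qed

text \<open>Not the mirror image of the lower bound: the tilt is a maximum over actions, so a
  deficit at \<open>s\<close> has to hold for all its actions at once and is therefore recorded as a
  bound on the tilt.\<close>

lemma window_step_upper:
  assumes w: "short_window \<alpha> \<tau> m n" and it: "avi p q \<alpha> no_err y m n"
    and hi: "\<And>i. y m $ i \<le> h" and dl: "0 \<le> \<delta>"
    and G: "\<And>s. s \<in> G \<Longrightarrow> tilt q (y m) s \<le> h - \<delta>"
  shows "(\<forall>s\<in>G. tilt q (y n) s \<le> h - c * \<delta>) \<and> (\<forall>i. (\<exists>t\<in>G. p (fst i) (snd i) t > 0) \<longrightarrow> y n $ i \<le> h - c * \<delta>)"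
proof -
  have mn: "m \<le> n" and st: "unit_steps \<alpha> m n" using w unfolding short_window_def by auto
  obtain l where lo: "\<And>i. l \<le> y m $ i" using spn_bounds[of "y m"] by metis
  have persist: "tilt q (y k) s \<le> h - 3/4 * \<delta>" if s: "s \<in> G" and k: "m \<le> k" "k \<le> n" for s k
    unfolding tilt_le_iff
  proof
    fix a
    have Gs: "q $ (s, a) + y m $ (s, a) \<le> maxQ q s + (h - \<delta>)" using G[OF s] unfolding tilt_le_iff by blast
    \<comment> \<open>The slack of action \<open>a\<close>. It contains the gap
      \<open>maxQ q s - q $ (s, a) \<ge> 0\<close>, so averaging towards values of at most
      \<open>h\<close> cannot reduce it by more than the factor
      \<open>1 - \<alpha> j (s, a)\<close>.\<close>
    define z where "z j = maxQ q s + h - (q $ (s, a) + y j $ (s, a))" for j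
    have "(1 - (\<Sum>j\<in>{m..<k}. \<alpha> j (s, a))) * z m \<le> z k"
    proof (rule averaging_lower_persist[OF k(1)])
      fix j assume j: "m \<le> j" "j < k"
      have a: "0 \<le> \<alpha> j (s, a)" "\<alpha> j (s, a) \<le> 1" using st j k unfolding unit_steps_def by auto
      have "PT p q (y j) (s, a) \<le> h"
        by (rule PT_upper[OF mdp]) (use avi_bounds[OF mdp it st lo hi, of j] j k in auto)
      hence "\<alpha> j (s, a) * PT p q (y j) (s, a) \<le> \<alpha> j (s, a) * h" using a by (intro mult_left_mono) auto
      moreover have "\<alpha> j (s, a) * q $ (s, a) \<le> \<alpha> j (s, a) * maxQ q s" using a maxQ_ge by (intro mult_left_mono) auto
      moreover have "y (Suc j) $ (s, a) = (1 - \<alpha> j (s, a)) * y j $ (s, a) + \<alpha> j (s, a) * PT p q (y j) (s, a)"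
        by (rule avi_no_err_step[OF it]) (use j k in auto)
      ultimately show "0 \<le> \<alpha> j (s, a) \<and> \<alpha> j (s, a) \<le> 1 \<and> (1 - \<alpha> j (s, a)) * z j \<le> z (Suc j)"
        using a by (simp add: z_def algebra_simps)
    qed (use short_window_partial_sum[OF w k(2), of "(s, a)"] Gs dl in \<open>auto simp: z_def\<close>)
    moreover have "3/4 * \<delta> \<le> (1 - (\<Sum>j\<in>{m..<k}. \<alpha> j (s, a))) * z m"
      using short_window_partial_sum[OF w k(2), of "(s, a)"] Gs dl by (intro mult_mono) (auto simp: z_def)
    ultimately show "q $ (s, a) + y k $ (s, a) \<le> maxQ q s + (h - 3/4 * \<delta>)" by (simp add: z_def)
  qed
  have "tilt q (y n) s \<le> h - c * \<delta>" if "s \<in> G" for s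
    using persist[OF that mn] mult_right_mono[OF c(2) dl] by simp
  moreover have "y n $ i \<le> h - c * \<delta>" if t: "t \<in> G" "p (fst i) (snd i) t > 0" for i t
  proof -
    have "y n $ i \<le> h - pm * (1 - exp (- \<tau>)) * (3/4 * \<delta>)"
      by (rule window_growth_upper[OF w it hi, where t=t]) (use persist[OF t(1)] dl t in auto)
    thus ?thesis by (simp add: c_def mult_ac)
  qed
  ultimately show ?thesis by blast
qed

lemma positive_successor: "\<exists>t. p s a t > 0"
proof (rule ccontr)
  assume "\<not> ?thesis"
  hence "p s a t = 0" for t using mdp_nonneg[OF mdp, of s a t] by (meson not_le order_antisym)
  thus False using mdp_sum[OF mdp, of s a] by simp
qed

text \<open>After \<open>CARD('s)\<close> windows the excess has reached the greedy pair of every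
  state. Every pair has some successor, so one more window lifts all pairs. Each window costs a
  factor \<open>c\<close>.\<close>

lemma windows_lower:
  assumes w: "\<And>j. j < J \<Longrightarrow> short_window \<alpha> \<tau> (T j) (T (Suc j))"
    and it: "avi p q \<alpha> no_err y (T 0) (T J)" and J: "J = CARD('s) + 1"
    and lo: "\<And>i. l \<le> y (T 0) $ i" and dl: "0 \<le> \<delta>"
    and G: "G \<noteq> {}" "\<And>s. s \<in> G \<Longrightarrow> l + \<delta> \<le> y (T 0) $ (s, d s)"
  shows "l + c ^ J * \<delta> \<le> y (T J) $ i"
proof -
  obtain h where hi: "\<And>i. y (T 0) $ i \<le> h" using spn_bounds[of "y (T 0)"] by metis
  have Tm: "T 0 \<le> T j" if "j \<le> J" for j
    by (rule short_windows_mono[where T=T and J=J]) (use w that in auto)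
  have Tm': "T j \<le> T J" if "j \<le> J" for j
    by (rule short_windows_mono[where T=T and J=J]) (use w that in auto)
  have st: "unit_steps \<alpha> (T 0) (T j)" if "j \<le> J" for j
    by (rule short_windows_unit_steps[where T=T and J=J]) (use w that in auto)
  have lo': "l \<le> y (T j) $ i" if "j \<le> J" for j i
    using avi_bounds[OF mdp it st lo hi, of "T j" i] Tm[OF that] Tm'[OF that] by auto
  define F where "F G = G \<union> {s. \<exists>s'\<in>G. p s (d s) s' > 0}" for G
  have ind: "\<forall>s\<in>(F ^^ j) G. l + c ^ j * \<delta> \<le> y (T j) $ (s, d s)" if "j \<le> J" for j using that
  proof (induction j)
    case 0 thus ?case using G by simp
  next
    case (Suc j)
    have S: "(\<forall>s\<in>(F ^^ j) G. l + c * (c ^ j * \<delta>) \<le> y (T (Suc j)) $ (s, d s)) \<and>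
       (\<forall>i. (\<exists>t\<in>(F ^^ j) G. p (fst i) (snd i) t > 0) \<longrightarrow> l + c * (c ^ j * \<delta>) \<le> y (T (Suc j)) $ i)"
      by (rule window_step_lower[OF w avi_subinterval[OF it] lo']) (use Suc Tm Tm' c dl in auto)
    have S': "l + c * (c ^ j * \<delta>) \<le> y (T (Suc j)) $ (s, d s)" if "\<exists>t\<in>(F ^^ j) G. p s (d s) t > 0" for s
      using conjunct2[OF S, rule_format, of "(s, d s)"] that by simp
    have "(F ^^ Suc j) G = (F ^^ j) G \<union> {s. \<exists>s'\<in>(F ^^ j) G. p s (d s) s' > 0}" by (simp add: F_def)
    thus ?case unfolding power_Suc mult.assoc using S S' by blast
  qed
  have full: "(F ^^ CARD('s)) G = UNIV"
  proof (rule iterate_to_UNIV[OF _ _ G(1)])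
    show "G = UNIV" if "G \<noteq> {}" "F G = G" for G
      by (rule policy_backward_closed[OF mdp irr that(1), of d]) (use that F_def in blast)
  qed (auto simp: F_def)
  define j where "j = CARD('s)"
  have "(\<forall>s\<in>UNIV. l + c * (c ^ j * \<delta>) \<le> y (T (Suc j)) $ (s, d s)) \<and>
       (\<forall>i. (\<exists>t\<in>UNIV. p (fst i) (snd i) t > 0) \<longrightarrow> l + c * (c ^ j * \<delta>) \<le> y (T (Suc j)) $ i)"
    by (rule window_step_lower[OF w avi_subinterval[OF it] lo'])
      (use J Tm Tm' c dl ind[of j] full in \<open>auto simp: j_def\<close>)
  thus ?thesis using positive_successor[of "fst i" "snd i"] J by (simp add: j_def mult.assoc)
qed

lemma windows_upper:
  assumes w: "\<And>j. j < J \<Longrightarrow> short_window \<alpha> \<tau> (T j) (T (Suc j))"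
    and it: "avi p q \<alpha> no_err y (T 0) (T J)" and J: "J = CARD('s) + 1"
    and hi: "\<And>i. y (T 0) $ i \<le> h" and dl: "0 \<le> \<delta>"
    and G: "G \<noteq> {}" "\<And>s. s \<in> G \<Longrightarrow> tilt q (y (T 0)) s \<le> h - \<delta>"
  shows "y (T J) $ i \<le> h - c ^ J * \<delta>"
proof -
  obtain l where lo: "\<And>i. l \<le> y (T 0) $ i" using spn_bounds[of "y (T 0)"] by metis
  have Tm: "T 0 \<le> T j" if "j \<le> J" for j
    by (rule short_windows_mono[where T=T and J=J]) (use w that in auto)
  have Tm': "T j \<le> T J" if "j \<le> J" for j
    by (rule short_windows_mono[where T=T and J=J]) (use w that in auto)
  have st: "unit_steps \<alpha> (T 0) (T j)" if "j \<le> J" for j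
    by (rule short_windows_unit_steps[where T=T and J=J]) (use w that in auto)
  have hi': "y (T j) $ i \<le> h" if "j \<le> J" for j i
    using avi_bounds[OF mdp it st lo hi, of "T j" i] Tm[OF that] Tm'[OF that] by auto
  define F where "F G = G \<union> {s. \<forall>a. \<exists>s'\<in>G. p s a s' > 0}" for G
  have ind: "\<forall>s\<in>(F ^^ j) G. tilt q (y (T j)) s \<le> h - c ^ j * \<delta>" if "j \<le> J" for j using that
  proof (induction j)
    case 0 thus ?case using G by simp
  next
    case (Suc j)
    have S: "(\<forall>s\<in>(F ^^ j) G. tilt q (y (T (Suc j))) s \<le> h - c * (c ^ j * \<delta>)) \<and>
       (\<forall>i. (\<exists>t\<in>(F ^^ j) G. p (fst i) (snd i) t > 0) \<longrightarrow> y (T (Suc j)) $ i \<le> h - c * (c ^ j * \<delta>))"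
      by (rule window_step_upper[OF w avi_subinterval[OF it] hi']) (use Suc Tm Tm' c dl in auto)
    show ?case
    proof
      fix s assume "s \<in> (F ^^ Suc j) G"
      hence "s \<in> (F ^^ j) G \<or> (\<forall>a. \<exists>s'\<in>(F ^^ j) G. p s a s' > 0)" by (auto simp: F_def)
      thus "tilt q (y (T (Suc j))) s \<le> h - c ^ Suc j * \<delta>"
      proof
        assume "s \<in> (F ^^ j) G" thus ?thesis using S by (simp add: mult.assoc)
      next
        assume "\<forall>a. \<exists>s'\<in>(F ^^ j) G. p s a s' > 0"
        thus ?thesis using S by (intro tilt_upper) (simp add: mult.assoc)
      qed
    qed
  qed
  have full: "(F ^^ CARD('s)) G = UNIV"
  proof (rule iterate_to_UNIV[OF _ _ G(1)])
    fix G assume G: "G \<noteq> {}" "F G = G"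
    show "G = UNIV"
    proof (rule ccontr)
      assume "G \<noteq> UNIV"
      \<comment> \<open>Outside a fixed set \<open>G\<close> of \<open>F\<close> some action avoids
        \<open>G\<close> altogether. The policy \<open>g\<close> made of such actions keeps
        \<open>- G\<close> invariant, and irreducibility then forces
        \<open>- G = UNIV\<close>.\<close>
      moreover have "\<forall>s. \<exists>a. s \<notin> G \<longrightarrow> (\<forall>s'\<in>G. \<not> p s a s' > 0)" using G(2) unfolding F_def by blast
      then obtain g where "\<forall>s. s \<notin> G \<longrightarrow> (\<forall>s'\<in>G. \<not> p s (g s) s' > 0)" by (rule choice[THEN exE])
      ultimately have "- G = UNIV"
        by (intro policy_forward_closed[OF mdp irr, of "- G" g]) auto
      thus False using G(1) by auto
    qed
  qed (auto simp: F_def)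
  define j where "j = CARD('s)"
  have "(\<forall>s\<in>UNIV. tilt q (y (T (Suc j))) s \<le> h - c * (c ^ j * \<delta>)) \<and>
       (\<forall>i. (\<exists>t\<in>UNIV. p (fst i) (snd i) t > 0) \<longrightarrow> y (T (Suc j)) $ i \<le> h - c * (c ^ j * \<delta>))"
    by (rule window_step_upper[OF w avi_subinterval[OF it] hi'])
      (use J Tm Tm' c dl ind[of j] full in \<open>auto simp: j_def\<close>)
  thus ?thesis using positive_successor[of "fst i" "snd i"] J by (simp add: j_def mult.assoc)
qed

end

context contraction
begin

lemma positive_predecessor: "\<exists>s. p s (d s) t > 0"
proof (rule ccontr)
  assume neg: "\<not> ?thesis"
  obtain t' where "p t (d t) t' > 0" using positive_successor by blast
  hence "t' \<noteq> t" using neg by blast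
  hence "- {t} = UNIV"
    by (intro policy_forward_closed[OF mdp irr, of "- {t}" d]) (use neg in auto)
  thus False by auto
qed

lemma avi_drift:
  assumes it: "avi p q \<alpha> no_err y m n" and st: "unit_steps \<alpha> m n" and k: "m \<le> k" "k \<le> n"
  shows "\<bar>y k $ i - y m $ i\<bar> \<le> (\<Sum>j\<in>{m..<k}. \<alpha> j i) * spn (y m)"
proof -
  obtain l where l: "\<And>i. l \<le> y m $ i" "\<And>i. y m $ i \<le> l + spn (y m)" using spn_bounds by metis
  show ?thesis using k
  proof (induction k rule: dec_induct)
    case (step k)
    have a: "0 \<le> \<alpha> k i" "\<alpha> k i \<le> 1" using st step.hyps step.prems unfolding unit_steps_def by auto
    have yk: "l \<le> y k $ i \<and> y k $ i \<le> l + spn (y m)" for i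
      using avi_bounds[OF mdp it st l, of k] step.hyps step.prems by simp
    have "\<bar>PT p q (y k) i - y k $ i\<bar> \<le> spn (y m)"
    proof -
      have "l \<le> PT p q (y k) i" "PT p q (y k) i \<le> l + spn (y m)"
        using yk by (auto intro!: PT_lower[OF mdp] PT_upper[OF mdp])
      thus ?thesis using yk[of i] by linarith
    qed
    hence "\<alpha> k i * \<bar>PT p q (y k) i - y k $ i\<bar> \<le> \<alpha> k i * spn (y m)" using a by (intro mult_left_mono)
    moreover have "y (Suc k) $ i = y k $ i + \<alpha> k i * (PT p q (y k) i - y k $ i)"
      using avi_no_err_step[OF it, of k i] step.hyps step.prems by (simp add: algebra_simps)
    moreover have "\<bar>\<alpha> k i * (PT p q (y k) i - y k $ i)\<bar> = \<alpha> k i * \<bar>PT p q (y k) i - y k $ i\<bar>"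
      using a by (simp add: abs_mult)
    ultimately have "\<bar>y (Suc k) $ i - y m $ i\<bar> \<le> \<bar>y k $ i - y m $ i\<bar> + \<alpha> k i * spn (y m)" by linarith
    thus ?case using step by (simp add: distrib_right)
  qed simp
qed

text \<open>The tilt at one arbitrary state, \<open>undefined\<close>, lies in the lower or in the
  upper half of the range of \<open>y\<close>. In the lower half, the upper bound spreads from this
  state at once. In the upper half, the high tilt may stem from an action that is not greedy,
  whereas the lower bound spreads through greedy pairs; an additional window converts it into an
  excess at the greedy pairs of the predecessors. Hence \<open>CARD('s) + 2\<close> windows.\<close>

lemma exact_contraction:
  assumes w: "\<And>j. j < CARD('s) + 2 \<Longrightarrow> short_window \<alpha> \<tau> (T j) (T (Suc j))"
    and it: "avi p q \<alpha> no_err y (T 0) (T (CARD('s) + 2))"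
  shows "spn (y (T (CARD('s) + 2))) \<le> (1 - c ^ (CARD('s) + 2) / 4) * spn (y (T 0))"
proof -
  define J where "J = CARD('s) + 1"
  have CJ: "CARD('s) + 2 = Suc J" unfolding J_def by simp
  define D where "D = spn (y (T 0))"
  have D0: "D \<ge> 0" unfolding D_def by (rule spn_nonneg)
  obtain l where l: "\<And>i. l \<le> y (T 0) $ i" "\<And>i. y (T 0) $ i \<le> l + D"
    unfolding D_def using spn_bounds by metis
  have Tm: "T i \<le> T j" if "i \<le> j" "j \<le> Suc J" for i j
    by (rule short_windows_mono[where T=T and J="Suc J"]) (use w that CJ in auto)
  have st: "unit_steps \<alpha> (T 0) (T j)" if "j \<le> Suc J" for j
    by (rule short_windows_unit_steps[where T=T and J="Suc J"]) (use w that CJ in auto)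
  note it' = it[unfolded CJ]
  have bd: "l \<le> y (T j) $ i \<and> y (T j) $ i \<le> l + D" if "j \<le> Suc J" for i j
    by (rule avi_bounds[OF mdp it' st l]) (use Tm that in auto)
  have cJ: "0 \<le> c ^ Suc J" "c ^ Suc J \<le> c ^ J" using c by (auto simp: mult_left_le_one_le)
  have cD: "c ^ Suc J * (D / 4) \<le> c ^ J * (D / 2)" using cJ D0 by (intro mult_mono) auto
  have "spn (y (T (Suc J))) \<le> D - c ^ Suc J * (D / 4)"
  proof (cases "l + D / 2 \<le> tilt q (y (T 0)) undefined")
    case True
    have w0: "short_window \<alpha> \<tau> (T 0) (T 1)" using w[of 0] by simp
    have it0: "avi p q \<alpha> no_err y (T 0) (T 1)" by (rule avi_subinterval[OF it']) (use Tm in auto)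
    \<comment> \<open>Over mass at most \<open>1/4\<close> no component moves by more than
      \<open>D / 4\<close>, so half of the excess \<open>D / 2\<close> remains throughout the first
      window.\<close>
    have V: "l + D / 4 \<le> tilt q (y k) undefined" if k: "T 0 \<le> k" "k < T 1" for k
    proof -
      have "\<bar>y k $ i - y (T 0) $ i\<bar> \<le> D / 4" for i
      proof -
        have "\<bar>y k $ i - y (T 0) $ i\<bar> \<le> (\<Sum>j\<in>{T 0..<k}. \<alpha> j i) * D" unfolding D_def
          by (rule avi_drift[OF it0]) (use w0 k in \<open>auto simp: short_window_def\<close>)
        also have "\<dots> \<le> 1/4 * D" using short_window_partial_sum[OF w0, of k i] k D0 by (intro mult_right_mono) auto
        finally show ?thesis by simp
      qed
      from tilt_diff[of "y k" "y (T 0)" "D/4" q undefined, OF this] True show ?thesis by linarith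
    qed
    define G where "G = {s. p s (d s) undefined > 0}"
    have G: "G \<noteq> {}" unfolding G_def using positive_predecessor by auto
    have y1: "l + c * (D / 4) \<le> y (T 1) $ (s, d s)" if "s \<in> G" for s
    proof -
      have "l + pm * (1 - exp (- \<tau>)) * (D / 4) \<le> y (T 1) $ (s, d s)"
        by (rule window_growth_lower[OF w0 it0 l(1) _ V]) (use D0 that in \<open>auto simp: G_def\<close>)
      moreover have "c * (D / 4) \<le> pm * (1 - exp (- \<tau>)) * (D / 4)"
        unfolding c_def using pm tau D0 by (intro mult_right_mono) auto
      ultimately show ?thesis by linarith
    qed
    have "l + c ^ J * (c * (D / 4)) \<le> y (T (Suc J)) $ i" for i
      by (rule windows_lower[where T="\<lambda>j. T (Suc j)", OF w avi_subinterval[OF it'] J_def _ _ G])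
        (use Tm bd[of 1] y1 c D0 in \<open>auto simp: J_def\<close>)
    hence "spn (y (T (Suc J))) \<le> (l + D) - (l + c ^ J * (c * (D / 4)))"
      using bd[of "Suc J"] by (intro spn_le_bounds) auto
    thus ?thesis by (simp add: mult_ac)
  next
    case False
    have "y (T J) $ i \<le> (l + D) - c ^ J * (D / 2)" for i
      by (rule windows_upper[where T=T and G="{undefined}", OF w avi_subinterval[OF it'] J_def l(2)])
        (use Tm False D0 in \<open>auto simp: J_def\<close>)
    hence "y (T (Suc J)) $ i \<le> (l + D) - c ^ J * (D / 2)" for i
      using avi_bounds[OF mdp, where y=y and \<alpha>=\<alpha> and m="T J" and n="T (Suc J)" and k="T (Suc J)" and i=i and h="(l + D) - c ^ J * (D / 2)" and l=l and q=q]
        avi_subinterval[OF it', of "T J" "T (Suc J)"] w[of J] Tm bd[of J] CJ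
      by (auto simp: short_window_def)
    hence "spn (y (T (Suc J))) \<le> ((l + D) - c ^ J * (D / 2)) - l"
      using bd[of "Suc J"] by (intro spn_le_bounds) auto
    thus ?thesis using cD by linarith
  qed
  thus ?thesis unfolding CJ D_def[symmetric] by (simp add: algebra_simps)
qed

end

lemma avi_exact_exists:
  fixes y0 :: "real ^ ('s::finite \<times> 'b::finite)"
  shows "\<exists>z. z m = y0 \<and> avi p q \<alpha> no_err z m n"
proof -
  define F where "F k v = (\<chi> i. v $ i + \<alpha> k i * (PT p q v i - v $ i))" for k and v :: "real ^ ('s \<times> 'b)"
  define z where "z k = rec_nat y0 (\<lambda>j v. F (j + m) v) (k - m)" for k
  have "z (Suc k) = F k (z k)" if "k \<ge> m" for k
    unfolding z_def using that by (simp add: Suc_diff_le)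
  thus ?thesis by (intro exI[of _ z]) (auto simp: z_def avi_def F_def)
qed

text \<open>\<open>PT\<close> is nonexpansive in the maximum norm, so perturbations add up without
  amplification, at most \<open>\<delta>\<close> per unit of step mass.\<close>

lemma avi_compare:
  assumes mdp: "is_mdp p" and it: "avi p q \<alpha> e y m n" and ex: "avi p q \<alpha> no_err z m n" and eq: "z m = y m"
    and st: "unit_steps \<alpha> m n" and \<beta>: "\<And>k i. \<alpha> k i \<le> \<beta> k"
    and e: "\<And>k i. m \<le> k \<Longrightarrow> k < n \<Longrightarrow> \<bar>e k i\<bar> \<le> \<delta>" and d: "0 \<le> \<delta>" and k: "m \<le> k" "k \<le> n"
  shows "\<bar>y k $ i - z k $ i\<bar> \<le> \<delta> * sum \<beta> {m..<k}"
proof -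
  have "\<forall>i. \<bar>y k $ i - z k $ i\<bar> \<le> \<delta> * sum \<beta> {m..<k}" using k
  proof (induction k rule: dec_induct)
    case base thus ?case using eq by simp
  next
    case (step k)
    define E where "E = \<delta> * sum \<beta> {m..<k}"
    have IH: "\<bar>y k $ i - z k $ i\<bar> \<le> E" for i unfolding E_def using step by simp
    show ?case
    proof
      fix i
      have a: "0 \<le> \<alpha> k i" "\<alpha> k i \<le> 1" using st step.hyps step.prems unfolding unit_steps_def by auto
      have y: "y (Suc k) $ i = y k $ i + \<alpha> k i * (PT p q (y k) i - y k $ i + e k i)"
        using it step.hyps step.prems unfolding avi_def by auto
      have z: "z (Suc k) $ i = z k $ i + \<alpha> k i * (PT p q (z k) i - z k $ i + 0)"
        using ex step.hyps step.prems unfolding avi_def by auto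
      have "y (Suc k) $ i - z (Suc k) $ i = (1 - \<alpha> k i) * (y k $ i - z k $ i) + \<alpha> k i * (PT p q (y k) i - PT p q (z k) i) + \<alpha> k i * e k i"
        unfolding y z by (simp add: algebra_simps)
      also have "\<bar>\<dots>\<bar> \<le> \<bar>(1 - \<alpha> k i) * (y k $ i - z k $ i)\<bar> + \<bar>\<alpha> k i * (PT p q (y k) i - PT p q (z k) i)\<bar> + \<bar>\<alpha> k i * e k i\<bar>"
        by linarith
      also have "\<dots> = (1 - \<alpha> k i) * \<bar>y k $ i - z k $ i\<bar> + \<alpha> k i * \<bar>PT p q (y k) i - PT p q (z k) i\<bar> + \<alpha> k i * \<bar>e k i\<bar>"
        using a by (simp add: abs_mult)
      also have "\<dots> \<le> (1 - \<alpha> k i) * E + \<alpha> k i * E + \<beta> k * \<delta>"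
        using a IH PT_diff[OF mdp IH, where q=q] e[of k i] \<beta>[of k i] d step.hyps step.prems
        by (intro add_mono mult_left_mono mult_mono) (auto intro: order_trans)
      also have "\<dots> = \<delta> * sum \<beta> {m..<Suc k}" using step.hyps unfolding E_def by (simp add: algebra_simps)
      finally show "\<bar>y (Suc k) $ i - z (Suc k) $ i\<bar> \<le> \<delta> * sum \<beta> {m..<Suc k}" .
    qed
  qed
  thus ?thesis by blast
qed

lemma avi_span_growth:
  assumes mdp: "is_mdp p" and it: "avi p q \<alpha> e y m n"
    and st: "unit_steps \<alpha> m n" and \<beta>: "\<And>k i. \<alpha> k i \<le> \<beta> k"
    and e: "\<And>k i. m \<le> k \<Longrightarrow> k < n \<Longrightarrow> \<bar>e k i\<bar> \<le> \<delta>" and d: "0 \<le> \<delta>" and mn: "m \<le> n"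
  shows "spn (y n) \<le> spn (y m) + 2 * (\<delta> * sum \<beta> {m..<n})"
proof -
  obtain z where z: "z m = y m" "avi p q \<alpha> no_err z m n" using avi_exact_exists by blast
  obtain l where l: "\<And>i. l \<le> y m $ i" "\<And>i. y m $ i \<le> l + spn (y m)" using spn_bounds by metis
  have "l \<le> z n $ i \<and> z n $ i \<le> l + spn (y m)" for i
    by (rule avi_bounds[OF mdp z(2) st]) (use l z(1) mn in auto)
  hence "spn (z n) \<le> (l + spn (y m)) - l" by (intro spn_le_bounds) auto
  moreover have "spn (y n) \<le> spn (z n) + 2 * (\<delta> * sum \<beta> {m..<n})"
    by (rule spn_perturb, rule avi_compare[OF mdp it z(2,1) st \<beta> e d mn]) auto
  ultimately show ?thesis by simp
qed

text \<open>The constants precede the iteration: they are built from \<open>\<tau>\<close>, the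
  number of states and the transition probabilities, so one factor serves all windows. The perturbed
  iteration is compared with the exact one from the same starting point.\<close>

theorem avi_span_contraction:
  fixes p :: "'s::finite \<Rightarrow> 'b::finite \<Rightarrow> 's \<Rightarrow> real" and q :: "real ^ ('s \<times> 'b)"
  assumes mdp: "is_mdp p" and irr: "policy_irreducible p" and tau: "0 < \<tau>"
  shows "\<exists>\<kappa> J. 0 \<le> \<kappa> \<and> \<kappa> < 1 \<and> 0 < J \<and> (\<forall>\<alpha> \<beta> e y T \<delta>.
     (\<forall>j<J. short_window \<alpha> \<tau> (T j) (T (Suc j))) \<longrightarrow> avi p q \<alpha> e y (T 0) (T J) \<longrightarrow> (\<forall>k i. \<alpha> k i \<le> \<beta> k) \<longrightarrow>
     (\<forall>k i. T 0 \<le> k \<longrightarrow> k < T J \<longrightarrow> \<bar>e k i\<bar> \<le> \<delta>) \<longrightarrow> 0 \<le> \<delta> \<longrightarrow>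
     spn (y (T J)) \<le> \<kappa> * spn (y (T 0)) + 2 * (\<delta> * sum \<beta> {T 0..<T J}))"
proof -
  obtain d where d: "\<And>s. maxQ q s = q $ (s, d s)" using maxQ_attained[of q] by metis
  obtain pm where pm: "0 < pm" "pm \<le> 1" "\<And>s a s'. p s a s' > 0 \<Longrightarrow> pm \<le> p s a s'"
    using mdp_pos_lower_bound[of p] by blast
  interpret contraction p q d pm \<tau> by unfold_locales fact+
  define J where "J = CARD('s) + 2"
  show ?thesis
  proof (intro exI[of _ "1 - c ^ J / 4"] exI[of _ J] conjI allI impI)
    have "c ^ J \<le> 1" "0 < c ^ J" using c by (auto intro: power_le_one)
    thus "0 \<le> 1 - c ^ J / 4" "1 - c ^ J / 4 < 1" by auto
    show "0 < J" by (simp add: J_def)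
    fix \<alpha> \<beta> e and y :: "nat \<Rightarrow> real ^ ('s \<times> 'b)" and T :: "nat \<Rightarrow> nat" and \<delta> :: real
    assume w: "\<forall>j<J. short_window \<alpha> \<tau> (T j) (T (Suc j))" and it: "avi p q \<alpha> e y (T 0) (T J)"
      and \<beta>: "\<forall>k i. \<alpha> k i \<le> \<beta> k" and e: "\<forall>k i. T 0 \<le> k \<longrightarrow> k < T J \<longrightarrow> \<bar>e k i\<bar> \<le> \<delta>" and dl: "0 \<le> \<delta>"
    have stm: "unit_steps \<alpha> (T 0) (T J)" "T 0 \<le> T J"
      using short_windows_unit_steps[of J \<alpha> \<tau> T J] short_windows_mono[of J \<alpha> \<tau> T 0 J] w by auto
    obtain z where z: "z (T 0) = y (T 0)" "avi p q \<alpha> no_err z (T 0) (T J)" using avi_exact_exists by blast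
    have "spn (z (T J)) \<le> (1 - c ^ J / 4) * spn (z (T 0))"
      unfolding J_def by (rule exact_contraction) (use w z J_def in auto)
    moreover have "spn (y (T J)) \<le> spn (z (T J)) + 2 * (\<delta> * sum \<beta> {T 0..<T J})"
      by (rule spn_perturb, rule avi_compare[OF mdp it z(2,1)]) (use stm \<beta> e dl in auto)
    ultimately show "spn (y (T J)) \<le> (1 - c ^ J / 4) * spn (y (T 0)) + 2 * (\<delta> * sum \<beta> {T 0..<T J})"
      using z(1) by simp
  qed
qed

section \<open>Convergence along a single path\<close>

primrec runmax :: "(nat \<Rightarrow> real) \<Rightarrow> nat \<Rightarrow> real" where
  "runmax x 0 = x 0"
| "runmax x (Suc k) = max (runmax x k) (x (Suc k))"

lemma runmax_ge: "x k \<le> runmax x k"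
  by (cases k) auto

lemma incseq_runmax: "incseq (runmax x)"
  by (rule incseq_SucI) simp

lemma g_clip_abs: "0 \<le> R \<Longrightarrow> 0 < \<eta> \<Longrightarrow> \<bar>g_clip R \<eta> x\<bar> \<le> R + \<eta>"
  unfolding g_clip_def by auto

lemma g_clip_lipschitz: "0 \<le> R \<Longrightarrow> 0 < \<eta> \<Longrightarrow> \<bar>g_clip R \<eta> x - g_clip R \<eta> y\<bar> \<le> \<bar>x - y\<bar>"
  unfolding g_clip_def by auto

lemma norm_le_card_bound:
  fixes x :: "real ^ 'n::finite"
  assumes "\<And>i. \<bar>x $ i\<bar> \<le> c"
  shows "norm x \<le> real CARD('n) * c"
proof -
  have "norm x \<le> (\<Sum>i\<in>UNIV. \<bar>x $ i\<bar>)" by (rule norm_le_l1_cart)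
  also have "\<dots> \<le> (\<Sum>i\<in>(UNIV::'n set). c)" by (intro sum_mono assms)
  finally show ?thesis by simp
qed

lemma card_ge_one: "1 \<le> real CARD('n::finite)"
  by (simp add: Suc_leI)

lemma tendsto_vec_zero_norm:
  fixes x :: "nat \<Rightarrow> real ^ 'n::finite"
  assumes "\<And>i. (\<lambda>k. x k $ i / g k) \<longlonglongrightarrow> 0" and "\<And>k. 0 < g k"
  shows "(\<lambda>k. norm (x k) / g k) \<longlonglongrightarrow> 0"
proof (rule Lim_null_comparison)
  show "eventually (\<lambda>k. norm (norm (x k) / g k) \<le> (\<Sum>i\<in>UNIV. \<bar>x k $ i / g k\<bar>)) sequentially"
  proof (intro always_eventually allI)
    fix k
    have "norm (x k) / g k \<le> (\<Sum>i\<in>UNIV. \<bar>x k $ i\<bar>) / g k"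
      using assms(2)[of k] norm_le_l1_cart by (intro divide_right_mono) auto
    thus "norm (norm (x k) / g k) \<le> (\<Sum>i\<in>UNIV. \<bar>x k $ i / g k\<bar>)"
      using assms(2)[of k] by (simp add: sum_divide_distrib abs_divide)
  qed
  show "(\<lambda>k. \<Sum>i\<in>UNIV. \<bar>x k $ i / g k\<bar>) \<longlonglongrightarrow> 0"
    by (rule tendsto_null_sum) (rule tendsto_rabs_zero[OF assms(1)])
qed

text \<open>Abel summation. At any time only one component is updated, so the differences
  \<open>d\<close> between the steps of two components are small in aggregate but not one by one;
  weights \<open>\<kappa>\<close> of bounded variation tolerate this.\<close>

lemma summation_by_parts_bound:
  fixes \<kappa> d :: "nat \<Rightarrow> real"
  assumes S: "\<And>k. m \<le> k \<Longrightarrow> k \<le> n \<Longrightarrow> \<bar>sum d {m..<k}\<bar> \<le> \<epsilon>" and mn: "m \<le> n"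
  shows "\<bar>\<Sum>l\<in>{m..<n}. \<kappa> l * d l\<bar> \<le> \<epsilon> * (\<bar>\<kappa> n\<bar> + (\<Sum>l\<in>{m..<n}. \<bar>\<kappa> (Suc l) - \<kappa> l\<bar>))"
proof -
  have eq: "(\<Sum>l\<in>{m..<n}. \<kappa> l * d l) = \<kappa> n * sum d {m..<n} - (\<Sum>l\<in>{m..<n}. sum d {m..<Suc l} * (\<kappa> (Suc l) - \<kappa> l))"
    using mn by (induction n rule: dec_induct) (auto simp: algebra_simps)
  have "\<bar>\<kappa> n * sum d {m..<n}\<bar> \<le> \<epsilon> * \<bar>\<kappa> n\<bar>"
    using S[OF mn order_refl] by (simp add: abs_mult mult.commute[of \<epsilon>] mult_left_mono)
  moreover have "\<bar>\<Sum>l\<in>{m..<n}. sum d {m..<Suc l} * (\<kappa> (Suc l) - \<kappa> l)\<bar> \<le> (\<Sum>l\<in>{m..<n}. \<epsilon> * \<bar>\<kappa> (Suc l) - \<kappa> l\<bar>)"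
  proof (rule order_trans[OF sum_abs sum_mono])
    fix l assume "l \<in> {m..<n}"
    hence "\<bar>sum d {m..<Suc l}\<bar> \<le> \<epsilon>" using S[of "Suc l"] by simp
    thus "\<bar>sum d {m..<Suc l} * (\<kappa> (Suc l) - \<kappa> l)\<bar> \<le> \<epsilon> * \<bar>\<kappa> (Suc l) - \<kappa> l\<bar>"
      unfolding abs_mult by (intro mult_right_mono) auto
  qed
  ultimately show ?thesis unfolding eq by (simp add: distrib_left sum_distrib_left)
qed

text \<open>What holds on almost every path. \<open>\<alpha> k i\<close> stands for the step of
  component \<open>i\<close> at time \<open>k\<close>, in the application \<open>0\<close> unless
  \<open>i\<close> is updated then, and \<open>equal\<close> expresses equal speed of the components
  over late stretches of bounded mass. The noise series are divided by the running norm in the case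
  of \<open>\<xi>\<close> and by the running span in the case of \<open>Q\<close>.\<close>

locale rvi_path =
  fixes r :: "'s::finite \<Rightarrow> 'b::finite \<Rightarrow> real" and p :: "'s \<Rightarrow> 'b \<Rightarrow> 's \<Rightarrow> real"
    and f :: "real ^ ('s \<times> 'b) \<Rightarrow> real" and u L \<eta> :: real and q :: "real ^ ('s \<times> 'b)"
    and a :: "nat \<Rightarrow> real" and \<alpha> :: "nat \<Rightarrow> 's \<times> 'b \<Rightarrow> real"
    and \<xi> :: "nat \<Rightarrow> real" and Q :: "nat \<Rightarrow> real ^ ('s \<times> 'b)"
    and w1 :: "nat \<Rightarrow> real" and w2 :: "nat \<Rightarrow> 's \<times> 'b \<Rightarrow> real" and \<beta> :: "nat \<Rightarrow> real"
  assumes mdp: "is_mdp p" and irr: "policy_irreducible p"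
    and q: "rvi_solution r p f q" and rho: "\<bar>f q\<bar> \<le> rnorm r"
    and f_lip: "\<And>x y. \<bar>f x - f y\<bar> \<le> L * norm (x - y)" and L0: "0 \<le> L"
    and f_shift: "\<And>x c. f (x + c *\<^sub>R ones) = f x + c * u"
    and u: "0 < u" and eta: "0 < \<eta>"
    and a_pos: "\<And>k. 0 < a k" and a_lim: "a \<longlonglongrightarrow> 0" and a_div: "\<not> summable a"
    and \<beta>_def: "\<And>k. \<beta> k = (\<Sum>i\<in>UNIV. \<alpha> k i)"
    and al0: "\<And>k i. 0 \<le> \<alpha> k i" and be_lim: "\<beta> \<longlonglongrightarrow> 0"
    and al_div: "\<And>i. \<not> summable (\<lambda>k. \<alpha> k i)"
    and ratio: "(\<lambda>k. \<beta> k / a (Suc k)) \<longlonglongrightarrow> 0"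
    and equal: "\<And>T \<epsilon>. \<epsilon> > 0 \<Longrightarrow> \<exists>K. \<forall>k0\<ge>K. \<forall>k\<ge>k0. sum \<beta> {k0..<k} \<le> T \<longrightarrow>
       (\<forall>i j. \<bar>(\<Sum>l\<in>{k0..<k}. \<alpha> l i) - (\<Sum>l\<in>{k0..<k}. \<alpha> l j)\<bar> \<le> \<epsilon>)"
    and Q_step: "\<And>k i. Q (Suc k) $ i = Q k $ i + \<alpha> k i * (r (fst i) (snd i) - g_clip (rnorm r) \<eta> (\<xi> k)
        + (\<Sum>s'\<in>UNIV. p (fst i) (snd i) s' * maxQ (Q k) s') - Q k $ i + w2 k i)"
    and xi_step: "\<And>k. \<xi> (Suc k) = \<xi> k + a k * (f (Q k) + w1 k - \<xi> k)"
    and noise1: "summable (\<lambda>k. a k * w1 k / runmax (\<lambda>k. 1 + norm (Q k)) k)"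
    and noise2: "\<And>i. summable (\<lambda>k. \<alpha> k i * w2 k i / runmax (\<lambda>k. 1 + spn (Q k)) k)"
begin

abbreviation "R \<equiv> rnorm r"
abbreviation "g \<equiv> g_clip (rnorm r) \<eta>"
abbreviation "Gs \<equiv> runmax (\<lambda>k. 1 + spn (Q k))"
abbreviation "Gn \<equiv> runmax (\<lambda>k. 1 + norm (Q k))"

lemma R0: "0 \<le> R" by (rule rnorm_nonneg)

lemma al_le: "\<alpha> k i \<le> \<beta> k"
  unfolding \<beta>_def by (rule member_le_sum) (auto simp: al0)

lemma be0: "0 \<le> \<beta> k"
  unfolding \<beta>_def by (intro sum_nonneg al0)

lemma be_div: "\<not> summable \<beta>"
proof
  assume "summable \<beta>"
  hence "summable (\<lambda>k. \<alpha> k undefined)"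
    by (rule summable_comparison_test'[where N=0]) (simp add: al0 al_le)
  thus False using al_div by blast
qed

lemma al_lim: "(\<lambda>k. \<alpha> k i) \<longlonglongrightarrow> 0"
  by (rule tendsto_sandwich[OF _ _ tendsto_const be_lim]) (auto intro!: always_eventually simp: al0 al_le)

lemma eventually_unit: "\<exists>K. \<forall>m n. K \<le> m \<longrightarrow> unit_steps \<alpha> m n"
proof -
  have "eventually (\<lambda>k. \<beta> k < 1) sequentially" using be_lim by (intro order_tendstoD) auto
  then obtain K where "\<And>k. K \<le> k \<Longrightarrow> \<beta> k < 1" unfolding eventually_sequentially by blast
  thus ?thesis unfolding unit_steps_def using al0 al_le by (intro exI[of _ K]) (smt (verit) atLeastLessThan_iff order_trans)
qed

text \<open>\<open>N\<close> collects the averaged noise. As \<open>Q - N\<close> is driven by the noise only through \<open>maxQ Q - maxQ (Q - N)\<close>,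
  it suffices that \<open>N\<close> tends to \<open>0\<close>.\<close>

primrec N :: "nat \<Rightarrow> real ^ ('s \<times> 'b)" where
  "N 0 = 0"
| "N (Suc k) = (\<chi> i. (1 - \<alpha> k i) * N k $ i + \<alpha> k i * w2 k i)"

definition "Z k = Q k - N k"
definition "y k = Z k - q"
text \<open>All that separates a step of \<open>y\<close> from exact averaging: the common drift,
  and the effect of \<open>N\<close> on the greedy values.\<close>

definition "err k i = f q - g (\<xi> k) + (\<Sum>s'\<in>UNIV. p (fst i) (snd i) s' * (maxQ (Q k) s' - maxQ (Z k) s'))"

lemma Q_eq: "Q k = q + y k + N k" unfolding y_def Z_def by simp
lemma Z_eq: "Z k = q + y k" unfolding y_def by simp

text \<open>The term \<open>- Q k $ i\<close> contains \<open>- N k $ i\<close>, which together with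
  \<open>w2 k i\<close> is exactly what drives \<open>N\<close>. Both cancel, and noise remains only
  inside \<open>maxQ\<close>.\<close>

lemma y_step: "y (Suc k) $ i = y k $ i + \<alpha> k i * (PT p q (y k) i - y k $ i + err k i)"
proof -
  have qi: "q $ i = r (fst i) (snd i) - f q + (\<Sum>s'\<in>UNIV. p (fst i) (snd i) s' * maxQ q s')"
    using q unfolding rvi_solution_def by (metis prod.collapse)
  have "PT p q (y k) i + (\<Sum>s'\<in>UNIV. p (fst i) (snd i) s' * (maxQ (Q k) s' - maxQ (Z k) s'))
      + (\<Sum>s'\<in>UNIV. p (fst i) (snd i) s' * maxQ q s') = (\<Sum>s'\<in>UNIV. p (fst i) (snd i) s' * maxQ (Q k) s')"
    unfolding PT_def tilt_def Z_eq[symmetric] by (simp add: sum.distrib[symmetric] distrib_left[symmetric])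
  hence "r (fst i) (snd i) - g (\<xi> k) + (\<Sum>s'\<in>UNIV. p (fst i) (snd i) s' * maxQ (Q k) s') = q $ i + PT p q (y k) i + err k i"
    unfolding qi err_def by linarith
  moreover have Qi: "Q k $ i = q $ i + y k $ i + N k $ i"
    using arg_cong[OF Q_eq[of k], of "\<lambda>v. v $ i"] by (simp only: vector_add_component)
  ultimately have "r (fst i) (snd i) - g (\<xi> k) + (\<Sum>s'\<in>UNIV. p (fst i) (snd i) s' * maxQ (Q k) s') - Q k $ i + w2 k i
      = PT p q (y k) i - y k $ i + err k i - N k $ i + w2 k i" by linarith
  hence Q': "Q (Suc k) $ i = q $ i + y k $ i + N k $ i + \<alpha> k i * (PT p q (y k) i - y k $ i + err k i - N k $ i + w2 k i)"
    using Q_step[of k i] Qi by (simp only:)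
  have "y (Suc k) $ i = Q (Suc k) $ i - ((1 - \<alpha> k i) * N k $ i + \<alpha> k i * w2 k i) - q $ i"
    by (simp add: y_def Z_def)
  thus ?thesis unfolding Q' by (simp add: algebra_simps)
qed

lemma avi_y: "avi p q \<alpha> err y m n"
  unfolding avi_def using y_step by blast

definition "C0 = 2 * R + \<eta>"

lemma C0: "0 \<le> C0" "\<bar>f q - g x\<bar> \<le> C0"
  using R0 eta rho g_clip_abs[of R \<eta> x] unfolding C0_def by linarith+

lemma err_noise: "\<bar>\<Sum>s'\<in>UNIV. p (fst i) (snd i) s' * (maxQ (Q k) s' - maxQ (Z k) s')\<bar> \<le> norm (N k)"
proof (rule mdp_avg_abs_le[OF mdp])
  fix s' show "\<bar>maxQ (Q k) s' - maxQ (Z k) s'\<bar> \<le> norm (N k)"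
    using maxQ_lipschitz[of "Q k" s' "Z k"] by (simp add: Z_def)
qed

lemma err_bound: "\<bar>err k i\<bar> \<le> C0 + norm (N k)"
  using err_noise[of i k] C0(2)[of "\<xi> k"] unfolding err_def by linarith

section \<open>Normalised noise and contracting windows\<close>

lemma Gs1: "1 \<le> Gs k"
  using runmax_ge[of "\<lambda>k. 1 + spn (Q k)" 0] incseqD[OF incseq_runmax, of 0 k] spn_nonneg[of "Q 0"] by (smt (verit) zero_le)

lemma Gn1: "1 \<le> Gn k"
  using runmax_ge[of "\<lambda>k. 1 + norm (Q k)" 0] incseqD[OF incseq_runmax, of 0 k] norm_ge_zero[of "Q 0"] by (smt (verit) zero_le)

lemma N_relative: "(\<lambda>k. norm (N k) / Gs k) \<longlonglongrightarrow> 0"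
proof (rule tendsto_vec_zero_norm)
  fix i
  show "(\<lambda>k. N k $ i / Gs k) \<longlonglongrightarrow> 0"
    by (rule averaged_noise_vanishes[OF al0 al_lim al_div _ incseq_runmax Gs1 noise2]) simp
  show "0 < Gs k" for k using Gs1[of k] by linarith
qed

text \<open>Quantified over all perturbed iterations with the given steps, because it is applied to
  \<open>y\<close> and later to a shifted process with an error of its own.\<close>

definition contracts :: "real \<Rightarrow> real \<Rightarrow> nat \<Rightarrow> nat \<Rightarrow> bool" where
  "contracts \<kappa> T0 k0 k1 \<longleftrightarrow> k0 < k1 \<and> sum \<beta> {k0..<k1} \<le> T0 \<and> unit_steps \<alpha> k0 k1 \<and>
     (\<forall>e (x :: nat \<Rightarrow> real ^ ('s \<times> 'b)) \<delta>. avi p q \<alpha> e x k0 k1 \<longrightarrow> (\<forall>k i. k0 \<le> k \<longrightarrow> k < k1 \<longrightarrow> \<bar>e k i\<bar> \<le> \<delta>) \<longrightarrow> 0 \<le> \<delta> \<longrightarrow>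
       spn (x k1) \<le> \<kappa> * spn (x k0) + 2 * (\<delta> * T0))"

lemma contracts_spn:
  assumes "contracts \<kappa> T0 k0 k1" "avi p q \<alpha> e x k0 k1" "\<And>k i. k0 \<le> k \<Longrightarrow> k < k1 \<Longrightarrow> \<bar>e k i\<bar> \<le> \<delta>" "0 \<le> \<delta>"
  shows "spn (x k1) \<le> \<kappa> * spn (x k0) + 2 * (\<delta> * T0)"
  using assms unfolding contracts_def by blast

lemma contraction_windows:
  "\<exists>\<kappa> T0 K. 0 \<le> \<kappa> \<and> \<kappa> < 1 \<and> 0 \<le> T0 \<and> (\<forall>k0\<ge>K. \<exists>k1. contracts \<kappa> T0 k0 k1)"
proof -
  define nd where "nd = real CARD('s \<times> 'b)"
  \<comment> \<open>A total mass of at least \<open>1/8\<close>, shared among \<open>nd\<close>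
    components whose masses differ by at most \<open>\<tau>\<close>, gives each of them at least
    \<open>1 / (8 * nd) - \<tau> = \<tau>\<close>.\<close>
  define \<tau> where "\<tau> = 1 / (16 * nd)"
  have cd: "nd \<ge> 1" unfolding nd_def by (rule card_ge_one)
  have tau: "\<tau> > 0" unfolding \<tau>_def using cd by simp
  obtain \<kappa> J where kJ: "0 \<le> \<kappa>" "\<kappa> < 1" "0 < J"
    and con: "\<forall>\<alpha> \<beta> e y T \<delta>. (\<forall>j<J. short_window \<alpha> \<tau> (T j) (T (Suc j))) \<longrightarrow> avi p q \<alpha> e y (T 0) (T J) \<longrightarrow> (\<forall>k i. \<alpha> k i \<le> \<beta> k) \<longrightarrow>
     (\<forall>k i. T 0 \<le> k \<longrightarrow> k < T J \<longrightarrow> \<bar>e k i\<bar> \<le> \<delta>) \<longrightarrow> 0 \<le> \<delta> \<longrightarrow>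
     spn (y (T J)) \<le> \<kappa> * spn (y (T 0)) + 2 * (\<delta> * sum \<beta> {T 0..<T J})"
    using avi_span_contraction[OF mdp irr tau, of q] by (elim exE conjE)
  obtain K1 where K1: "\<And>m n. K1 \<le> m \<Longrightarrow> unit_steps \<alpha> m n" using eventually_unit by blast
  have "eventually (\<lambda>k. \<beta> k < 1/8) sequentially" using be_lim by (intro order_tendstoD) auto
  then obtain K2 where K2: "\<And>k. K2 \<le> k \<Longrightarrow> \<beta> k < 1/8" unfolding eventually_sequentially by blast
  obtain K3 where K3: "\<forall>k0\<ge>K3. \<forall>k\<ge>k0. sum \<beta> {k0..<k} \<le> 1 \<longrightarrow>
       (\<forall>i j. \<bar>(\<Sum>l\<in>{k0..<k}. \<alpha> l i) - (\<Sum>l\<in>{k0..<k}. \<alpha> l j)\<bar> \<le> \<tau>)"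
    using equal[OF tau, of 1] by blast
  define K where "K = max K1 (max K2 K3)"
  have win: "\<exists>n>m. short_window \<alpha> \<tau> m n \<and> sum \<beta> {m..<n} \<le> 1/4" if m: "m \<ge> K" for m
  proof -
    have sm: "\<beta> k \<le> 1/8" if "k \<ge> m" for k using K2[of k] m that unfolding K_def by simp
    have "\<exists>n>m. 1/8 \<le> sum \<beta> {m..<n} \<and> sum \<beta> {m..<n} \<le> 2 * (1/8)"
      by (rule window_exists[OF be0 be_div _ sm]) simp_all
    then obtain n where n: "n > m" "1/8 \<le> sum \<beta> {m..<n}" "sum \<beta> {m..<n} \<le> 1/4" by auto
    define M where "M i = (\<Sum>k\<in>{m..<n}. \<alpha> k i)" for i
    have Mtot: "sum \<beta> {m..<n} = (\<Sum>i\<in>UNIV. M i)" unfolding M_def \<beta>_def by (rule sum.swap)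
    have Mle: "M i \<le> sum \<beta> {m..<n}" for i unfolding M_def by (intro sum_mono al_le)
    have Md: "\<bar>M i - M j\<bar> \<le> \<tau>" for i j unfolding M_def using K3 m n unfolding K_def by auto
    have "\<tau> \<le> M i" for i
    proof -
      have "1/8 \<le> (\<Sum>j\<in>UNIV. M j)" using n Mtot by simp
      also have "\<dots> \<le> (\<Sum>j\<in>(UNIV::('s\<times>'b) set). M i + \<tau>)"
        by (rule sum_mono) (use Md in \<open>smt (verit)\<close>)
      also have "\<dots> = nd * (M i + \<tau>)" by (simp only: sum_constant nd_def)
      finally have "1/8 \<le> nd * M i + nd * \<tau>" by (simp add: distrib_left)
      moreover have "nd * \<tau> = 1/16" unfolding \<tau>_def using cd by simp
      ultimately have "nd * \<tau> \<le> nd * M i" by linarith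
      thus ?thesis using cd by simp
    qed
    moreover have "M i \<le> 1/4" for i using Mle[of i] n by linarith
    ultimately have "short_window \<alpha> \<tau> m n" using n K1[of m n] m
      unfolding short_window_def K_def M_def by simp
    thus ?thesis using n by blast
  qed
  have "\<forall>m. \<exists>n. K \<le> m \<longrightarrow> n > m \<and> short_window \<alpha> \<tau> m n \<and> sum \<beta> {m..<n} \<le> 1/4" using win by blast
  then obtain W where W: "\<forall>m. K \<le> m \<longrightarrow> W m > m \<and> short_window \<alpha> \<tau> m (W m) \<and> sum \<beta> {m..<W m} \<le> 1/4"
    by (rule choice[THEN exE])
  have main: "\<exists>k1. contracts \<kappa> (real J / 4) k0 k1" if k0: "k0 \<ge> K" for k0
  proof -
    define T where "T j = (W ^^ j) k0" for j
    have T: "T 0 = k0" "T (Suc j) = W (T j)" for j unfolding T_def by auto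
    have TK: "k0 + j \<le> T j \<and> sum \<beta> {k0..<T j} \<le> real j / 4" for j
    proof (induction j)
      case 0 thus ?case by (simp add: T)
    next
      case (Suc j)
      hence W': "W (T j) > T j" "sum \<beta> {T j..<W (T j)} \<le> 1/4" using W k0 by auto
      have "sum \<beta> {k0..<T (Suc j)} = sum \<beta> {k0..<T j} + sum \<beta> {T j..<W (T j)}"
        unfolding T using Suc W' by (subst sum.atLeastLessThan_concat) auto
      thus ?case using Suc W' by (auto simp: T)
    qed
    have sw: "\<forall>j<J. short_window \<alpha> \<tau> (T j) (T (Suc j))" using W TK k0 unfolding T
      by (meson le_add1 order_trans)
    show ?thesis unfolding contracts_def
    proof (intro exI[of _ "T J"] conjI allI impI)
      show "k0 < T J" using TK[of J] kJ by linarith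
      show "sum \<beta> {k0..<T J} \<le> real J / 4" using TK by blast
      show "unit_steps \<alpha> k0 (T J)" using K1[of k0] k0 unfolding K_def by simp
      fix e and x :: "nat \<Rightarrow> real ^ ('s \<times> 'b)" and \<delta> :: real
      assume A: "avi p q \<alpha> e x k0 (T J)" "\<forall>k i. k0 \<le> k \<longrightarrow> k < T J \<longrightarrow> \<bar>e k i\<bar> \<le> \<delta>" "0 \<le> \<delta>"
      have "spn (x (T J)) \<le> \<kappa> * spn (x (T 0)) + 2 * (\<delta> * sum \<beta> {T 0..<T J})"
        by (rule con[THEN spec[of _ \<alpha>], THEN spec[of _ \<beta>], THEN spec[of _ e], THEN spec[of _ x], THEN spec[of _ T], THEN spec[of _ \<delta>],
              THEN mp, THEN mp, THEN mp, THEN mp, THEN mp]) (use sw A T al_le in auto)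
      moreover have "\<delta> * sum \<beta> {T 0..<T J} \<le> \<delta> * (real J / 4)"
        using TK[of J] A(3) T(1) by (intro mult_left_mono) auto
      ultimately show "spn (x (T J)) \<le> \<kappa> * spn (x k0) + 2 * (\<delta> * (real J / 4))"
        unfolding T(1) by linarith
    qed
  qed
  show ?thesis
    by (rule exI[of _ \<kappa>], rule exI[of _ "real J / 4"], rule exI[of _ K]) (use kJ main in auto)
qed

section \<open>Boundedness of the span\<close>

lemma spn_Q_le: "spn (Q k) \<le> spn (y k) + (spn q + 2 * norm (N k))"
proof (rule spn_leI)
  fix i j
  have "Q k $ i - Q k $ j = (y k $ i - y k $ j) + (q $ i - q $ j) + (N k $ i - N k $ j)"
    using arg_cong[OF Q_eq[of k], of "\<lambda>v. v $ i"] arg_cong[OF Q_eq[of k], of "\<lambda>v. v $ j"] by simp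
  thus "Q k $ i - Q k $ j \<le> spn (y k) + (spn q + 2 * norm (N k))"
    using spn_ge[of "y k" i j] spn_ge[of q i j] component_le_norm_cart[of "N k" i] component_le_norm_cart[of "N k" j]
    by linarith
qed

lemma spn_y_le: "spn (y k) \<le> spn (Q k) + (spn q + 2 * norm (N k))"
proof (rule spn_leI)
  fix i j
  have "Q k $ i - Q k $ j = (y k $ i - y k $ j) + (q $ i - q $ j) + (N k $ i - N k $ j)"
    using arg_cong[OF Q_eq[of k], of "\<lambda>v. v $ i"] arg_cong[OF Q_eq[of k], of "\<lambda>v. v $ j"] by simp
  thus "y k $ i - y k $ j \<le> spn (Q k) + (spn q + 2 * norm (N k))"
    using spn_ge[of "Q k" i j] spn_ge[of q j i] component_le_norm_cart[of "N k" i] component_le_norm_cart[of "N k" j]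
    by linarith
qed

text \<open>Stability of the span does not depend on \<open>\<xi>\<close>: the clipped gain is bounded, and the noise is of the order of the span.\<close>

lemma Gs_bounded: "\<exists>B. \<forall>k. Gs k \<le> B"
proof -
  obtain \<kappa> T0 K0 where kT: "0 \<le> \<kappa>" "\<kappa> < 1" "0 \<le> T0"
    and con: "\<forall>k0\<ge>K0. \<exists>k1. contracts \<kappa> T0 k0 k1"
    using contraction_windows by (elim exE conjE)
  define \<epsilon> where "\<epsilon> = (1 - \<kappa>) / (16 * (1 + T0))"
  have ep: "0 < \<epsilon>" unfolding \<epsilon>_def using kT by simp
  have epT: "\<epsilon> + \<epsilon> * T0 = (1 - \<kappa>) / 16"
  proof -
    have "x / (16 * z) * z = x / 16" if "z > 0" for x z :: real using that by simp
    from this[of "1 + T0" "1 - \<kappa>"] have "\<epsilon> * (1 + T0) = (1 - \<kappa>) / 16" unfolding \<epsilon>_def using kT by linarith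
    thus ?thesis by (simp add: distrib_left)
  qed
  have "eventually (\<lambda>k. norm (N k) / Gs k < \<epsilon>) sequentially" using N_relative ep by (intro order_tendstoD) auto
  then obtain K1 where "\<And>k. K1 \<le> k \<Longrightarrow> norm (N k) / Gs k < \<epsilon>" unfolding eventually_sequentially by blast
  hence Ns: "norm (N k) \<le> \<epsilon> * Gs k" if "K1 \<le> k" for k
    using that Gs1[of k] by (smt (verit) pos_divide_le_eq)
  define K where "K = max K0 K1"
  define A where "A = 1 + spn q + 2 * (T0 * C0)"
  have A: "1 \<le> A" unfolding A_def using spn_nonneg[of q] C0 kT by simp
  \<comment> \<open>Two bounds are carried from window to window, \<open>Gs \<le> B\<close> and
    \<open>2 * spn (y k) \<le> B\<close>; the factor \<open>2\<close> leaves room for growth inside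
    a window. The last term of \<open>B\<close> absorbs the constants in \<open>A\<close>, and with
    the above choice of \<open>\<epsilon>\<close> noise of size \<open>\<epsilon> * B\<close> uses
    up only a fraction of the margin \<open>(1 - \<kappa>) * B\<close> left by the
    contraction.\<close>
  define B where "B = max (max (Gs K) (2 * spn (y K))) (3 * A / (1 - \<kappa>))"
  have B: "Gs K \<le> B" "2 * spn (y K) \<le> B" "3 * A / (1 - \<kappa>) \<le> B" unfolding B_def by auto
  have B3: "3 * A \<le> (1 - \<kappa>) * B" using B(3) kT by (simp add: pos_divide_le_eq mult.commute)
  have B0: "0 \<le> B" using B(1) Gs1[of K] by linarith
  have kB: "0 \<le> \<kappa> * B" using kT B0 by simp
  have eB: "\<epsilon> * B + T0 * (\<epsilon> * B) = (1 - \<kappa>) * B / 16"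
    using arg_cong[OF epT, of "\<lambda>x. x * B"] by (simp add: algebra_simps)
  have eB0: "0 \<le> T0 * (\<epsilon> * B)" "0 \<le> \<epsilon> * B" using kT ep B0 by auto
  have kB1: "(1 - \<kappa>) * B = B - \<kappa> * B" by (simp add: algebra_simps)
  define \<delta> where "\<delta> = C0 + \<epsilon> * B"
  have d0: "0 \<le> \<delta>" unfolding \<delta>_def using C0 eB0 by simp
  have dT: "\<delta> * T0 = T0 * C0 + T0 * (\<epsilon> * B)" unfolding \<delta>_def by (simp add: algebra_simps)
  have errb: "\<bar>err k i\<bar> \<le> \<delta>" if "K \<le> k" "Gs k \<le> B" for k i
  proof -
    have "norm (N k) \<le> \<epsilon> * Gs k" using Ns that unfolding K_def by simp
    also have "\<dots> \<le> \<epsilon> * B" using that ep by (intro mult_left_mono) auto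
    finally show ?thesis using err_bound[of k i] unfolding \<delta>_def by linarith
  qed
  have step: "\<exists>k1>k0. Gs k1 \<le> B \<and> 2 * spn (y k1) \<le> B \<and> (\<forall>k\<in>{k0..k1}. Gs k \<le> B)"
    if k0: "K \<le> k0" "Gs k0 \<le> B" "2 * spn (y k0) \<le> B" for k0
  proof -
    have "K0 \<le> k0" using k0 unfolding K_def by simp
    then obtain k1 where con1: "contracts \<kappa> T0 k0 k1" using con by blast
    hence k1: "k1 > k0" "sum \<beta> {k0..<k1} \<le> T0" "unit_steps \<alpha> k0 k1" unfolding contracts_def by blast+
    have Gk: "\<forall>j\<in>{k0..k}. Gs j \<le> B" if "k0 \<le> k" "k \<le> k1" for k using that
    proof (induction k rule: dec_induct)
      case base thus ?case using k0 by simp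
    next
      case (step k)
      hence IH: "\<forall>j\<in>{k0..k}. Gs j \<le> B" by simp
      have "sum \<beta> {k0..<Suc k} \<le> sum \<beta> {k0..<k1}" using step by (intro sum_mono2) (auto simp: be0)
      hence mass: "\<delta> * sum \<beta> {k0..<Suc k} \<le> \<delta> * T0" using k1 d0 by (intro mult_left_mono) auto
      have "spn (y (Suc k)) \<le> spn (y k0) + 2 * (\<delta> * sum \<beta> {k0..<Suc k})"
        by (rule avi_span_growth[OF mdp avi_y unit_steps_subinterval[OF k1(3)] al_le _ d0])
          (use step IH k0 in \<open>auto intro!: errb\<close>)
      hence sy: "2 * spn (y (Suc k)) \<le> B + 4 * (\<delta> * T0)" using mass k0 by linarith
      have "norm (N (Suc k)) \<le> \<epsilon> * Gs (Suc k)" using Ns[of "Suc k"] step k0 unfolding K_def by simp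
      hence sQ: "spn (Q (Suc k)) \<le> spn (y (Suc k)) + (spn q + 2 * (\<epsilon> * Gs (Suc k)))"
        using spn_Q_le[of "Suc k"] by linarith
      have "Gs (Suc k) \<le> B"
      proof (rule ccontr)
        \<comment> \<open>Where the running maximum first passes \<open>B\<close> it equals
          \<open>1\<close> plus the current span. The noise bound
          \<open>\<epsilon> * Gs (Suc k)\<close> is then a small fraction of the quantity to be
          bounded and is absorbed.\<close>
        assume n: "\<not> Gs (Suc k) \<le> B"
        have "Gs k \<le> B" using IH step by simp
        hence G: "Gs (Suc k) = 1 + spn (Q (Suc k))" using n by auto
        have "2 * Gs (Suc k) \<le> 2 + B + 4 * (\<delta> * T0) + 2 * spn q + 4 * (\<epsilon> * Gs (Suc k))"
          using sQ sy G by linarith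
        hence "2 * Gs (Suc k) - 4 * (\<epsilon> * Gs (Suc k)) \<le> 2 * A + B + 4 * (T0 * (\<epsilon> * B))" unfolding dT A_def by argo
        moreover have "(2 - 4 * \<epsilon>) * B \<le> (2 - 4 * \<epsilon>) * Gs (Suc k)"
        proof (intro mult_left_mono)
          have "\<epsilon> \<le> (1 - \<kappa>) / 16" using epT ep kT by (smt (verit) mult_nonneg_nonneg)
          thus "0 \<le> 2 - 4 * \<epsilon>" using kT by argo
        qed (use n in linarith)
        ultimately have "2 * B - 4 * (\<epsilon> * B) \<le> 2 * A + B + 4 * (T0 * (\<epsilon> * B))"
          unfolding left_diff_distrib mult.assoc by argo
        hence "B - 4 * (\<epsilon> * B + T0 * (\<epsilon> * B)) \<le> 2 * A" by argo
        hence "B - (B - \<kappa> * B) / 4 \<le> 2 * A" unfolding eB kB1 by argo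
        moreover have "3 * A \<le> B - \<kappa> * B" using B3 kB1 by simp
        ultimately show False using A kB by argo
      qed
      thus ?case using IH step by (auto simp: le_Suc_eq)
    qed
    have "spn (y k1) \<le> \<kappa> * spn (y k0) + 2 * (\<delta> * T0)"
      by (rule contracts_spn[OF con1 avi_y]) (use d0 Gk[of k1] k1 k0 in \<open>auto intro!: errb\<close>)
    moreover have "\<kappa> * (2 * spn (y k0)) \<le> \<kappa> * B" using k0 kT by (intro mult_left_mono) auto
    ultimately have "2 * spn (y k1) \<le> \<kappa> * B + 4 * (T0 * C0) + 4 * (T0 * (\<epsilon> * B))" unfolding dT by argo
    also have "\<dots> \<le> \<kappa> * B + 2 * A + (B - \<kappa> * B) / 4"
      using eB eB0 kB1 spn_nonneg[of q] unfolding A_def by argo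
    also have "\<dots> \<le> B" using B3 kB1 A by argo
    finally have "2 * spn (y k1) \<le> B" .
    thus ?thesis using Gk[of k1] k1 by (intro exI[of _ k1]) auto
  qed
  have all: "Gs k \<le> B" if "k0 \<le> k" "K \<le> k0" "Gs k0 \<le> B" "2 * spn (y k0) \<le> B" for k k0 using that
  proof (induction "k - k0" arbitrary: k0 rule: less_induct)
    case less
    obtain k1 where k1: "k1 > k0" "Gs k1 \<le> B" "2 * spn (y k1) \<le> B" "\<forall>k\<in>{k0..k1}. Gs k \<le> B"
      using step[OF less.prems(2-4)] by blast
    show ?case
    proof (cases "k \<le> k1")
      case True thus ?thesis using k1(4) less.prems by auto
    next
      case False thus ?thesis using less.hyps[of k1] k1 less.prems by auto
    qed
  qed
  show ?thesis
  proof (intro exI[of _ B] allI)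
    fix k show "Gs k \<le> B"
    proof (cases "K \<le> k")
      case True thus ?thesis using all[of K k] B by simp
    next
      case False thus ?thesis using incseqD[OF incseq_runmax, of k K] B(1) by (meson nat_le_linear order_trans)
    qed
  qed
qed

lemma N_lim: "(\<lambda>k. norm (N k)) \<longlonglongrightarrow> 0"
proof -
  obtain B where B: "\<And>k. Gs k \<le> B" using Gs_bounded by blast
  have lim: "(\<lambda>k. norm (N k) / Gs k * B) \<longlonglongrightarrow> 0" by (rule tendsto_mult_left_zero[OF N_relative])
  have "norm (N k) \<le> norm (N k) / Gs k * B" for k
  proof -
    have "norm (N k) / Gs k * Gs k \<le> norm (N k) / Gs k * B"
      using B[of k] Gs1[of k] by (intro mult_left_mono) auto
    thus ?thesis using Gs1[of k] by simp
  qed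
  hence "eventually (\<lambda>k. norm (norm (N k)) \<le> norm (N k) / Gs k * B) sequentially"
    by (intro always_eventually allI) (simp only: real_norm_def abs_norm_cancel)
  thus ?thesis by (rule Lim_null_comparison[OF _ lim])
qed

lemma N_bounded: "\<exists>B. \<forall>k. norm (N k) \<le> B"
  using convergent_imp_Bseq[OF convergentI[OF N_lim]] unfolding Bseq_def by auto

lemma spn_y_bounded: "\<exists>B. \<forall>k. spn (y k) \<le> B"
proof -
  obtain B where B: "\<And>k. Gs k \<le> B" using Gs_bounded by blast
  obtain B' where B': "\<And>k. norm (N k) \<le> B'" using N_bounded by blast
  have "spn (y k) \<le> B + spn q + 2 * B'" for k
    using spn_y_le[of k] B[of k] B'[of k] runmax_ge[of "\<lambda>k. 1 + spn (Q k)" k] by linarith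
  thus ?thesis by blast
qed

lemma PT_minus_y: "\<bar>PT p q (y k) i - y k $ i\<bar> \<le> spn (y k)"
proof -
  obtain l where l: "\<And>i. l \<le> y k $ i" "\<And>i. y k $ i \<le> l + spn (y k)" using spn_bounds by metis
  have "l \<le> PT p q (y k) i" "PT p q (y k) i \<le> l + spn (y k)"
    using l by (auto intro!: PT_lower[OF mdp] PT_upper[OF mdp])
  thus ?thesis using l[of i] by linarith
qed

text \<open>The difference \<open>PT p q y - y\<close> is controlled by the span alone, so the bound
  is available before \<open>y\<close> itself is known to be bounded.\<close>

lemma y_increment: "\<exists>C\<ge>0. \<forall>k. norm (y (Suc k) - y k) \<le> C * \<beta> k"
proof -
  obtain B where B: "\<And>k. spn (y k) \<le> B" using spn_y_bounded by blast
  obtain B' where B': "\<And>k. norm (N k) \<le> B'" using N_bounded by blast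
  define D where "D = B + C0 + B'"
  have D: "\<bar>PT p q (y k) i - y k $ i + err k i\<bar> \<le> D" for k i
    using PT_minus_y[of k i] err_bound[of k i] B[of k] B'[of k] unfolding D_def by linarith
  hence D0: "0 \<le> D" by (meson abs_ge_zero order_trans)
  have "norm (y (Suc k) - y k) \<le> real CARD('s \<times> 'b) * (D * \<beta> k)" for k
  proof (rule norm_le_card_bound)
    fix i
    have "\<bar>(y (Suc k) - y k) $ i\<bar> = \<alpha> k i * \<bar>PT p q (y k) i - y k $ i + err k i\<bar>"
      by (simp add: y_step abs_mult al0)
    also have "\<dots> \<le> \<beta> k * D" using D al_le al0 be0 by (intro mult_mono) auto
    finally show "\<bar>(y (Suc k) - y k) $ i\<bar> \<le> D * \<beta> k" by (simp add: mult.commute)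
  qed
  thus ?thesis using D0 by (intro exI[of _ "real CARD('s \<times> 'b) * D"]) (simp add: mult.assoc del: of_nat_mult)
qed

section \<open>The fast time scale\<close>

primrec Nx :: "nat \<Rightarrow> real" where
  "Nx 0 = 0"
| "Nx (Suc k) = (1 - a k) * Nx k + a k * w1 k"

lemma Nx_relative: "(\<lambda>k. Nx k / Gn k) \<longlonglongrightarrow> 0"
  by (rule averaged_noise_vanishes[OF less_imp_le[OF a_pos] a_lim a_div _ incseq_runmax Gn1 noise1]) simp

text \<open>The proof compares \<open>\<xi> (Suc k)\<close> with \<open>f (Z k)\<close>, which makes \<open>\<beta> k / a (Suc k)\<close> the relevant ratio; see \<open>step_ratio\<close> below.\<close>

lemma xi_tracks: "(\<lambda>k. \<xi> k - Nx k - f (Z k)) \<longlonglongrightarrow> 0"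
proof -
  obtain C where C: "0 \<le> C" "\<And>k. norm (y (Suc k) - y k) \<le> C * \<beta> k" using y_increment by blast
  have fZ: "\<bar>f (Z k) - f (Z (Suc k))\<bar> \<le> L * (C * \<beta> k)" for k
  proof -
    have "Z k - Z (Suc k) = - (y (Suc k) - y k)" by (simp add: Z_eq)
    hence "norm (Z k - Z (Suc k)) \<le> C * \<beta> k" using C(2)[of k] by (metis norm_minus_cancel)
    thus ?thesis using f_lip[of "Z k" "Z (Suc k)"] L0 by (meson mult_left_mono order_trans)
  qed
  define x where "x k = \<xi> k - Nx k" for k
  have x: "x (Suc k) = (1 - a k) * x k + a k * f (Q k)" for k
    unfolding x_def by (simp add: xi_step algebra_simps)
  define t where "t k = x (Suc k) - f (Z k)" for k
  have "t \<longlonglongrightarrow> 0"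
  \<comment> \<open>One step moves \<open>f (Z k)\<close> by an amount of order
    \<open>\<beta> k\<close>, which is \<open>a (Suc k)\<close> times a null sequence: on the time
    scale of \<open>\<xi>\<close> the target stands still.\<close>
  proof (rule averaging_tracks[where \<alpha>="\<lambda>k. a (Suc k)" and \<epsilon>="\<lambda>k. L * C * (\<beta> k / a (Suc k)) + L * norm (N (Suc k))"])
    show "0 \<le> a (Suc k)" for k using a_pos less_imp_le by blast
    show "(\<lambda>k. a (Suc k)) \<longlonglongrightarrow> 0" by (rule LIMSEQ_Suc[OF a_lim])
    show "\<not> summable (\<lambda>k. a (Suc k))" using a_div by (simp add: summable_Suc_iff)
    have "(\<lambda>k. L * C * (\<beta> k / a (Suc k)) + L * norm (N (Suc k))) \<longlonglongrightarrow> L * C * 0 + L * 0"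
      by (intro tendsto_intros ratio LIMSEQ_Suc[OF N_lim])
    thus "(\<lambda>k. L * C * (\<beta> k / a (Suc k)) + L * norm (N (Suc k))) \<longlonglongrightarrow> 0" by simp
    have "eventually (\<lambda>k. a (Suc k) < 1) sequentially" using LIMSEQ_Suc[OF a_lim] by (intro order_tendstoD) auto
    thus "eventually (\<lambda>k. \<bar>t (Suc k)\<bar> \<le> (1 - a (Suc k)) * \<bar>t k\<bar> + a (Suc k) * (L * C * (\<beta> k / a (Suc k)) + L * norm (N (Suc k)))) sequentially"
    proof eventually_elim
      case (elim k)
      define A where "A = a (Suc k)"
      have A: "0 < A" "A < 1" unfolding A_def using a_pos elim by auto
      have "t (Suc k) = (1 - A) * (t k + (f (Z k) - f (Z (Suc k)))) + A * (f (Q (Suc k)) - f (Z (Suc k)))"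
        unfolding t_def x[of "Suc k"] A_def by (simp add: algebra_simps)
      also have "\<bar>\<dots>\<bar> \<le> \<bar>(1 - A) * (t k + (f (Z k) - f (Z (Suc k))))\<bar> + \<bar>A * (f (Q (Suc k)) - f (Z (Suc k)))\<bar>"
        by (rule abs_triangle_ineq)
      also have "\<dots> = (1 - A) * \<bar>t k + (f (Z k) - f (Z (Suc k)))\<bar> + A * \<bar>f (Q (Suc k)) - f (Z (Suc k))\<bar>"
        using A by (simp add: abs_mult)
      also have "\<dots> \<le> (1 - A) * (\<bar>t k\<bar> + \<bar>f (Z k) - f (Z (Suc k))\<bar>) + A * (L * norm (N (Suc k)))"
        using A f_lip[of "Q (Suc k)" "Z (Suc k)"] by (intro add_mono mult_left_mono) (auto simp: Z_def)
      also have "\<dots> = (1 - A) * \<bar>t k\<bar> + (1 - A) * \<bar>f (Z k) - f (Z (Suc k))\<bar> + A * (L * norm (N (Suc k)))"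
        by (simp add: distrib_left)
      also have "\<dots> \<le> (1 - A) * \<bar>t k\<bar> + 1 * (L * (C * \<beta> k)) + A * (L * norm (N (Suc k)))"
        using A fZ[of k] by (intro add_mono mult_mono) (auto simp: L0)
      also have "\<dots> = (1 - A) * \<bar>t k\<bar> + A * (L * C * (\<beta> k / A) + L * norm (N (Suc k)))"
        using A by (simp add: field_simps)
      finally show ?case unfolding A_def .
    qed
  qed
  moreover have "(\<lambda>k. f (Z k) - f (Z (Suc k))) \<longlonglongrightarrow> 0"
  proof (rule Lim_null_comparison)
    show "eventually (\<lambda>k. norm (f (Z k) - f (Z (Suc k))) \<le> L * (C * \<beta> k)) sequentially"
      using fZ by (intro always_eventually) simp
    have "(\<lambda>k. L * (C * \<beta> k)) \<longlonglongrightarrow> L * (C * 0)" by (intro tendsto_intros be_lim)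
    thus "(\<lambda>k. L * (C * \<beta> k)) \<longlonglongrightarrow> 0" by simp
  qed
  ultimately have "(\<lambda>k. t k + (f (Z k) - f (Z (Suc k)))) \<longlonglongrightarrow> 0 + 0" by (rule tendsto_add)
  moreover have "t k + (f (Z k) - f (Z (Suc k))) = \<xi> (Suc k) - Nx (Suc k) - f (Z (Suc k))" for k
    unfolding t_def x_def by linarith
  ultimately have "(\<lambda>k. \<xi> (Suc k) - Nx (Suc k) - f (Z (Suc k))) \<longlonglongrightarrow> 0" by (simp only: add_0)
  thus ?thesis by (rule LIMSEQ_imp_Suc)
qed

text \<open>Coordinatewise, \<open>q + y k\<close> differs from a constant shift of \<open>q\<close>
  by at most the span, and along constants \<open>f\<close> is affine. Any single component thus
  represents the level of the whole vector.\<close>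

lemma f_near_constant:
  "\<bar>f (q + y k) - (f q + u * y k $ i)\<bar> \<le> L * (real CARD('s \<times> 'b) * spn (y k))"
proof -
  have "norm ((q + y k) - (q + (y k $ i) *\<^sub>R ones)) \<le> real CARD('s \<times> 'b) * spn (y k)"
  proof (rule norm_le_card_bound)
    fix j
    show "\<bar>((q + y k) - (q + (y k $ i) *\<^sub>R ones)) $ j\<bar> \<le> spn (y k)"
      using spn_ge[of "y k" i j] spn_ge[of "y k" j i] by (simp add: ones_def abs_le_iff)
  qed
  hence "L * norm ((q + y k) - (q + (y k $ i) *\<^sub>R ones)) \<le> L * (real CARD('s \<times> 'b) * spn (y k))"
    using L0 by (intro mult_left_mono)
  moreover have "f (q + (y k $ i) *\<^sub>R ones) = f q + u * y k $ i" by (simp add: f_shift)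
  ultimately show ?thesis using f_lip[of "q + y k" "q + (y k $ i) *\<^sub>R ones"] by linarith
qed

text \<open>As \<open>\<bar>f q\<bar> \<le> R\<close>, a drift clipped from above is at most
  \<open>- \<eta>\<close>; only the noise counteracts it.\<close>

lemma err_upper_of_large_xi:
  assumes "R + \<eta> \<le> \<xi> k"
  shows "err k i \<le> norm (N k) - \<eta>"
proof -
  have "g (\<xi> k) = R + \<eta>" using assms unfolding g_clip_def by simp
  thus ?thesis using err_noise[of i k] rho unfolding err_def by linarith
qed

lemma err_lower_of_small_xi:
  assumes "\<xi> k \<le> - R - \<eta>"
  shows "\<eta> - norm (N k) \<le> err k i"
proof -
  have "g (\<xi> k) = - R - \<eta>" using assms R0 eta unfolding g_clip_def by auto
  thus ?thesis using err_noise[of i k] rho unfolding err_def by linarith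
qed

text \<open>The averaged noise of \<open>\<xi>\<close> is only known to be small relative to
  \<open>Gn\<close>, so the bounds on \<open>y\<close> and on \<open>Gn\<close> are proved in one
  induction. If some component reaches \<open>B / 2\<close>, then \<open>f (q + y k)\<close> exceeds
  \<open>f q\<close> by about \<open>u * B / 2\<close>; the part of the noise that grows with
  \<open>B\<close> takes back at most \<open>u * B / 4\<close>, so \<open>\<xi>\<close> is clipped
  and the drift points inwards.\<close>

lemma Gn_bounded: "\<exists>B. \<forall>k. Gn k \<le> B"
proof -
  define nd where "nd = real CARD('s \<times> 'b)"
  have nd: "1 \<le> nd" unfolding nd_def by (rule card_ge_one)
  have combo: "(1 - t) * x + t * x = x" for t x :: real by (simp add: algebra_simps)
  obtain S where S: "\<And>k. spn (y k) \<le> S" using spn_y_bounded by blast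
  have S0: "0 \<le> S" using S[of 0] spn_nonneg[of "y 0"] by linarith
  define c1 where "c1 = L * (nd * S)"
  have c1: "\<bar>f (q + y k) - (f q + u * y k $ i)\<bar> \<le> c1" for k i
  proof -
    have "L * (nd * spn (y k)) \<le> c1" unfolding c1_def using S L0 nd by (intro mult_left_mono) auto
    thus ?thesis using f_near_constant[of k i] unfolding nd_def by linarith
  qed
  define \<epsilon> where "\<epsilon> = u / (4 * nd)"
  have ep: "0 < \<epsilon>" "\<epsilon> * nd = u / 4" unfolding \<epsilon>_def using u nd by auto
  have e1: "eventually (\<lambda>k. \<bar>Nx k / Gn k\<bar> < \<epsilon>) sequentially"
    using tendsto_rabs_zero[OF Nx_relative] ep by (intro order_tendstoD) auto
  have e2: "eventually (\<lambda>k. \<bar>\<xi> k - Nx k - f (Z k)\<bar> < 1) sequentially"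
    using tendsto_rabs_zero[OF xi_tracks] by (intro order_tendstoD) auto
  have e3: "eventually (\<lambda>k. norm (N k) < min 1 \<eta>) sequentially"
    using N_lim eta by (intro order_tendstoD) auto
  have e4: "eventually (\<lambda>k. \<beta> k < 1) sequentially"
    using be_lim by (intro order_tendstoD) auto
  have "eventually (\<lambda>k. \<bar>Nx k / Gn k\<bar> < \<epsilon> \<and> \<bar>\<xi> k - Nx k - f (Z k)\<bar> < 1 \<and> norm (N k) < min 1 \<eta> \<and> \<beta> k < 1) sequentially"
    using e1 e2 e3 e4 by eventually_elim simp
  then obtain K where K: "\<And>k. K \<le> k \<Longrightarrow> \<bar>Nx k / Gn k\<bar> < \<epsilon> \<and> \<bar>\<xi> k - Nx k - f (Z k)\<bar> < 1 \<and> norm (N k) < min 1 \<eta> \<and> \<beta> k < 1"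
    unfolding eventually_sequentially by blast
  have KNx: "\<bar>Nx k\<bar> \<le> \<epsilon> * Gn k" if "K \<le> k" for k
  proof -
    have "0 < Gn k" using Gn1[of k] by linarith
    moreover have "\<bar>Nx k\<bar> / \<bar>Gn k\<bar> < \<epsilon>" using K[OF that] by (simp add: abs_divide)
    ultimately show ?thesis by (simp add: pos_divide_less_eq less_imp_le)
  qed
  define Cn where "Cn = 2 + norm q + Gn K"
  \<comment> \<open>\<open>c2\<close> makes the remaining \<open>u * B / 4\<close> outweigh the
    clipping level and all constants. The term \<open>2 * (C0 + 1)\<close> of \<open>B\<close> lets
    a component below \<open>B / 2\<close> take one step without passing \<open>B\<close>.\<close>
  define c2 where "c2 = 4 * (2 * R + \<eta> + c1 + 1 + \<epsilon> * Cn) / u"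
  define y0 where "y0 = norm (y K)"
  define B where "B = max (max y0 (2 * (C0 + 1))) c2"
  have B: "y0 \<le> B" "2 * (C0 + 1) \<le> B" "c2 \<le> B" unfolding B_def by auto
  have uB: "2 * R + \<eta> + c1 + 1 + \<epsilon> * Cn \<le> u * B / 4"
    using B(3) u unfolding c2_def by (simp add: pos_divide_le_eq mult.commute)
  have B0: "0 \<le> B" using B(2) C0(1) by argo
  have ineq: "\<epsilon> * (Cn + nd * B) = \<epsilon> * Cn + u * B / 4"
    using arg_cong[OF ep(2), of "\<lambda>x. x * B"] by (simp add: algebra_simps)
  have "(\<forall>i. \<bar>y k $ i\<bar> \<le> B) \<and> Gn k \<le> Cn + nd * B" if "K \<le> k" for k using that
  proof (induction k rule: dec_induct)
    case base
    have "\<bar>y K $ i\<bar> \<le> B" for i using component_le_norm_cart[of "y K" i] B(1) unfolding y0_def by linarith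
    moreover have "Gn K \<le> Cn + nd * B" unfolding Cn_def using nd B0 norm_ge_zero[of q] by (smt (verit) mult_nonneg_nonneg)
    ultimately show ?case by blast
  next
    case (step k)
    hence IH: "\<And>i. \<bar>y k $ i\<bar> \<le> B" "Gn k \<le> Cn + nd * B" by auto
    note Kk = K[OF step.hyps(1)]
    have xi: "\<bar>\<xi> k - f (q + y k)\<bar> \<le> 1 + (\<epsilon> * Cn + u * B / 4)"
    proof -
      have "\<epsilon> * Gn k \<le> \<epsilon> * (Cn + nd * B)" using IH(2) ep by (intro mult_left_mono) auto
      thus ?thesis using KNx[OF step.hyps(1)] Kk unfolding ineq Z_eq by linarith
    qed
    have al: "0 \<le> \<alpha> k i" "\<alpha> k i \<le> 1" for i using al0[of k i] al_le[of k i] Kk by auto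
    have ys: "y (Suc k) $ i = (1 - \<alpha> k i) * y k $ i + \<alpha> k i * (PT p q (y k) i + err k i)" for i
      unfolding y_step by (simp add: algebra_simps)
    have er: "\<bar>err k i\<bar> \<le> C0 + 1" for i using err_bound[of k i] Kk by simp
    have up: "y (Suc k) $ i \<le> B" for i
    \<comment> \<open>It does not matter which component is large: with bounded span, each of them
      determines \<open>f (q + y k)\<close> up to \<open>c1\<close>.\<close>
    proof (cases "\<exists>j. B / 2 \<le> y k $ j")
      case True
      then obtain j where j: "B / 2 \<le> y k $ j" by blast
      have "u * (B / 2) \<le> u * y k $ j" using j u by (intro mult_left_mono) auto
      hence "R + \<eta> \<le> \<xi> k" using xi c1[of k j] uB rho by argo
      hence e: "err k i \<le> 0" using err_upper_of_large_xi[of k i] Kk by simp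
      have "PT p q (y k) i \<le> B" using IH(1) by (intro PT_upper[OF mdp]) (simp add: abs_le_iff)
      hence "y (Suc k) $ i \<le> (1 - \<alpha> k i) * B + \<alpha> k i * B" unfolding ys
        using e al IH(1)[of i] by (intro add_mono mult_left_mono) auto
      thus ?thesis by (simp add: algebra_simps)
    next
      case False
      hence lt: "y k $ j \<le> B / 2" for j by (meson linear)
      have "PT p q (y k) i \<le> B / 2" using lt by (intro PT_upper[OF mdp])
      moreover have "y k $ i \<le> B / 2 + (C0 + 1)" using lt[of i] C0(1) by linarith
      ultimately have "y (Suc k) $ i \<le> (1 - \<alpha> k i) * (B / 2 + (C0 + 1)) + \<alpha> k i * (B / 2 + (C0 + 1))" unfolding ys
        using er[of i] al by (intro add_mono mult_left_mono) auto
      also have "\<dots> = B / 2 + (C0 + 1)" by (rule combo)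
      finally show ?thesis using B(2) by argo
    qed
    have low: "- B \<le> y (Suc k) $ i" for i
    proof (cases "\<exists>j. y k $ j \<le> - (B / 2)")
      case True
      then obtain j where j: "y k $ j \<le> - (B / 2)" by blast
      have "u * y k $ j \<le> u * - (B / 2)" using j u by (intro mult_left_mono) auto
      hence "\<xi> k \<le> - R - \<eta>" using xi c1[of k j] uB rho by argo
      hence e: "0 \<le> err k i" using err_lower_of_small_xi[of k i] Kk by simp
      have "- B \<le> PT p q (y k) i" using IH(1) by (intro PT_lower[OF mdp]) (simp add: abs_le_iff minus_le_iff)
      hence "(1 - \<alpha> k i) * (- B) + \<alpha> k i * (- B) \<le> y (Suc k) $ i" unfolding ys
        using e al IH(1)[of i] by (intro add_mono mult_left_mono) auto
      thus ?thesis by (simp add: algebra_simps)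
    next
      case False
      hence lt: "- (B / 2) \<le> y k $ j" for j by (meson linear)
      have "- (B / 2) \<le> PT p q (y k) i" using lt by (intro PT_lower[OF mdp])
      moreover have "- (B / 2 + (C0 + 1)) \<le> y k $ i" using lt[of i] C0(1) by linarith
      ultimately have "(1 - \<alpha> k i) * (- (B / 2 + (C0 + 1))) + \<alpha> k i * (- (B / 2 + (C0 + 1))) \<le> y (Suc k) $ i" unfolding ys
        using er[of i] al by (intro add_mono mult_left_mono) (auto simp: abs_le_iff)
      moreover have "(1 - \<alpha> k i) * (- (B / 2 + (C0 + 1))) + \<alpha> k i * (- (B / 2 + (C0 + 1))) = - (B / 2 + (C0 + 1))"
        by (rule combo)
      ultimately show ?thesis using B(2) by argo
    qed
    have yb: "\<bar>y (Suc k) $ i\<bar> \<le> B" for i using up[of i] low[of i] by linarith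
    have "norm (y (Suc k)) \<le> nd * B" unfolding nd_def by (rule norm_le_card_bound[OF yb])
    moreover have "norm (N (Suc k)) \<le> 1" using K[of "Suc k"] step.hyps by simp
    moreover have "norm (Q (Suc k)) \<le> norm q + norm (y (Suc k)) + norm (N (Suc k))"
      unfolding Q_eq[of "Suc k"] using norm_triangle_ineq[of "q + y (Suc k)" "N (Suc k)"] norm_triangle_ineq[of q "y (Suc k)"] by linarith
    ultimately have "1 + norm (Q (Suc k)) \<le> Cn + nd * B" unfolding Cn_def using Gn1[of K] by linarith
    thus ?case using yb IH(2) by simp
  qed
  hence "Gn k \<le> Cn + nd * B" if "K \<le> k" for k using that by blast
  moreover have "Gn k \<le> Gn (max k K)" for k by (rule incseqD[OF incseq_runmax]) simp
  ultimately show ?thesis by (meson max.cobounded2 order_trans)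
qed

lemma Nx_lim: "Nx \<longlonglongrightarrow> 0"
proof -
  obtain B where B: "\<And>k. Gn k \<le> B" using Gn_bounded by blast
  have lim: "(\<lambda>k. \<bar>Nx k / Gn k\<bar> * B) \<longlonglongrightarrow> 0" by (rule tendsto_mult_left_zero[OF tendsto_rabs_zero[OF Nx_relative]])
  have "norm (Nx k) \<le> \<bar>Nx k / Gn k\<bar> * B" for k
  proof -
    have "\<bar>Nx k / Gn k\<bar> * Gn k \<le> \<bar>Nx k / Gn k\<bar> * B"
      using B[of k] by (intro mult_left_mono) auto
    thus ?thesis using Gn1[of k] by (simp add: abs_divide)
  qed
  hence "eventually (\<lambda>k. norm (Nx k) \<le> \<bar>Nx k / Gn k\<bar> * B) sequentially"
    by (intro always_eventually allI)
  thus ?thesis by (rule Lim_null_comparison[OF _ lim])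
qed

section \<open>Convergence of the span, then of the level\<close>

lemma xi_f_lim: "(\<lambda>k. \<xi> k - f (q + y k)) \<longlonglongrightarrow> 0"
proof -
  have "(\<lambda>k. (\<xi> k - Nx k - f (Z k)) + Nx k) \<longlonglongrightarrow> 0 + 0" by (intro tendsto_add xi_tracks Nx_lim)
  moreover have "(\<xi> k - Nx k - f (Z k)) + Nx k = \<xi> k - f (q + y k)" for k unfolding Z_eq by linarith
  ultimately show ?thesis by (simp only: add_0)
qed

text \<open>The clipped gain with \<open>\<xi> k\<close> replaced by the value it follows, relative
  to \<open>f q\<close>. \<open>\<xi>\<close> itself varies on the scale of \<open>a\<close>; the
  replacement has increments of order \<open>\<beta> k\<close>, as summation by parts
  requires.\<close>

definition "\<kappa> k = g (f (q + y k)) - f q"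
definition "dl k = \<bar>\<xi> k - f (q + y k)\<bar> + norm (N k)"

lemma dl_lim: "dl \<longlonglongrightarrow> 0"
proof -
  have "(\<lambda>k. \<bar>\<xi> k - f (q + y k)\<bar> + norm (N k)) \<longlonglongrightarrow> 0 + 0"
    by (intro tendsto_add tendsto_rabs_zero[OF xi_f_lim] N_lim)
  thus ?thesis unfolding dl_def[abs_def] by (simp only: add_0)
qed

lemma err_kappa: "\<bar>err k i + \<kappa> k\<bar> \<le> dl k"
  using err_noise[of i k] g_clip_lipschitz[OF R0 eta, of "\<xi> k" "f (q + y k)"]
  unfolding err_def \<kappa>_def dl_def by linarith

lemma kappa_bound: "\<bar>\<kappa> k\<bar> \<le> C0"
  using C0(2)[of "f (q + y k)"] unfolding \<kappa>_def by linarith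

lemma kappa_increment: "\<exists>C\<ge>0. \<forall>k. \<bar>\<kappa> (Suc k) - \<kappa> k\<bar> \<le> C * \<beta> k"
proof -
  obtain C where C: "0 \<le> C" "\<And>k. norm (y (Suc k) - y k) \<le> C * \<beta> k" using y_increment by blast
  have "\<bar>\<kappa> (Suc k) - \<kappa> k\<bar> \<le> L * C * \<beta> k" for k
  proof -
    have "\<bar>\<kappa> (Suc k) - \<kappa> k\<bar> \<le> \<bar>f (q + y (Suc k)) - f (q + y k)\<bar>"
      using g_clip_lipschitz[OF R0 eta, of "f (q + y (Suc k))" "f (q + y k)"] unfolding \<kappa>_def by linarith
    also have "\<dots> \<le> L * norm (y (Suc k) - y k)" using f_lip[of "q + y (Suc k)" "q + y k"] by simp
    also have "\<dots> \<le> L * (C * \<beta> k)" using C(2) L0 by (intro mult_left_mono)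
    finally show ?thesis by (simp add: mult.assoc)
  qed
  thus ?thesis using C L0 by (intro exI[of _ "L * C"]) auto
qed

text \<open>The clipped gain acts on all components at asymptotically the same speed, so that it can be
  removed by a shift: \<open>y + c\<close> follows value iteration without any gain.\<close>

lemma spn_y_lim: "(\<lambda>k. spn (y k)) \<longlonglongrightarrow> 0"
proof -
  obtain \<theta> T0 K0 where kT: "0 \<le> \<theta>" "\<theta> < 1" "0 \<le> T0"
    and con: "\<forall>k0\<ge>K0. \<exists>k1. contracts \<theta> T0 k0 k1"
    using contraction_windows by (elim exE conjE)
  obtain C where C: "0 \<le> C" "\<And>k. \<bar>\<kappa> (Suc k) - \<kappa> k\<bar> \<le> C * \<beta> k" using kappa_increment by blast
  show ?thesis
  proof (rule chain_contraction[OF spn_nonneg kT(1,2)])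
    fix \<epsilon> :: real assume e: "\<epsilon> > 0"
    \<comment> \<open>\<open>4 * T0\<close> accounts for errors of size
      \<open>2 * \<epsilon>1\<close> over mass \<open>T0\<close>, counted twice in the span, and
      \<open>1\<close> for the return from \<open>x\<close> to \<open>y\<close>.\<close>
    define \<epsilon>1 where "\<epsilon>1 = \<epsilon> / (4 * T0 + 1)"
    have e1: "0 < \<epsilon>1" "(4 * T0 + 1) * \<epsilon>1 = \<epsilon>" unfolding \<epsilon>1_def using e kT by auto
    define V where "V = C0 + C * T0"
    have V0: "0 \<le> V" unfolding V_def using C0(1) C kT by simp
    define \<epsilon>2 where "\<epsilon>2 = \<epsilon>1 / (1 + V)"
    have e2: "0 < \<epsilon>2" "\<epsilon>2 * V \<le> \<epsilon>1" unfolding \<epsilon>2_def using e1 V0 by (auto simp: field_simps)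
    obtain K1 where K1: "\<forall>k0\<ge>K1. \<forall>k\<ge>k0. sum \<beta> {k0..<k} \<le> T0 \<longrightarrow>
       (\<forall>i j. \<bar>(\<Sum>l\<in>{k0..<k}. \<alpha> l i) - (\<Sum>l\<in>{k0..<k}. \<alpha> l j)\<bar> \<le> \<epsilon>2)"
      using equal[OF e2(1), of T0] by blast
    have "eventually (\<lambda>k. dl k < \<epsilon>1) sequentially" using dl_lim e1 by (intro order_tendstoD) auto
    then obtain K2 where K2: "\<And>k. K2 \<le> k \<Longrightarrow> dl k < \<epsilon>1" unfolding eventually_sequentially by blast
    show "\<exists>K. \<forall>k0\<ge>K. \<exists>k1>k0. spn (y k1) \<le> \<theta> * spn (y k0) + \<epsilon> \<and> (\<forall>k\<in>{k0..k1}. spn (y k) \<le> spn (y k0) + \<epsilon>)"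
    proof (rule exI[of _ "max K0 (max K1 K2)"], intro allI impI)
      fix k0 assume k0: "max K0 (max K1 K2) \<le> k0"
      hence "K0 \<le> k0" by simp
      then obtain k1 where con1: "contracts \<theta> T0 k0 k1" using con by blast
      hence k1: "k1 > k0" "sum \<beta> {k0..<k1} \<le> T0" "unit_steps \<alpha> k0 k1" unfolding contracts_def by blast+
      \<comment> \<open>What the drift has taken from each component since \<open>k0\<close>. The
        entries agree up to \<open>\<epsilon>1\<close>, so adding \<open>c\<close> to
        \<open>y\<close> undoes the drift and hardly changes the span.\<close>
      define c where "c k = (\<chi> i. \<Sum>l\<in>{k0..<k}. \<kappa> l * \<alpha> l i)" for k
      have mass: "sum \<beta> {k0..<k} \<le> T0" if "k \<le> k1" for k
      proof -
        have "sum \<beta> {k0..<k} \<le> sum \<beta> {k0..<k1}" using that by (intro sum_mono2) (auto simp: be0)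
        thus ?thesis using k1 by linarith
      qed
      have cd: "\<bar>c k $ i - c k $ j\<bar> \<le> \<epsilon>1" if k: "k0 \<le> k" "k \<le> k1" for k i j
      proof -
        have cij: "c k $ i - c k $ j = (\<Sum>l\<in>{k0..<k}. \<kappa> l * (\<alpha> l i - \<alpha> l j))"
          unfolding c_def by (simp add: right_diff_distrib sum_subtractf)
        have "\<bar>\<Sum>l\<in>{k0..<k}. \<kappa> l * (\<alpha> l i - \<alpha> l j)\<bar> \<le> \<epsilon>2 * (\<bar>\<kappa> k\<bar> + (\<Sum>l\<in>{k0..<k}. \<bar>\<kappa> (Suc l) - \<kappa> l\<bar>))"
        proof (rule summation_by_parts_bound[OF _ k(1)])
          fix k' assume k': "k0 \<le> k'" "k' \<le> k"
          have "\<bar>(\<Sum>l\<in>{k0..<k'}. \<alpha> l i) - (\<Sum>l\<in>{k0..<k'}. \<alpha> l j)\<bar> \<le> \<epsilon>2"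
            using K1 mass[of k'] k k' k0 by simp
          thus "\<bar>\<Sum>l\<in>{k0..<k'}. \<alpha> l i - \<alpha> l j\<bar> \<le> \<epsilon>2" by (simp only: sum_subtractf)
        qed
        also have "\<dots> \<le> \<epsilon>2 * V"
        proof (intro mult_left_mono)
          have "(\<Sum>l\<in>{k0..<k}. \<bar>\<kappa> (Suc l) - \<kappa> l\<bar>) \<le> (\<Sum>l\<in>{k0..<k}. C * \<beta> l)" by (rule sum_mono) (rule C(2))
          also have "\<dots> = C * sum \<beta> {k0..<k}" by (rule sum_distrib_left[symmetric])
          also have "\<dots> \<le> C * T0" using mass[of k] k C by (intro mult_left_mono) auto
          finally show "\<bar>\<kappa> k\<bar> + (\<Sum>l\<in>{k0..<k}. \<bar>\<kappa> (Suc l) - \<kappa> l\<bar>) \<le> V" unfolding V_def using kappa_bound[of k] by linarith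
        qed (use e2 in simp)
        finally show ?thesis using e2 unfolding cij by linarith
      qed
      define x where "x k = y k + c k" for k
      \<comment> \<open>\<open>PT\<close> commutes with the shift by one constant, but each
        component carries its own entry of \<open>c k\<close>. The second term is the resulting
        defect, small because the entries nearly agree.\<close>
      define e' where "e' k i = (err k i + \<kappa> k) + (PT p q (y k + (c k $ i) *\<^sub>R ones) i - PT p q (x k) i)" for k i
      have e': "\<bar>e' k i\<bar> \<le> 2 * \<epsilon>1" if k: "k0 \<le> k" "k < k1" for k i
      proof -
        have "\<bar>PT p q (y k + (c k $ i) *\<^sub>R ones) i - PT p q (x k) i\<bar> \<le> \<epsilon>1"
          by (rule PT_diff[OF mdp]) (use cd[of k i] k in \<open>simp add: x_def ones_def\<close>)
        moreover have "dl k < \<epsilon>1" using K2[of k] k k0 by simp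
        ultimately show ?thesis using err_kappa[of k i] unfolding e'_def by linarith
      qed
      have itx: "avi p q \<alpha> e' x k0 k1" unfolding avi_def
      proof (intro ballI allI)
        fix k i assume k: "k \<in> {k0..<k1}"
        have "c (Suc k) $ i = c k $ i + \<kappa> k * \<alpha> k i" using k by (simp add: c_def)
        moreover have "PT p q (y k + (c k $ i) *\<^sub>R ones) i = PT p q (y k) i + c k $ i" by (rule PT_shift[OF mdp])
        ultimately show "x (Suc k) $ i = x k $ i + \<alpha> k i * (PT p q (x k) i - x k $ i + e' k i)"
          unfolding e'_def by (simp add: x_def y_step algebra_simps)
      qed
      have xk0: "x k0 = y k0" unfolding x_def c_def by (simp add: vec_eq_iff)
      have spx: "spn (y k) \<le> spn (x k) + \<epsilon>1" if k: "k0 \<le> k" "k \<le> k1" for k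
      proof (rule spn_leI)
        fix i j
        have "y k $ i - y k $ j = (x k $ i - x k $ j) - (c k $ i - c k $ j)" by (simp add: x_def)
        thus "y k $ i - y k $ j \<le> spn (x k) + \<epsilon>1" using cd[OF k, of i j] spn_ge[of "x k" i j] by linarith
      qed
      have tot: "2 * (2 * \<epsilon>1 * T0) + \<epsilon>1 \<le> \<epsilon>" using e1(2) by (simp add: algebra_simps)
      have "spn (x k1) \<le> \<theta> * spn (x k0) + 2 * (2 * \<epsilon>1 * T0)"
        by (rule contracts_spn[OF con1 itx]) (use e' e1 in auto)
      hence A: "spn (y k1) \<le> \<theta> * spn (y k0) + \<epsilon>" using spx[of k1] k1(1) tot unfolding xk0 by simp
      have "spn (y k) \<le> spn (y k0) + \<epsilon>" if k: "k \<in> {k0..k1}" for k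
      proof -
        have "spn (x k) \<le> spn (x k0) + 2 * (2 * \<epsilon>1 * sum \<beta> {k0..<k})"
          by (rule avi_span_growth[OF mdp avi_subinterval[OF itx] unit_steps_subinterval[OF k1(3)] al_le])
            (use e' e1 k in auto)
        moreover have "2 * \<epsilon>1 * sum \<beta> {k0..<k} \<le> 2 * \<epsilon>1 * T0" using mass[of k] k e1 by (intro mult_left_mono) auto
        ultimately show ?thesis using spx[of k] k tot unfolding xk0 by simp
      qed
      thus "\<exists>k1>k0. spn (y k1) \<le> \<theta> * spn (y k0) + \<epsilon> \<and> (\<forall>k\<in>{k0..k1}. spn (y k) \<le> spn (y k0) + \<epsilon>)"
        using A k1(1) by blast
    qed
  qed
qed

text \<open>Once the span vanishes, so does the averaging term, and each component obeys a scalar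
  recursion with the restoring drift \<open>- h\<close>, whose only zero is
  \<open>0\<close>.\<close>

lemma y_component_lim: "(\<lambda>k. y k $ i) \<longlonglongrightarrow> 0"
proof -
  define nd where "nd = real CARD('s \<times> 'b)"
  define h where "h x = g (f q + u * x) - f q" for x
  define \<omega> where "\<omega> k = PT p q (y k) i - y k $ i + err k i + h (y k $ i)" for k
  define W where "W k = spn (y k) + dl k + L * (nd * spn (y k))" for k
  have hb: "\<bar>h x\<bar> \<le> C0" for x using C0(2)[of "f q + u * x"] unfolding h_def by linarith
  have W: "\<bar>\<omega> k\<bar> \<le> W k" for k
  proof -
    have "\<bar>\<kappa> k - h (y k $ i)\<bar> \<le> \<bar>f (q + y k) - (f q + u * y k $ i)\<bar>"
      using g_clip_lipschitz[OF R0 eta, of "f (q + y k)" "f q + u * y k $ i"] unfolding \<kappa>_def h_def by linarith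
    thus ?thesis using f_near_constant[of k i] PT_minus_y[of k i] err_kappa[of k i] unfolding \<omega>_def W_def nd_def by linarith
  qed
  have "W \<longlonglongrightarrow> 0 + 0 + L * (nd * 0)" unfolding W_def[abs_def]
    by (intro tendsto_intros spn_y_lim dl_lim)
  hence W0: "W \<longlonglongrightarrow> 0" by simp
  have ys: "y (Suc k) $ i = y k $ i + \<alpha> k i * (- h (y k $ i) + \<omega> k)" for k
    unfolding \<omega>_def y_step by simp
  have "(\<lambda>k. \<bar>y k $ i\<bar>) \<longlonglongrightarrow> 0"
  proof (rule descent_to_zero[OF abs_ge_zero al0 al_div])
    fix \<epsilon> :: real assume e: "\<epsilon> > 0"
    \<comment> \<open>\<open>h\<close> has slope \<open>u\<close> until clipping sets in, at
      distance at least \<open>\<eta>\<close> from \<open>f q\<close>. So \<open>h\<close> has size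
      at least \<open>2 * c\<close> outside the \<open>\<epsilon>\<close>-ball, and half of it is
      left to outweigh \<open>\<omega>\<close>.\<close>
    define c where "c = min (u * \<epsilon>) \<eta> / 2"
    have c: "0 < c" unfolding c_def using u e eta by simp
    have hp: "2 * c \<le> h x" if "\<epsilon> \<le> x" for x
    proof -
      have "u * \<epsilon> \<le> u * x" "0 < u * \<epsilon>" using that u e by auto
      thus ?thesis unfolding h_def g_clip_def c_def using rho R0 eta by (auto simp: min_def)
    qed
    have hn: "h x \<le> - (2 * c)" if "x \<le> - \<epsilon>" for x
    proof -
      have "u * x \<le> - (u * \<epsilon>)" using mult_left_mono[OF that, of u] u by simp
      moreover have "0 < u * \<epsilon>" using u e by simp
      ultimately show ?thesis unfolding h_def g_clip_def c_def using rho R0 eta by (auto simp: min_def)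
    qed
    have "eventually (\<lambda>k. W k < min c 1) sequentially" using W0 c by (intro order_tendstoD) auto
    moreover have "eventually (\<lambda>k. \<alpha> k i < \<epsilon> / (C0 + 1)) sequentially"
      using e C0(1) by (intro order_tendstoD(2)[OF al_lim]) simp
    ultimately have "eventually (\<lambda>k. (\<epsilon> \<le> \<bar>y k $ i\<bar> \<longrightarrow> \<bar>y (Suc k) $ i\<bar> \<le> \<bar>y k $ i\<bar> - c * \<alpha> k i)
        \<and> (\<bar>y k $ i\<bar> < \<epsilon> \<longrightarrow> \<bar>y (Suc k) $ i\<bar> \<le> 2 * \<epsilon>)) sequentially"
    proof eventually_elim
      case (elim k)
      define X where "X = y k $ i"
      define D where "D = \<alpha> k i * (- h X + \<omega> k)"
      have y': "y (Suc k) $ i = X + D" unfolding ys X_def D_def by simp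
      have wc: "\<bar>\<omega> k\<bar> \<le> c" "\<bar>\<omega> k\<bar> \<le> 1" using W[of k] elim by auto
      have "\<bar>- h X + \<omega> k\<bar> \<le> C0 + 1" using wc hb[of X] by linarith
      hence "\<bar>D\<bar> \<le> \<alpha> k i * (C0 + 1)" unfolding D_def abs_mult using al0 by (simp add: mult_left_mono)
      also have "\<dots> \<le> \<epsilon>" using elim C0(1) by (simp add: pos_less_divide_eq less_imp_le)
      finally have D: "\<bar>D\<bar> \<le> \<epsilon>" .
      have pos: "D \<le> - (c * \<alpha> k i)" if "\<epsilon> \<le> X"
      proof -
        have "\<alpha> k i * (- h X + \<omega> k) \<le> \<alpha> k i * (- c)" using hp[OF that] wc al0 by (intro mult_left_mono) auto
        thus ?thesis unfolding D_def by (simp add: mult.commute)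
      qed
      have neg: "c * \<alpha> k i \<le> D" if "X \<le> - \<epsilon>"
      proof -
        have "\<alpha> k i * c \<le> \<alpha> k i * (- h X + \<omega> k)" using hn[OF that] wc al0 by (intro mult_left_mono) auto
        thus ?thesis unfolding D_def by (simp add: mult.commute)
      qed
      have "0 \<le> c * \<alpha> k i" using c al0 by simp
      thus ?case unfolding y' X_def[symmetric] using D pos neg e by (auto simp: abs_if split: if_splits)
    qed
    thus "\<exists>c>0. eventually (\<lambda>k. (\<epsilon> \<le> \<bar>y k $ i\<bar> \<longrightarrow> \<bar>y (Suc k) $ i\<bar> \<le> \<bar>y k $ i\<bar> - c * \<alpha> k i)
        \<and> (\<bar>y k $ i\<bar> < \<epsilon> \<longrightarrow> \<bar>y (Suc k) $ i\<bar> \<le> 2 * \<epsilon>)) sequentially"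
      using c by blast
  qed
  thus ?thesis by (rule tendsto_rabs_zero_cancel)
qed

theorem path_convergence: "Q \<longlonglongrightarrow> q \<and> \<xi> \<longlonglongrightarrow> f q"
proof -
  have "y \<longlonglongrightarrow> 0" by (rule vec_tendstoI) (simp add: y_component_lim)
  hence "(\<lambda>k. q + y k + N k) \<longlonglongrightarrow> q + 0 + 0"
    by (intro tendsto_add tendsto_const tendsto_norm_zero_cancel[OF N_lim])
  hence Q: "Q \<longlonglongrightarrow> q" unfolding Q_eq[symmetric] by simp
  have "(\<lambda>k. f (q + y k) - f q) \<longlonglongrightarrow> 0"
  proof (rule Lim_null_comparison)
    show "eventually (\<lambda>k. norm (f (q + y k) - f q) \<le> L * norm (y k)) sequentially"
      using f_lip[of "q + y k" q for k] by (intro always_eventually) simp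
    show "(\<lambda>k. L * norm (y k)) \<longlonglongrightarrow> 0"
      by (rule tendsto_mult_right_zero) (rule tendsto_norm_zero[OF \<open>y \<longlonglongrightarrow> 0\<close>])
  qed
  hence "(\<lambda>k. (\<xi> k - f (q + y k)) + (f (q + y k) - f q) + f q) \<longlonglongrightarrow> 0 + 0 + f q"
    by (intro tendsto_add xi_f_lim tendsto_const)
  thus ?thesis using Q by simp
qed

end

section \<open>Step sizes of asynchronous updates\<close>

lemma floor_right_constant:
  fixes x :: real
  shows "\<exists>e>0. \<forall>y. x \<le> y \<longrightarrow> y < x + e \<longrightarrow> \<lfloor>y * real k\<rfloor> = \<lfloor>x * real k\<rfloor>"
proof -
  define e where "e = (of_int \<lfloor>x * real k\<rfloor> + 1 - x * real k) / (real k + 1)"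
  have pos: "0 < of_int \<lfloor>x * real k\<rfloor> + 1 - x * real k" by linarith
  hence e: "0 < e" unfolding e_def by simp
  show ?thesis
  proof (intro exI[of _ e] conjI allI impI e)
    fix y assume y: "x \<le> y" "y < x + e"
    have "x * real k \<le> y * real k" using y by (intro mult_right_mono) auto
    moreover have "y * real k < of_int \<lfloor>x * real k\<rfloor> + 1"
    proof -
      have "y * real k \<le> (x + e) * real k" using y by (intro mult_right_mono) auto
      also have "\<dots> < x * real k + e * (real k + 1)" using e by (simp add: algebra_simps)
      also have "e * (real k + 1) = of_int \<lfloor>x * real k\<rfloor> + 1 - x * real k" unfolding e_def by simp
      finally show ?thesis by simp
    qed
    ultimately show "\<lfloor>y * real k\<rfloor> = \<lfloor>x * real k\<rfloor>"
      by (intro floor_unique) (linarith | simp)+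
  qed
qed

text \<open>The bound on \<open>b (\<lfloor>x k\<rfloor>) / b k\<close> is assumed for each \<open>x\<close> separately; Baire's theorem, applied to the
  sets where the bound exceeds \<open>n\<close> (which are open to the right), makes it uniform on some interval.\<close>

lemma ratio_bound_on_interval:
  fixes b :: "nat \<Rightarrow> real"
  assumes bd: "\<And>x. 0 < x \<Longrightarrow> x < 1 \<Longrightarrow> bdd_above (range (\<lambda>k. b (nat \<lfloor>x * real k\<rfloor>) / b k))"
    and lh: "0 < l" "l < h" "h < 1"
  shows "\<exists>\<alpha> \<beta> C. l \<le> \<alpha> \<and> \<alpha> < \<beta> \<and> \<beta> \<le> h \<and> (\<forall>x k. \<alpha> \<le> x \<longrightarrow> x < \<beta> \<longrightarrow> b (nat \<lfloor>x * real k\<rfloor>) / b k \<le> C)"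
proof (rule ccontr)
  assume neg: "\<not> ?thesis"
  define bad where "bad n x \<longleftrightarrow> (\<exists>k. b (nat \<lfloor>x * real k\<rfloor>) / b k > real n)" for n and x :: real
  have ex_bad: "\<exists>x. \<alpha> \<le> x \<and> x < \<beta> \<and> bad n x" if "l \<le> \<alpha>" "\<alpha> < \<beta>" "\<beta> \<le> h" for \<alpha> \<beta> n
    using neg that unfolding bad_def by (meson not_le)
  have right: "\<exists>e>0. \<forall>y. x \<le> y \<longrightarrow> y < x + e \<longrightarrow> bad n y" if bx: "bad n x" for n x
  proof -
    obtain k where k: "b (nat \<lfloor>x * real k\<rfloor>) / b k > real n" using bx unfolding bad_def by blast
    obtain e where e: "e > 0" "\<And>y. x \<le> y \<Longrightarrow> y < x + e \<Longrightarrow> \<lfloor>y * real k\<rfloor> = \<lfloor>x * real k\<rfloor>"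
      using floor_right_constant[of x k] by blast
    have "bad n y" if y: "x \<le> y" "y < x + e" for y
      unfolding bad_def using k unfolding e(2)[OF y, symmetric] by blast
    thus ?thesis using e(1) by blast
  qed
  \<comment> \<open>Bad points occur in every subinterval, and each has a bad interval to its right;
    hence the interior of the bad set is dense in \<open>{l..h}\<close>. A point common to all these
    sets would have unbounded ratios.\<close>
  define U where "U n = {l..h} \<inter> interior {x. bad n x}" for n
  have dense: "{l..h} \<subseteq> closure (U n)" for n
  proof
    fix x assume x: "x \<in> {l..h}"
    show "x \<in> closure (U n)" unfolding closure_approachable
    proof (intro allI impI)
      fix e :: real assume e: "e > 0"
      define \<alpha> where "\<alpha> = max l (x - e / 2)"
      define \<beta> where "\<beta> = min h (x + e / 2)"
      have ab: "l \<le> \<alpha>" "\<alpha> < \<beta>" "\<beta> \<le> h" unfolding \<alpha>_def \<beta>_def using x e lh by auto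
      obtain z where z: "\<alpha> \<le> z" "z < \<beta>" "bad n z" using ex_bad[OF ab] by blast
      obtain e' where e': "e' > 0" "\<And>y. z \<le> y \<Longrightarrow> y < z + e' \<Longrightarrow> bad n y" using right[OF z(3)] by blast
      define d where "d = min e' (\<beta> - z)"
      have d: "0 < d" unfolding d_def using e' z by simp
      have "{z<..<z + d} \<subseteq> interior {x. bad n x}"
        by (rule interior_maximal) (use e' in \<open>auto simp: d_def\<close>)
      moreover have "z + d / 2 \<in> {z<..<z + d}" using d by simp
      moreover have "d \<le> \<beta> - z" unfolding d_def by simp
      hence "z + d / 2 \<le> \<beta>" using d by linarith
      ultimately have "z + d / 2 \<in> U n" unfolding U_def using z ab d by auto
      moreover have "dist (z + d / 2) x < e"
        using \<open>z + d / 2 \<le> \<beta>\<close> z(1) d e unfolding \<alpha>_def \<beta>_def dist_real_def by (auto simp: abs_less_iff)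
      ultimately show "\<exists>y\<in>U n. dist y x < e" by blast
    qed
  qed
  have "{l..h} \<subseteq> closure (\<Inter> (range U))"
  proof (rule Baire)
    fix T assume "T \<in> range U"
    then obtain n where T: "T = U n" by blast
    have "openin (top_of_set {l..h}) (U n)" unfolding U_def by (rule openin_open_Int) simp
    thus "openin (top_of_set {l..h}) T \<and> {l..h} \<subseteq> closure T" using dense[of n] T by simp
  qed auto
  hence "closure (\<Inter> (range U)) \<noteq> {}" using lh by auto
  then obtain x where x: "\<And>n. x \<in> U n" by auto
  have badx: "bad n x" for n using x[of n] interior_subset unfolding U_def by blast
  have "x \<in> {l..h}" using x[of 0] unfolding U_def by simp
  then obtain B where B: "\<And>k. b (nat \<lfloor>x * real k\<rfloor>) / b k \<le> B"
    using bd[of x] lh unfolding bdd_above_def by auto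
  obtain n where "B < real n" using reals_Archimedean2 by blast
  thus False using badx[of n] B unfolding bad_def by (meson less_trans not_le)
qed

text \<open>The way from \<open>k\<close> to \<open>m = v * k\<close> is split into two jumps: from
  \<open>k\<close> to \<open>k' = \<lfloor>z * k\<rfloor>\<close> with \<open>z\<close> from a
  finite grid, and from \<open>k'\<close> to \<open>m\<close> with \<open>m / k'\<close> in the
  interval where the bound is already uniform. That interval is placed so close to \<open>1\<close>
  that \<open>z\<close> stays below \<open>1\<close>.\<close>

lemma ratio_bound_uniform:
  fixes b :: "nat \<Rightarrow> real"
  assumes pos: "\<And>k. 0 < b k"
    and bd: "\<And>x. 0 < x \<Longrightarrow> x < 1 \<Longrightarrow> bdd_above (range (\<lambda>k. b (nat \<lfloor>x * real k\<rfloor>) / b k))"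
    and d: "0 < \<delta>" "\<delta> < 1"
  shows "\<exists>C K. \<forall>k\<ge>K. \<forall>m. \<delta> * real k \<le> real m \<longrightarrow> real m \<le> (1 - \<delta>) * real k \<longrightarrow> b m \<le> C * b k"
proof -
  have "\<exists>\<alpha> \<beta> C. 1 - \<delta> / 2 \<le> \<alpha> \<and> \<alpha> < \<beta> \<and> \<beta> \<le> 1 - \<delta> / 4 \<and>
      (\<forall>x k. \<alpha> \<le> x \<longrightarrow> x < \<beta> \<longrightarrow> b (nat \<lfloor>x * real k\<rfloor>) / b k \<le> C)"
    by (rule ratio_bound_on_interval[OF bd]) (use d in auto)
  then obtain \<alpha> \<beta> C where ab: "1 - \<delta> / 2 \<le> \<alpha>" "\<alpha> < \<beta>" "\<beta> \<le> 1 - \<delta> / 4"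
    and C: "\<And>x k. \<alpha> \<le> x \<Longrightarrow> x < \<beta> \<Longrightarrow> b (nat \<lfloor>x * real k\<rfloor>) / b k \<le> C"
    by blast
  have a0: "0 < \<alpha>" "0 < \<beta>" "\<beta> < 1" using ab d by auto
  \<comment> \<open>The suitable \<open>z\<close> lie between \<open>v / \<beta>\<close> and
    \<open>v / \<alpha>\<close>, a distance of at least \<open>w\<close> because
    \<open>v \<ge> \<delta>\<close>. The mesh \<open>w / 4\<close> and the condition
    \<open>2 / w < k\<close> leave room for the rounding of \<open>k'\<close>.\<close>
  define w where "w = \<delta> * (1 / \<alpha> - 1 / \<beta>)"
  have "1 / \<beta> < 1 / \<alpha>" using ab a0 by (simp add: frac_less2)
  hence w: "0 < w" unfolding w_def using d by simp
  define G where "G = {z. \<exists>j::nat. z = real j * (w / 4) \<and> real j * (w / 4) < 1}"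
  have "G \<subseteq> (\<lambda>j. real j * (w / 4)) ` {..nat \<lceil>4 / w\<rceil>}"
  proof
    fix z assume "z \<in> G"
    then obtain j :: nat where j: "z = real j * (w / 4)" "real j * (w / 4) < 1" unfolding G_def by blast
    have "real j < 4 / w" using j(2) w by (simp add: pos_less_divide_eq)
    hence "j \<le> nat \<lceil>4 / w\<rceil>" by linarith
    thus "z \<in> (\<lambda>j. real j * (w / 4)) ` {..nat \<lceil>4 / w\<rceil>}" using j by auto
  qed
  hence finG: "finite G" by (rule finite_subset) auto
  have "\<forall>z. \<exists>B. z \<in> G \<and> 0 < z \<longrightarrow> (\<forall>k. b (nat \<lfloor>z * real k\<rfloor>) / b k \<le> B)"
  proof
    fix z
    show "\<exists>B. z \<in> G \<and> 0 < z \<longrightarrow> (\<forall>k. b (nat \<lfloor>z * real k\<rfloor>) / b k \<le> B)"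
    proof (cases "z \<in> G \<and> 0 < z")
      case True
      hence "z < 1" unfolding G_def by auto
      thus ?thesis using bd[of z] True unfolding bdd_above_def by auto
    qed auto
  qed
  then obtain B where B: "\<forall>z. z \<in> G \<and> 0 < z \<longrightarrow> (\<forall>k. b (nat \<lfloor>z * real k\<rfloor>) / b k \<le> B z)"
    by (rule choice[THEN exE])
  define D where "D = (\<Sum>z\<in>G. \<bar>B z\<bar>)"
  have D: "b (nat \<lfloor>z * real k\<rfloor>) \<le> D * b k" if "z \<in> G" "0 < z" for z k
  proof -
    have "b (nat \<lfloor>z * real k\<rfloor>) / b k \<le> B z" using B that by blast
    also have "\<dots> \<le> \<bar>B z\<bar>" by simp
    also have "\<dots> \<le> D" unfolding D_def using finG that by (intro member_le_sum) auto
    finally show ?thesis using pos[of k] by (simp add: pos_divide_le_eq)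
  qed
  have C': "b (nat \<lfloor>x * real k\<rfloor>) \<le> C * b k" if "\<alpha> \<le> x" "x < \<beta>" for x k
    using C[OF that, of k] pos[of k] by (simp add: pos_divide_le_eq)
  have C0: "0 \<le> C" using C'[of \<alpha> 0] ab pos[of 0] pos[of "nat \<lfloor>\<alpha> * real 0\<rfloor>"] by (smt (verit) mult_neg_pos)
  show ?thesis
  proof (intro exI[of _ "C * D"] exI[of _ "nat \<lceil>2 / w\<rceil> + 1"] allI impI)
    fix k m assume k: "nat \<lceil>2 / w\<rceil> + 1 \<le> k" and m: "\<delta> * real k \<le> real m" "real m \<le> (1 - \<delta>) * real k"
    have k0: "0 < real k" using k by simp
    have "2 / w < real k" using k by linarith
    hence kw: "2 < w * real k" using w by (simp add: pos_divide_less_eq mult.commute)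
    define v where "v = real m / real k"
    have v: "\<delta> \<le> v" "v \<le> 1 - \<delta>" unfolding v_def using m k0 by (auto simp: pos_le_divide_eq pos_divide_le_eq)
    have mv: "real m = v * real k" unfolding v_def using k0 by simp
    define j where "j = nat \<lfloor>(v / \<alpha>) / (w / 4)\<rfloor>"
    define z where "z = real j * (w / 4)"
    have "0 \<le> (v / \<alpha>) / (w / 4)" using v d a0 w by simp
    hence j: "real j \<le> (v / \<alpha>) / (w / 4)" "(v / \<alpha>) / (w / 4) < real j + 1" unfolding j_def by linarith+
    have z1: "z \<le> v / \<alpha>" using mult_right_mono[OF j(1), of "w/4"] w unfolding z_def by simp
    have w4: "0 < w / 4" using w by simp
    have z2: "v / \<alpha> < z + w / 4"
      using j(2)[unfolded pos_divide_less_eq[OF w4]] unfolding z_def distrib_right by linarith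
    have "v / \<alpha> < 1" using v(2) ab(1) a0 d by (simp add: pos_divide_less_eq)
    hence "z < 1" using z1 by linarith
    hence zG: "z \<in> G" unfolding G_def z_def by blast
    have "v * (1 / \<alpha> - 1 / \<beta>) \<ge> w" unfolding w_def using v \<open>1 / \<beta> < 1 / \<alpha>\<close> by (intro mult_right_mono) auto
    hence vb: "v / \<beta> + w \<le> v / \<alpha>" by (simp add: right_diff_distrib)
    have v0: "0 \<le> v / \<beta>" using v d a0 by simp
    have z0: "0 < z" using vb z2 v0 w by linarith
    define k' where "k' = nat \<lfloor>z * real k\<rfloor>"
    have "0 \<le> z * real k" using z0 by simp
    hence k': "real k' \<le> z * real k" "z * real k < real k' + 1" unfolding k'_def by linarith+
    have "z * real k \<le> v / \<alpha> * real k" using z1 by (intro mult_right_mono) auto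
    hence "real k' \<le> v / \<alpha> * real k" using k' by linarith
    hence "real k' * \<alpha> \<le> v / \<alpha> * real k * \<alpha>" using a0 by (intro mult_right_mono) auto
    hence up: "real k' * \<alpha> \<le> real m" unfolding mv using a0 by simp
    have "(v / \<beta> + 3/4 * w) * real k \<le> z * real k" using vb z2 by (intro mult_right_mono) auto
    hence "v / \<beta> * real k + 3/4 * (w * real k) \<le> z * real k" by (simp add: distrib_right)
    hence lo: "v / \<beta> * real k < real k'" using k' kw by linarith
    hence k'0: "0 < real k'" using v0 by (smt (verit) mult_nonneg_nonneg of_nat_0_le_iff)
    have "v / \<beta> * real k * \<beta> < real k' * \<beta>" using lo a0 by (intro mult_strict_right_mono) auto
    hence lo': "real m < real k' * \<beta>" unfolding mv using a0 by simp
    define x where "x = real m / real k'"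
    have x: "\<alpha> \<le> x" "x < \<beta>" unfolding x_def using up lo' k'0 by (auto simp: pos_le_divide_eq pos_divide_less_eq mult.commute)
    have "nat \<lfloor>x * real k'\<rfloor> = m" unfolding x_def using k'0 by simp
    hence "b m \<le> C * b k'" using C'[OF x, of k'] by simp
    also have "\<dots> \<le> C * (D * b k)" using D[OF zG z0, of k] C0 unfolding k'_def by (intro mult_left_mono)
    finally show "b m \<le> C * D * b k" by (simp add: mult.assoc)
  qed
qed

lemma cesaro_mean:
  fixes d :: "nat \<Rightarrow> real"
  assumes "d \<longlonglongrightarrow> \<mu>"
  shows "(\<lambda>t. (\<Sum>s<t. d s) / real t) \<longlonglongrightarrow> \<mu>"
proof -
  define x where "x t = (\<Sum>s<t. d s) / real t" for t
  have "(\<lambda>t. x t - \<mu>) \<longlonglongrightarrow> 0"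
  proof (rule averaging_tracks[where \<alpha>="\<lambda>t. 1 / real (Suc t)" and \<epsilon>="\<lambda>t. \<bar>d t - \<mu>\<bar>"])
    show "(\<lambda>t. 1 / real (Suc t)) \<longlonglongrightarrow> 0" by (rule LIMSEQ_Suc[OF lim_1_over_n])
    show "\<not> summable (\<lambda>t. 1 / real (Suc t))"
      using not_summable_harmonic[where 'a=real] summable_Suc_iff[of "\<lambda>t. 1 / real t"] by (simp add: inverse_eq_divide)
    show "(\<lambda>t. \<bar>d t - \<mu>\<bar>) \<longlonglongrightarrow> 0" using assms by (simp add: LIM_zero tendsto_rabs_zero)
    show "eventually (\<lambda>t. \<bar>x (Suc t) - \<mu>\<bar> \<le> (1 - 1 / real (Suc t)) * \<bar>x t - \<mu>\<bar> + 1 / real (Suc t) * \<bar>d t - \<mu>\<bar>) sequentially"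
      using eventually_gt_at_top[of 0]
    proof eventually_elim
      case (elim t)
      define c where "c = 1 / real (Suc t)"
      have c: "0 \<le> c" "c \<le> 1" unfolding c_def by auto
      have "1 - c = real t * c" unfolding c_def by (simp add: field_simps)
      hence "(1 - c) * x t = c * (\<Sum>s<t. d s)" unfolding x_def using elim by simp
      moreover have "x (Suc t) = c * (\<Sum>s<t. d s) + c * d t" unfolding x_def c_def by (simp add: add_divide_distrib)
      ultimately have "x (Suc t) - \<mu> = (1 - c) * (x t - \<mu>) + c * (d t - \<mu>)" by (simp add: algebra_simps)
      also have "\<bar>\<dots>\<bar> \<le> (1 - c) * \<bar>x t - \<mu>\<bar> + c * \<bar>d t - \<mu>\<bar>"
        by (rule order_trans[OF abs_triangle_ineq]) (use c in \<open>simp add: abs_mult\<close>)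
      finally show ?case unfolding c_def .
    qed
  qed simp
  thus ?thesis unfolding x_def by (rule LIM_zero_cancel)
qed

section \<open>Visit counts and the steps of single components\<close>

definition cnt :: "(nat \<Rightarrow> 'i) \<Rightarrow> nat \<Rightarrow> 'i \<Rightarrow> nat" where
  "cnt \<phi> n i = card {m. m < n \<and> \<phi> m = i}"

text \<open>Shift by one: \<open>visits\<close> at \<open>k\<close> includes time \<open>k\<close>,
  while \<open>cnt\<close> at \<open>n\<close> stops before \<open>n\<close> and so starts from
  \<open>0\<close>, which suits induction.\<close>

lemma visits_eq_cnt: "visits \<phi> k \<omega> i = cnt (\<lambda>m. \<phi> m \<omega>) (Suc k) i"
  unfolding visits_def cnt_def by (simp add: less_Suc_eq_le)

lemma cnt_0 [simp]: "cnt \<phi> 0 i = 0"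
  unfolding cnt_def by simp

lemma cnt_Suc: "cnt \<phi> (Suc n) i = cnt \<phi> n i + (if \<phi> n = i then 1 else 0)"
proof -
  have "{m. m < Suc n \<and> \<phi> m = i} = (if \<phi> n = i then insert n {m. m < n \<and> \<phi> m = i} else {m. m < n \<and> \<phi> m = i})"
    by (auto simp: less_Suc_eq)
  thus ?thesis unfolding cnt_def by simp
qed

lemma cnt_mono: "m \<le> n \<Longrightarrow> cnt \<phi> m i \<le> cnt \<phi> n i"
  unfolding cnt_def by (intro card_mono) auto

lemma cnt_le: "cnt \<phi> n i \<le> n"
  by (induction n) (auto simp: cnt_Suc)

lemma sum_cnt: "(\<Sum>i\<in>(UNIV::'i::finite set). cnt \<phi> n i) = n"
  by (induction n) (auto simp: cnt_Suc sum.distrib)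

text \<open>A sum over time becomes a sum over visit numbers. The count includes the current update,
  so the first step of a component has number \<open>1\<close>.\<close>

lemma sum_over_visits:
  fixes h :: "nat \<Rightarrow> real"
  shows "(\<Sum>k<n. if i = \<phi> k then h (cnt \<phi> (Suc k) i) else 0) = (\<Sum>m=1..cnt \<phi> n i. h m)"
  by (induction n) (auto simp: cnt_Suc)

lemma square_summable_imp_null:
  fixes b :: "nat \<Rightarrow> real"
  assumes "summable (\<lambda>k. (b k)\<^sup>2)"
  shows "b \<longlonglongrightarrow> 0"
proof -
  have "(\<lambda>k. sqrt ((b k)\<^sup>2)) \<longlonglongrightarrow> sqrt 0" by (rule tendsto_real_sqrt[OF summable_LIMSEQ_zero[OF assms]])
  hence "(\<lambda>k. \<bar>b k\<bar>) \<longlonglongrightarrow> 0" by simp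
  thus ?thesis by (rule tendsto_rabs_zero_cancel)
qed

definition astep :: "(nat \<Rightarrow> real) \<Rightarrow> (nat \<Rightarrow> 'i) \<Rightarrow> nat \<Rightarrow> 'i \<Rightarrow> real" where
  "astep b \<phi> k i = (if i = \<phi> k then b (cnt \<phi> (Suc k) i) else 0)"

definition bstep :: "(nat \<Rightarrow> real) \<Rightarrow> (nat \<Rightarrow> 'i) \<Rightarrow> nat \<Rightarrow> real" where
  "bstep b \<phi> k = b (cnt \<phi> (Suc k) (\<phi> k))"

lemma sum_astep: "(\<Sum>i\<in>(UNIV::'i::finite set). astep b \<phi> k i) = bstep b \<phi> k"
  unfolding astep_def bstep_def by simp

lemma sum_astep_eq: "(\<Sum>k<n. astep b \<phi> k i) = (\<Sum>m=1..cnt \<phi> n i. b m)"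
  unfolding astep_def by (rule sum_over_visits)

lemma sum_astep_square: "(\<Sum>k<n. (astep b \<phi> k i)\<^sup>2) = (\<Sum>m=1..cnt \<phi> n i. (b m)\<^sup>2)"
proof -
  have "(\<Sum>k<n. (astep b \<phi> k i)\<^sup>2) = (\<Sum>k<n. if i = \<phi> k then (b (cnt \<phi> (Suc k) i))\<^sup>2 else 0)"
    unfolding astep_def by (intro sum.cong) auto
  also have "\<dots> = (\<Sum>m=1..cnt \<phi> n i. (b m)\<^sup>2)" by (rule sum_over_visits[where h="\<lambda>m. (b m)\<^sup>2"])
  finally show ?thesis .
qed

locale async_steps =
  fixes \<phi> :: "nat \<Rightarrow> 'i::finite" and b :: "nat \<Rightarrow> real" and \<Delta> :: real and K0 :: nat
  assumes b_pos: "\<And>k. 0 < b k" and step: "stepsize_cond b" and D0: "0 < \<Delta>"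
    and freq: "\<And>n i. K0 \<le> n \<Longrightarrow> \<Delta> * real n \<le> real (cnt \<phi> n i)"
begin

abbreviation "\<alpha> \<equiv> astep b \<phi>"
abbreviation "\<beta> \<equiv> bstep b \<phi>"

lemma al0: "0 \<le> \<alpha> k i" unfolding astep_def using b_pos less_imp_le by auto
lemma be_pos: "0 < \<beta> k" unfolding bstep_def by (rule b_pos)
lemma al_le: "\<alpha> k i \<le> \<beta> k"
  unfolding astep_def bstep_def using b_pos less_imp_le by auto

lemma b_null: "b \<longlonglongrightarrow> 0"
  by (rule square_summable_imp_null) (use step in \<open>simp add: stepsize_cond_def\<close>)

lemma D1: "\<Delta> \<le> 1"
proof -
  have "\<Delta> * real (Suc K0) \<le> real (cnt \<phi> (Suc K0) undefined)" by (rule freq) simp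
  also have "\<dots> \<le> 1 * real (Suc K0)" using cnt_le[of \<phi> "Suc K0" undefined] by simp
  finally show ?thesis by (simp only: mult_le_cancel_right_pos[of "real (Suc K0)"] of_nat_0_less_iff zero_less_Suc)
qed

lemma cnt_top: "filterlim (\<lambda>n. cnt \<phi> n i) at_top sequentially"
  unfolding filterlim_at_top
proof
  fix Z :: nat
  have "eventually (\<lambda>n. real Z / \<Delta> \<le> real n) sequentially"
    using filterlim_real_sequentially unfolding filterlim_at_top by blast
  thus "eventually (\<lambda>n. Z \<le> cnt \<phi> n i) sequentially" using eventually_ge_at_top[of K0]
  proof eventually_elim
    case (elim n)
    have "real Z \<le> \<Delta> * real n" using elim D0 by (simp add: pos_divide_le_eq mult.commute)
    thus ?case using freq[OF elim(2), of i] by linarith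
  qed
qed

lemma b_cnt_null: "(\<lambda>n. b (cnt \<phi> n i)) \<longlonglongrightarrow> 0"
  using filterlim_compose[OF b_null cnt_top] .

lemma be_lim: "\<beta> \<longlonglongrightarrow> 0"
proof (rule Lim_null_comparison)
  show "eventually (\<lambda>k. norm (\<beta> k) \<le> (\<Sum>i\<in>UNIV. b (cnt \<phi> (Suc k) i))) sequentially"
  proof (intro always_eventually allI)
    fix k
    have "\<beta> k \<le> (\<Sum>i\<in>UNIV. b (cnt \<phi> (Suc k) i))" unfolding bstep_def
      by (rule member_le_sum) (auto intro: less_imp_le b_pos)
    thus "norm (\<beta> k) \<le> (\<Sum>i\<in>UNIV. b (cnt \<phi> (Suc k) i))" using be_pos[of k] by simp
  qed
  show "(\<lambda>k. \<Sum>i\<in>UNIV. b (cnt \<phi> (Suc k) i)) \<longlonglongrightarrow> 0"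
    by (rule tendsto_null_sum) (rule LIMSEQ_Suc[OF b_cnt_null])
qed

definition "C n = (\<Sum>m\<le>n. b m)"

lemma C_pos: "0 < C n" unfolding C_def by (rule sum_pos) (auto simp: b_pos)

lemma C_cnt: "C (cnt \<phi> n i) = b 0 + (\<Sum>k<n. \<alpha> k i)"
  unfolding C_def sum_astep_eq by (simp add: sum.atMost_shift sum.atLeast1_atMost_eq lessThan_Suc_atMost)

lemma C_top: "filterlim C at_top sequentially"
  unfolding filterlim_at_top
proof
  fix Z :: real
  have "\<exists>n. Z < (\<Sum>m<n. b m)"
  proof (rule ccontr)
    assume "\<not> ?thesis"
    hence "(\<Sum>m<n. b m) \<le> Z" for n by (meson not_le)
    hence "summable b" using b_pos less_imp_le by (intro summableI_nonneg_bounded) auto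
    thus False using step unfolding stepsize_cond_def by blast
  qed
  then obtain n where n: "Z < (\<Sum>m<n. b m)" by blast
  show "eventually (\<lambda>n. Z \<le> C n) sequentially" unfolding eventually_sequentially
  proof (intro exI[of _ n] allI impI)
    fix k assume "n \<le> k"
    hence "(\<Sum>m<n. b m) \<le> C k" unfolding C_def using b_pos less_imp_le by (intro sum_mono2) auto
    thus "Z \<le> C k" using n by linarith
  qed
qed

lemma C_cnt_top: "filterlim (\<lambda>n. C (cnt \<phi> n i)) at_top sequentially"
  using filterlim_compose[OF C_top cnt_top] .

lemma al_div: "\<not> summable (\<lambda>k. \<alpha> k i)"
proof
  assume "summable (\<lambda>k. \<alpha> k i)"
  hence "(\<Sum>k<n. \<alpha> k i) \<le> (\<Sum>k. \<alpha> k i)" for n by (intro sum_le_suminf) (auto simp: al0)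
  hence le: "C (cnt \<phi> n i) \<le> b 0 + (\<Sum>k. \<alpha> k i)" for n unfolding C_cnt by simp
  have "eventually (\<lambda>n. b 0 + (\<Sum>k. \<alpha> k i) + 1 \<le> C (cnt \<phi> n i)) sequentially"
    using C_cnt_top[of i] unfolding filterlim_at_top by simp
  then obtain n where "b 0 + (\<Sum>k. \<alpha> k i) + 1 \<le> C (cnt \<phi> n i)"
    unfolding eventually_sequentially by blast
  thus False using le[of n] by simp
qed

lemma be_div: "\<not> summable \<beta>"
proof
  assume "summable \<beta>"
  hence "summable (\<lambda>k. \<alpha> k undefined)"
    by (rule summable_comparison_test'[where N=0]) (simp add: al0 al_le)
  thus False using al_div by blast
qed

text \<open>Each count is a fraction of \<open>n\<close> bounded away from \<open>0\<close>, so each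
  sum is asymptotically \<open>C n\<close> by the uniform step-size condition, whatever the fraction
  does.\<close>

lemma C_ratio: "(\<lambda>n. C (cnt \<phi> n i) / C (cnt \<phi> n j)) \<longlonglongrightarrow> 1"
proof -
  have one: "(\<lambda>n. C (cnt \<phi> n i) / C n) \<longlonglongrightarrow> 1" for i
  proof -
    \<comment> \<open>Halved because \<open>\<Delta>\<close> may equal \<open>1\<close>, whereas the
      step-size condition asks for \<open>x < 1\<close>.\<close>
    define x where "x = \<Delta> / 2"
    have x: "0 < x" "x < 1" unfolding x_def using D0 D1 by auto
    have ul: "uniform_limit {x..1} (\<lambda>k y. (\<Sum>i\<le>nat \<lfloor>y * real k\<rfloor>. b i) / (\<Sum>i\<le>k. b i)) (\<lambda>_. 1) sequentially"
      using step x unfolding stepsize_cond_def by blast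
    show ?thesis
    proof (rule tendstoI)
      fix e :: real assume e: "e > 0"
      have "eventually (\<lambda>k. \<forall>y\<in>{x..1}. dist ((\<Sum>i\<le>nat \<lfloor>y * real k\<rfloor>. b i) / (\<Sum>i\<le>k. b i)) 1 < e) sequentially"
        using ul e unfolding uniform_limit_iff by blast
      thus "eventually (\<lambda>n. dist (C (cnt \<phi> n i) / C n) 1 < e) sequentially"
        using eventually_ge_at_top[of K0] eventually_gt_at_top[of 0]
      proof eventually_elim
        case (elim k)
        define y where "y = real (cnt \<phi> k i) / real k"
        have "\<Delta> \<le> y" unfolding y_def using freq[OF elim(2), of i] elim(3) by (simp add: pos_le_divide_eq)
        moreover have "y \<le> 1" unfolding y_def using cnt_le[of \<phi> k i] elim(3) by (simp add: pos_divide_le_eq)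
        ultimately have "y \<in> {x..1}" unfolding x_def using D0 by simp
        moreover have "nat \<lfloor>y * real k\<rfloor> = cnt \<phi> k i" unfolding y_def using elim(3) by simp
        ultimately show ?case using elim(1) unfolding C_def by fastforce
      qed
    qed
  qed
  have "(\<lambda>n. (C (cnt \<phi> n i) / C n) / (C (cnt \<phi> n j) / C n)) \<longlonglongrightarrow> 1 / 1"
    by (intro tendsto_divide one) simp
  moreover have "(C (cnt \<phi> n i) / C n) / (C (cnt \<phi> n j) / C n) = C (cnt \<phi> n i) / C (cnt \<phi> n j)" for n
    using C_pos[of n] by simp
  ultimately show ?thesis by (simp only: div_by_1)
qed

text \<open>With \<open>a k\<close> in place of \<open>a (Suc k)\<close> the case of a single index would fail to follow: then \<open>\<beta> k = b (Suc k)\<close>, and nothing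
  bounds \<open>b (Suc k) / b k\<close>. With two or more indices, \<open>cnt \<phi> (Suc k) (\<phi> k) / Suc k\<close> stays away from \<open>1\<close>.\<close>

lemma step_ratio:
  assumes a_pos: "\<And>k. 0 < a k" and ba: "(\<lambda>k. b k / a k) \<longlonglongrightarrow> 0"
  shows "(\<lambda>k. \<beta> k / a (Suc k)) \<longlonglongrightarrow> 0"
proof -
  have bd: "bdd_above (range (\<lambda>k. b (nat \<lfloor>x * real k\<rfloor>) / b k))" if "0 < x" "x < 1" for x
    using step that unfolding stepsize_cond_def by simp
  define \<delta> where "\<delta> = \<Delta> / 2"
  have d: "0 < \<delta>" "\<delta> < 1" "\<delta> \<le> \<Delta>" unfolding \<delta>_def using D0 D1 by auto
  obtain B K where B: "\<forall>k\<ge>K. \<forall>m. \<delta> * real k \<le> real m \<longrightarrow> real m \<le> (1 - \<delta>) * real k \<longrightarrow> b m \<le> B * b k"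
    using ratio_bound_uniform[OF b_pos bd d(1,2)] by blast
  have ev: "eventually (\<lambda>k. \<beta> k \<le> max 1 B * b (Suc k)) sequentially"
    using eventually_ge_at_top[of K0] eventually_ge_at_top[of K]
  proof eventually_elim
    case (elim k)
    define n where "n = Suc k"
    define m where "m = cnt \<phi> n (\<phi> k)"
    have n: "K0 \<le> n" "K \<le> n" unfolding n_def using elim by auto
    have "b m \<le> max 1 B * b n"
    proof (cases "\<exists>j. j \<noteq> \<phi> k")
      case True
      then obtain j where j: "j \<noteq> \<phi> k" by blast
      have "cnt \<phi> n (\<phi> k) + cnt \<phi> n j = (\<Sum>i\<in>{\<phi> k, j}. cnt \<phi> n i)" using j by simp
      also have "\<dots> \<le> (\<Sum>i\<in>UNIV. cnt \<phi> n i)" by (intro sum_mono2) auto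
      finally have "m + cnt \<phi> n j \<le> n" unfolding m_def sum_cnt .
      hence "real m \<le> real n - \<Delta> * real n" using freq[OF n(1), of j] by linarith
      moreover have "\<delta> * real n \<le> \<Delta> * real n" using d by (intro mult_right_mono) auto
      ultimately have "real m \<le> (1 - \<delta>) * real n" "\<delta> * real n \<le> real m"
        using freq[OF n(1), of "\<phi> k"] unfolding m_def by (auto simp: left_diff_distrib)
      hence "b m \<le> B * b n" using B n by blast
      also have "\<dots> \<le> max 1 B * b n" using b_pos[of n] by (intro mult_right_mono) auto
      finally show ?thesis .
    next
      case False
      hence U: "UNIV = {\<phi> k}" by auto
      have "m = (\<Sum>i\<in>{\<phi> k}. cnt \<phi> n i)" unfolding m_def by simp
      also have "\<dots> = n" unfolding U[symmetric] by (rule sum_cnt)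
      finally show ?thesis using mult_right_mono[of 1 "max 1 B" "b n"] b_pos[of n] by simp
    qed
    thus ?case unfolding bstep_def m_def n_def .
  qed
  show ?thesis
  proof (rule Lim_null_comparison)
    show "eventually (\<lambda>k. norm (\<beta> k / a (Suc k)) \<le> max 1 B * (b (Suc k) / a (Suc k))) sequentially"
      using ev
    proof eventually_elim
      case (elim k)
      have "\<beta> k / a (Suc k) \<le> max 1 B * b (Suc k) / a (Suc k)"
        using elim a_pos[of "Suc k"] by (intro divide_right_mono) auto
      thus ?case using be_pos[of k] a_pos[of "Suc k"] by simp
    qed
    show "(\<lambda>k. max 1 B * (b (Suc k) / a (Suc k))) \<longlonglongrightarrow> 0"
      by (rule tendsto_mult_right_zero[OF LIMSEQ_Suc[OF ba]])
  qed
qed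

definition "Np x k = (LEAST m. k < m \<and> x \<le> (\<Sum>l=Suc k..m. \<beta> l))"

lemma Np:
  assumes x: "0 < x"
  shows "k < Np x k" "x \<le> sum \<beta> {Suc k..<Suc (Np x k)}" "sum \<beta> {Suc k..<Suc (Np x k)} \<le> x + \<beta> (Np x k)"
proof -
  have "\<exists>m. k < m \<and> x \<le> (\<Sum>l=Suc k..m. \<beta> l)"
  proof (rule ccontr)
    assume neg: "\<not> ?thesis"
    have "(\<Sum>l<n. \<beta> (l + Suc k)) \<le> x" for n
    proof (cases n)
      case 0 thus ?thesis using x by simp
    next
      case (Suc n')
      have "\<not> (k < k + n \<and> x \<le> (\<Sum>l=Suc k..k + n. \<beta> l))" using neg by blast
      moreover have "k < k + n" using Suc by simp
      ultimately have "\<not> x \<le> (\<Sum>l=Suc k..k + n. \<beta> l)" by blast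
      moreover have "(\<Sum>l<n. \<beta> (l + Suc k)) = (\<Sum>l=Suc k..k + n. \<beta> l)"
        using sum.shift_bounds_nat_ivl[of \<beta> 0 "Suc k" n] by (simp add: atLeast0LessThan atLeastLessThanSuc_atLeastAtMost add.commute)
      ultimately show ?thesis by linarith
    qed
    hence "summable (\<lambda>l. \<beta> (l + Suc k))" using be_pos less_imp_le by (intro summableI_nonneg_bounded) blast+
    hence "summable \<beta>" using summable_iff_shift[of \<beta> "Suc k"] by blast
    thus False using be_div by blast
  qed
  from LeastI_ex[OF this] have L: "k < Np x k" "x \<le> (\<Sum>l=Suc k..Np x k. \<beta> l)" unfolding Np_def by auto
  show "k < Np x k" by fact
  show "x \<le> sum \<beta> {Suc k..<Suc (Np x k)}" using L by (simp add: atLeastLessThanSuc_atLeastAtMost)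
  obtain N' where N': "Np x k = Suc N'" using L(1) by (cases "Np x k") auto
  have "sum \<beta> {Suc k..<Suc N'} \<le> x"
  proof (cases "k < N'")
    case True
    have "\<not> (k < N' \<and> x \<le> (\<Sum>l=Suc k..N'. \<beta> l))"
      using not_less_Least[of N' "\<lambda>m. k < m \<and> x \<le> (\<Sum>l=Suc k..m. \<beta> l)"] N' unfolding Np_def by simp
    thus ?thesis using True by (simp add: atLeastLessThanSuc_atLeastAtMost)
  next
    case False thus ?thesis using x by simp
  qed
  moreover have "sum \<beta> {Suc k..<Suc (Np x k)} = sum \<beta> {Suc k..<Suc N'} + \<beta> (Np x k)"
    using L(1) unfolding N' by (simp add: less_Suc_eq_le)
  ultimately show "sum \<beta> {Suc k..<Suc (Np x k)} \<le> x + \<beta> (Np x k)" by linarith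
qed

definition "Ms x k i = (\<Sum>l\<in>{Suc k..<Suc (Np x k)}. \<alpha> l i)"

text \<open>The sums in the assumption begin with visit number \<open>cnt \<phi> (Suc k) i\<close>,
  which took place at or before time \<open>k\<close>; this surplus term tends to \<open>0\<close>.
  A count of \<open>0\<close> is excluded because \<open>b 0\<close> belongs to no update.\<close>

lemma window_sum:
  assumes "0 < x" "1 \<le> cnt \<phi> (Suc k) i"
  shows "(\<Sum>m = cnt \<phi> (Suc k) i..cnt \<phi> (Suc (Np x k)) i. b m) = Ms x k i + b (cnt \<phi> (Suc k) i)"
proof -
  define A where "A = cnt \<phi> (Suc k) i"
  define B where "B = cnt \<phi> (Suc (Np x k)) i"
  have AB: "A \<le> B" unfolding A_def B_def using Np(1)[OF assms(1), of k] by (intro cnt_mono) simp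
  have kN: "Suc k \<le> Suc (Np x k)" using Np(1)[OF assms(1), of k] by simp
  have "(\<Sum>l<Suc (Np x k). \<alpha> l i) = (\<Sum>l<Suc k. \<alpha> l i) + Ms x k i"
    unfolding Ms_def lessThan_atLeast0 using kN by (intro sum.atLeastLessThan_concat[symmetric]) auto
  hence "(\<Sum>m=1..B. b m) = (\<Sum>m=1..A. b m) + Ms x k i" unfolding sum_astep_eq A_def B_def .
  moreover have "(\<Sum>m=1..B. b m) = (\<Sum>m=1..<A. b m) + (\<Sum>m=A..B. b m)"
    using AB assms(2) unfolding A_def[symmetric]
    by (metis atLeastLessThanSuc_atLeastAtMost le_SucI sum.atLeastLessThan_concat)
  moreover have "(\<Sum>m=1..A. b m) = (\<Sum>m=1..<A. b m) + b A"
    using assms(2) unfolding A_def[symmetric] by (simp add: atLeastLessThanSuc_atLeastAtMost[symmetric])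
  ultimately show ?thesis unfolding A_def B_def by linarith
qed

text \<open>The masses of a window converge. Their limits are the Cesaro limits of the total masses of consecutive windows, whose
  ratios tend to \<open>1\<close> because \<open>C (\<lfloor>y k\<rfloor>) / C k\<close> does.\<close>

lemma window_masses_equal:
  assumes x: "0 < x"
    and conv: "\<And>i j. convergent (\<lambda>k. (\<Sum>m = cnt \<phi> (Suc k) j..cnt \<phi> (Suc (Np x k)) j. b m) /
       (\<Sum>m = cnt \<phi> (Suc k) i..cnt \<phi> (Suc (Np x k)) i. b m))"
  shows "(\<lambda>k. Ms x k i - Ms x k j) \<longlonglongrightarrow> 0"
proof -
  define s where "s k i = (\<Sum>m = cnt \<phi> (Suc k) i..cnt \<phi> (Suc (Np x k)) i. b m)" for k i
  have s_pos: "0 < s k i" for k i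
  proof -
    have "cnt \<phi> (Suc k) i \<le> cnt \<phi> (Suc (Np x k)) i" using Np(1)[OF x, of k] by (intro cnt_mono) simp
    thus ?thesis unfolding s_def by (intro sum_pos) (auto simp: b_pos)
  qed
  have sM: "(\<lambda>k. s k i - Ms x k i) \<longlonglongrightarrow> 0" for i
  proof -
    have "eventually (\<lambda>n. 1 \<le> cnt \<phi> n i) sequentially" using cnt_top unfolding filterlim_at_top by blast
    hence "eventually (\<lambda>k. 1 \<le> cnt \<phi> (Suc k) i) sequentially" by (subst eventually_sequentially_Suc)
    hence "eventually (\<lambda>k. b (cnt \<phi> (Suc k) i) = s k i - Ms x k i) sequentially"
      by eventually_elim (simp add: s_def window_sum[OF x])
    thus ?thesis using LIMSEQ_Suc[OF b_cnt_null] by (rule Lim_transform_eventually[rotated])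
  qed
  have "\<forall>i j. \<exists>l. (\<lambda>k. s k j / s k i) \<longlonglongrightarrow> l" using conv unfolding s_def convergent_def by blast
  then obtain l where l: "\<And>i j. (\<lambda>k. s k j / s k i) \<longlonglongrightarrow> l i j" by metis
  have Mtot: "(\<Sum>i\<in>UNIV. Ms x k i) = sum \<beta> {Suc k..<Suc (Np x k)}" for k
    unfolding Ms_def by (subst sum.swap) (simp only: sum_astep)
  have "filterlim (Np x) at_top sequentially" unfolding filterlim_at_top eventually_sequentially
    using Np(1)[OF x] by (meson less_imp_le order_trans)
  hence beN: "(\<lambda>k. \<beta> (Np x k)) \<longlonglongrightarrow> 0" using filterlim_compose[OF be_lim] by blast
  have "(\<lambda>k. \<Sum>i\<in>UNIV. Ms x k i) \<longlonglongrightarrow> x"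
  proof (rule tendsto_sandwich[OF _ _ tendsto_const])
    show "eventually (\<lambda>k. x \<le> (\<Sum>i\<in>UNIV. Ms x k i)) sequentially" unfolding Mtot using Np(2)[OF x] by simp
    show "eventually (\<lambda>k. (\<Sum>i\<in>UNIV. Ms x k i) \<le> x + \<beta> (Np x k)) sequentially" unfolding Mtot using Np(3)[OF x] by simp
    show "(\<lambda>k. x + \<beta> (Np x k)) \<longlonglongrightarrow> x" using tendsto_add[OF tendsto_const beN, of x] by simp
  qed
  moreover have "(\<lambda>k. \<Sum>i\<in>UNIV. (s k i - Ms x k i)) \<longlonglongrightarrow> 0" by (rule tendsto_null_sum) (rule sM)
  ultimately have "(\<lambda>k. (\<Sum>i\<in>UNIV. (s k i - Ms x k i)) + (\<Sum>i\<in>UNIV. Ms x k i)) \<longlonglongrightarrow> 0 + x" by (intro tendsto_add)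
  hence Stot: "(\<lambda>k. \<Sum>i\<in>UNIV. s k i) \<longlonglongrightarrow> x" by (simp add: sum.distrib[symmetric])
  \<comment> \<open>The sum of all \<open>s k i\<close> tends to \<open>x\<close>, its quotient by
    \<open>s k j\<close> to the sum of the \<open>l j i\<close>; together they identify the limit of
    \<open>s k j\<close>.\<close>
  define \<mu> where "\<mu> j = x / (\<Sum>i\<in>UNIV. l j i)" for j
  have l1: "1 \<le> (\<Sum>i\<in>UNIV. l j i)" for j
  proof -
    have "l j j = 1" using LIMSEQ_unique[OF l[of j j], of 1] s_pos[of _ j] by (simp add: less_imp_neq[symmetric])
    moreover have "0 \<le> l j i" for i
      by (rule LIMSEQ_le_const[OF l]) (intro exI[of _ 0] allI impI divide_nonneg_nonneg less_imp_le s_pos)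
    hence "l j j \<le> (\<Sum>i\<in>UNIV. l j i)" by (intro member_le_sum) auto
    ultimately show ?thesis by simp
  qed
  have mu_pos: "0 < \<mu> j" for j unfolding \<mu>_def using x l1[of j] by simp
  have s_lim: "(\<lambda>k. s k j) \<longlonglongrightarrow> \<mu> j" for j
  proof -
    have "(\<lambda>k. (\<Sum>i\<in>UNIV. s k i) / (\<Sum>i\<in>UNIV. s k i / s k j)) \<longlonglongrightarrow> \<mu> j" unfolding \<mu>_def
      using l1[of j] by (intro tendsto_divide Stot tendsto_sum l) auto
    moreover have "(\<Sum>i\<in>UNIV. s k i) / (\<Sum>i\<in>UNIV. s k i / s k j) = s k j" for k
    proof -
      have "0 < (\<Sum>i\<in>UNIV. s k i)" by (rule sum_pos) (auto simp: s_pos)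
      thus ?thesis using s_pos[of k j] by (simp add: sum_divide_distrib[symmetric])
    qed
    ultimately show ?thesis by simp
  qed
  have M_lim: "(\<lambda>k. Ms x k j) \<longlonglongrightarrow> \<mu> j" for j
    using tendsto_diff[OF s_lim[of j] sM[of j]] by simp
  \<comment> \<open>Starting points of consecutive windows. \<open>Np\<close> takes the index before
    the window, hence \<open>n t - 1\<close>, and the chain begins at \<open>1\<close> so that this
    predecessor exists.\<close>
  define n where "n t = rec_nat 1 (\<lambda>_ m. Suc (Np x (m - 1))) t" for t
  have n: "n 0 = 1" "n (Suc t) = Suc (Np x (n t - 1))" for t unfolding n_def by auto
  have n_ge: "Suc t \<le> n t" for t
  proof (induction t)
    case (Suc t) thus ?case using Np(1)[OF x, of "n t - 1"] unfolding n by linarith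
  qed (simp add: n)
  have n_top: "filterlim n at_top sequentially" unfolding filterlim_at_top eventually_sequentially
    using n_ge by (meson Suc_leD order_trans)
  have "filterlim (\<lambda>t. n t - 1) at_top sequentially" unfolding filterlim_at_top eventually_sequentially
    using n_ge by (metis Suc_le_mono diff_Suc_1 diff_le_mono order_trans)
  hence d_lim: "(\<lambda>t. Ms x (n t - 1) j) \<longlonglongrightarrow> \<mu> j" for j
    using filterlim_compose[OF M_lim] by blast
  have A: "C (cnt \<phi> (n t) j) = C (cnt \<phi> 1 j) + (\<Sum>s<t. Ms x (n s - 1) j)" for t j
  proof (induction t)
    case (Suc t)
    have nt: "Suc (n t - 1) = n t" using n_ge[of t] by simp
    have "(\<Sum>l<n (Suc t). \<alpha> l j) = (\<Sum>l<n t. \<alpha> l j) + Ms x (n t - 1) j"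
      unfolding Ms_def lessThan_atLeast0 nt n(2) using Np(1)[OF x, of "n t - 1"] n_ge[of t]
      by (intro sum.atLeastLessThan_concat[symmetric]) auto
    thus ?case using Suc unfolding C_cnt by simp
  qed (simp add: n)
  have Ct: "(\<lambda>t. C (cnt \<phi> (n t) j) / real t) \<longlonglongrightarrow> \<mu> j" for j
  proof -
    have "(\<lambda>t. C (cnt \<phi> 1 j) / real t + (\<Sum>s<t. Ms x (n s - 1) j) / real t) \<longlonglongrightarrow> 0 + \<mu> j"
      by (intro tendsto_add cesaro_mean d_lim lim_const_over_n)
    thus ?thesis unfolding A by (simp add: add_divide_distrib)
  qed
  have "(\<lambda>t. (C (cnt \<phi> (n t) i) / real t) / (C (cnt \<phi> (n t) j) / real t)) \<longlonglongrightarrow> \<mu> i / \<mu> j"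
    using mu_pos[of j] by (intro tendsto_divide Ct) auto
  moreover have "eventually (\<lambda>t. (C (cnt \<phi> (n t) i) / real t) / (C (cnt \<phi> (n t) j) / real t) = C (cnt \<phi> (n t) i) / C (cnt \<phi> (n t) j)) sequentially"
    using eventually_gt_at_top[of 0] by eventually_elim simp
  ultimately have "(\<lambda>t. C (cnt \<phi> (n t) i) / C (cnt \<phi> (n t) j)) \<longlonglongrightarrow> \<mu> i / \<mu> j"
    by (rule Lim_transform_eventually)
  moreover have "(\<lambda>t. C (cnt \<phi> (n t) i) / C (cnt \<phi> (n t) j)) \<longlonglongrightarrow> 1"
    using filterlim_compose[OF C_ratio n_top] .
  ultimately have "\<mu> i / \<mu> j = 1" by (rule LIMSEQ_unique)
  hence "\<mu> i = \<mu> j" using mu_pos[of j] by simp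
  thus ?thesis using tendsto_diff[OF M_lim[of i] M_lim[of j]] by simp
qed

text \<open>A stretch of mass at most \<open>T\<close> is cut into at most \<open>J\<close> windows
  of mass about \<open>x\<close>, each nearly balanced, and a rest of mass at most
  \<open>2 * x < \<epsilon> / 2\<close>. The sizes \<open>1 / (N + 1)\<close> form a countable
  family, for which the convergence can be required on one path simultaneously.\<close>

lemma masses_equalize:
  assumes conv: "\<And>N i j. convergent (\<lambda>k. (\<Sum>m = cnt \<phi> (Suc k) j..cnt \<phi> (Suc (Np (inverse (real (Suc N))) k)) j. b m) /
       (\<Sum>m = cnt \<phi> (Suc k) i..cnt \<phi> (Suc (Np (inverse (real (Suc N))) k)) i. b m))"
    and e: "0 < \<epsilon>"
  shows "\<exists>K. \<forall>k0\<ge>K. \<forall>k\<ge>k0. sum \<beta> {k0..<k} \<le> T \<longrightarrow>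
       (\<forall>i j. \<bar>(\<Sum>l\<in>{k0..<k}. \<alpha> l i) - (\<Sum>l\<in>{k0..<k}. \<alpha> l j)\<bar> \<le> \<epsilon>)"
proof -
  obtain N where N: "inverse (real (Suc N)) < \<epsilon> / 4" using reals_Archimedean[of "\<epsilon> / 4"] e by auto
  define x where "x = inverse (real (Suc N))"
  have x: "0 < x" "x < \<epsilon> / 4" unfolding x_def using N by auto
  obtain J where J: "T \<le> real J * x" using reals_Archimedean3[OF x(1)] less_imp_le by blast
  define \<epsilon>' where "\<epsilon>' = \<epsilon> / (2 * (real J + 1))"
  have e': "0 < \<epsilon>'" "real J * \<epsilon>' \<le> \<epsilon> / 2" unfolding \<epsilon>'_def using e by (auto simp: field_simps)
  have "eventually (\<lambda>k. \<forall>i\<in>UNIV. \<forall>j\<in>UNIV. \<bar>Ms x k i - Ms x k j\<bar> < \<epsilon>') sequentially"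
  proof (intro eventually_ball_finite ballI)
    fix i j
    show "eventually (\<lambda>k. \<bar>Ms x k i - Ms x k j\<bar> < \<epsilon>') sequentially"
      using tendsto_rabs_zero[OF window_masses_equal[OF x(1) conv[of _ N, folded x_def], of i j]] e' by (intro order_tendstoD) auto
  qed auto
  moreover have "eventually (\<lambda>k. \<beta> k < x) sequentially" using be_lim x by (intro order_tendstoD) auto
  ultimately have "eventually (\<lambda>k. (\<forall>i j. \<bar>Ms x k i - Ms x k j\<bar> < \<epsilon>') \<and> \<beta> k < x) sequentially"
    by eventually_elim simp
  then obtain K where K: "\<And>k. K \<le> k \<Longrightarrow> (\<forall>i j. \<bar>Ms x k i - Ms x k j\<bar> < \<epsilon>') \<and> \<beta> k < x"
    unfolding eventually_sequentially by blast
  define S where "S k0 k i = (\<Sum>l\<in>{k0..<k}. \<alpha> l i)" for k0 k i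
  have S: "0 \<le> S k0 k i" "S k0 k i \<le> sum \<beta> {k0..<k}" for k0 k i
    unfolding S_def by (auto intro!: sum_nonneg sum_mono al0 al_le)
  have be0: "0 \<le> \<beta> k" for k using be_pos less_imp_le by blast
  have main: "\<bar>S k0 k i - S k0 k j\<bar> \<le> real t * \<epsilon>' + 2 * x"
    if "Suc K \<le> k0" "k0 \<le> k" "sum \<beta> {k0..<k} \<le> real t * x" for t k0 k i j using that
  proof (induction t arbitrary: k0)
    case 0
    thus ?case using S[of k0 k i] S[of k0 k j] x by (simp add: abs_le_iff)
  next
    case (Suc t)
    define m where "m = k0 - 1"
    have m: "K \<le> m" "k0 = Suc m" unfolding m_def using Suc.prems by auto
    define W where "W = Suc (Np x m)"
    have W: "k0 < W" "x \<le> sum \<beta> {k0..<W}" "sum \<beta> {k0..<W} \<le> 2 * x"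
      using Np[OF x(1), of m] K[of "Np x m"] m unfolding W_def by auto
    show ?case
    proof (cases "k \<le> W")
      case True
      have "sum \<beta> {k0..<k} \<le> sum \<beta> {k0..<W}" using True by (intro sum_mono2) (auto simp: be0)
      hence "\<bar>S k0 k i - S k0 k j\<bar> \<le> 2 * x" using S[of k0 k i] S[of k0 k j] W(3) by (simp add: abs_le_iff)
      moreover have "0 \<le> real (Suc t) * \<epsilon>'" using e' by simp
      ultimately show ?thesis by linarith
    next
      case False
      have cc: "S k0 k i = S k0 W i + S W k i" for i
        unfolding S_def using False W(1) by (intro sum.atLeastLessThan_concat[symmetric]) auto
      have "sum \<beta> {k0..<k} = sum \<beta> {k0..<W} + sum \<beta> {W..<k}"
        using False W(1) by (intro sum.atLeastLessThan_concat[symmetric]) auto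
      hence "sum \<beta> {W..<k} \<le> real t * x" using Suc.prems(3) W(2) by (simp add: distrib_right)
      hence "\<bar>S W k i - S W k j\<bar> \<le> real t * \<epsilon>' + 2 * x"
        using Suc.prems(1) W(1) False by (intro Suc.IH) auto
      moreover have "\<bar>S k0 W i - S k0 W j\<bar> < \<epsilon>'"
        using K[OF m(1)] unfolding S_def W_def m(2) Ms_def by blast
      ultimately have "\<bar>S k0 k i - S k0 k j\<bar> \<le> \<epsilon>' + (real t * \<epsilon>' + 2 * x)" unfolding cc by linarith
      thus ?thesis by (simp add: distrib_right)
    qed
  qed
  show ?thesis
  proof (rule exI[of _ "Suc K"], intro allI impI)
    fix k0 k i j assume A: "Suc K \<le> k0" "k0 \<le> k" "sum \<beta> {k0..<k} \<le> T"
    hence "\<bar>S k0 k i - S k0 k j\<bar> \<le> real J * \<epsilon>' + 2 * x" using J by (intro main) auto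
    also have "\<dots> \<le> \<epsilon>" using e'(2) x(2) by linarith
    finally show "\<bar>(\<Sum>l\<in>{k0..<k}. \<alpha> l i) - (\<Sum>l\<in>{k0..<k}. \<alpha> l j)\<bar> \<le> \<epsilon>" unfolding S_def .
  qed
qed

end

section \<open>The noise of the iteration\<close>

lemma measurable_sigma_preimgs:
  fixes X :: "'w \<Rightarrow> 'v::topological_space"
  assumes "G \<subseteq> Pow (space M)" "preimgs M X \<subseteq> G"
  shows "X \<in> borel_measurable (sigma (space M) G)"
proof (rule measurableI)
  fix A :: "'v set" assume "A \<in> sets borel"
  hence "X -` A \<inter> space M \<in> G" using assms(2) unfolding preimgs_def by blast
  thus "X -` A \<inter> space (sigma (space M) G) \<in> sets (sigma (space M) G)"
    using assms(1) by (simp add: sets_measure_of space_measure_of sigma_sets.Basic)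
qed simp

lemma measurable_sigma_preimgs_discr:
  assumes "G \<subseteq> Pow (space M)" "preimgs_discr M X \<subseteq> G"
  shows "X \<in> measurable (sigma (space M) G) (count_space UNIV)"
proof (rule measurableI)
  fix A
  have "X -` A \<inter> space M \<in> G" using assms(2) unfolding preimgs_discr_def by blast
  thus "X -` A \<inter> space (sigma (space M) G) \<in> sets (sigma (space M) G)"
    using assms(1) by (simp add: sets_measure_of space_measure_of sigma_sets.Basic)
qed simp

lemma preimgs_sets: "X \<in> borel_measurable M \<Longrightarrow> preimgs M X \<subseteq> sets M"
  unfolding preimgs_def by (auto intro: measurable_sets)

lemma preimgs_discr_sets: "X \<in> measurable M (count_space UNIV) \<Longrightarrow> preimgs_discr M X \<subseteq> sets M"
  unfolding preimgs_discr_def by (auto intro: measurable_sets)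

lemma subalgebra_sigma: "G \<subseteq> sets M \<Longrightarrow> subalgebra M (sigma (space M) G)"
  using order_trans[OF _ sets.space_closed[of M], of G]
  by (simp add: subalgebra_def sets_measure_of space_measure_of sets.sigma_sets_subset)

lemma sets_sigma_mono: "G \<subseteq> H \<Longrightarrow> H \<subseteq> Pow S \<Longrightarrow> sets (sigma S G) \<subseteq> sets (sigma S H)"
  by (simp add: sigma_sets_mono' order_trans)

lemma borel_measurable_vec_iff:
  fixes X :: "'w \<Rightarrow> real ^ 'n::finite"
  shows "X \<in> borel_measurable M \<longleftrightarrow> (\<forall>i. (\<lambda>\<omega>. X \<omega> $ i) \<in> borel_measurable M)"
proof
  assume "X \<in> borel_measurable M"
  moreover have "(\<lambda>x :: real ^ 'n. x $ i) \<in> borel_measurable borel" for i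
    by (intro borel_measurable_continuous_onI continuous_intros)
  ultimately show "\<forall>i. (\<lambda>\<omega>. X \<omega> $ i) \<in> borel_measurable M"
    using measurable_compose[of X M borel] by blast
next
  assume A: "\<forall>i. (\<lambda>\<omega>. X \<omega> $ i) \<in> borel_measurable M"
  show "X \<in> borel_measurable M"
    by (subst borel_measurable_euclidean_space) (use A in \<open>auto simp: Basis_vec_def inner_axis\<close>)
qed

lemma borel_measurable_maxQ:
  assumes "X \<in> borel_measurable M"
  shows "(\<lambda>\<omega>. maxQ (X \<omega>) s) \<in> borel_measurable M"
proof -
  have "(\<lambda>q. maxQ q s) \<in> borel_measurable borel"
    by (intro borel_measurable_continuous_onI continuous_on_maxQ continuous_on_id)
  thus ?thesis using measurable_compose[OF assms] by blast
qed

lemma borel_measurable_spn: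
  assumes "X \<in> borel_measurable M"
  shows "(\<lambda>\<omega>. spn (X \<omega>)) \<in> borel_measurable M"
proof -
  have "(\<lambda>\<omega>. Max ((\<lambda>ij. X \<omega> $ fst ij - X \<omega> $ snd ij) ` UNIV)) \<in> borel_measurable M"
    using assms unfolding borel_measurable_vec_iff
    by (intro borel_measurable_Max borel_measurable_diff) auto
  thus ?thesis unfolding spn_def by (simp add: case_prod_unfold)
qed

lemma borel_measurable_runmax:
  assumes "\<And>j. j \<le> k \<Longrightarrow> (\<lambda>\<omega>. x j \<omega>) \<in> borel_measurable M"
  shows "(\<lambda>\<omega>. runmax (\<lambda>j. x j \<omega>) k) \<in> borel_measurable M"
  using assms by (induction k) (auto intro!: borel_measurable_max)

lemma measurable_visits:
  assumes "\<And>m. m \<le> k \<Longrightarrow> \<phi> m \<in> measurable M (count_space UNIV)"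
  shows "(\<lambda>\<omega>. visits \<phi> k \<omega> i) \<in> measurable M (count_space UNIV)"
proof -
  have eq: "visits \<phi> k \<omega> i = (\<Sum>m\<le>k. if \<phi> m \<omega> = i then 1 else 0)" for \<omega>
    unfolding visits_def by (simp add: sum.If_cases Int_def)
  have "(\<lambda>\<omega>. if \<phi> m \<omega> = i then 1 else (0::nat)) \<in> measurable M (count_space UNIV)" if "m \<le> k" for m
    by (rule measurable_compose[OF assms[OF that], of "\<lambda>j. if j = i then 1 else (0::nat)"]) simp
  thus ?thesis unfolding eq
  proof (induction k)
    case (Suc k)
    have "(\<lambda>\<omega>. (\<Sum>m\<le>k. if \<phi> m \<omega> = i then 1 else 0) + (if \<phi> (Suc k) \<omega> = i then 1 else (0::nat))) \<in> measurable M (count_space UNIV)"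
    proof (rule measurable_compose_countable[where f="\<lambda>n \<omega>. n + (if \<phi> (Suc k) \<omega> = i then 1 else (0::nat))"])
      show "(\<lambda>\<omega>. n + (if \<phi> (Suc k) \<omega> = i then 1 else (0::nat))) \<in> measurable M (count_space UNIV)" for n
        by (rule measurable_compose[OF Suc.prems, of "Suc k" "\<lambda>j. n + j"]) auto
    qed (use Suc in auto)
    thus ?case by simp
  qed simp
qed

text \<open>\<open>G k\<close> is known at time \<open>k\<close>, so division by it preserves the
  conditional mean \<open>0\<close>, and it dominates the conditional deviation, so the variances
  are at most \<open>K * (a k)\<^sup>2\<close>. The second moment is conditioned by
  \<open>nn_cond_exp\<close> because \<open>w k\<close> is only given as integrable; square
  integrability is obtained for the quotient.\<close>

lemma normalized_noise_summable:
  fixes w G :: "nat \<Rightarrow> 'w \<Rightarrow> real"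
  assumes M: "prob_space M"
    and sub: "\<And>k. subalgebra M (F k)" and mono: "\<And>j k. j \<le> k \<Longrightarrow> sets (F j) \<subseteq> sets (F k)"
    and w: "\<And>k. w k \<in> borel_measurable (F (Suc k))" and wi: "\<And>k. integrable M (w k)"
    and mean: "\<And>k. AE \<omega> in M. real_cond_exp M (F k) (w k) \<omega> = 0"
    and G: "\<And>k. G k \<in> borel_measurable (F k)" and G1: "\<And>k \<omega>. 1 \<le> G k \<omega>" and K: "0 \<le> K"
    and var: "\<And>k. AE \<omega> in M. nn_cond_exp M (F k) (\<lambda>\<omega>. ennreal ((w k \<omega>)\<^sup>2)) \<omega> \<le> ennreal (K * (G k \<omega>)\<^sup>2)"
    and a0: "\<And>k. 0 \<le> a k" and a2: "summable (\<lambda>k. (a k)\<^sup>2)"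
  shows "AE \<omega> in M. summable (\<lambda>k. a k * w k \<omega> / G k \<omega>)"
proof -
  interpret prob_space M by fact
  define D where "D k \<omega> = a k / G k \<omega> * w k \<omega>" for k \<omega>
  have wM[measurable]: "w k \<in> borel_measurable M" for k using measurable_from_subalg[OF sub w] .
  have GM[measurable]: "G k \<in> borel_measurable M" for k using measurable_from_subalg[OF sub G] .
  have DM[measurable]: "D k \<in> borel_measurable M" for k unfolding D_def by simp
  have G0: "0 < G k \<omega>" for k \<omega> using G1[of k \<omega>] by linarith
  have GF: "G k \<in> borel_measurable (F (Suc k))" for k
    using G mono[of k "Suc k"] sub by (intro measurable_from_subalg[of "F (Suc k)" "F k"]) (auto simp: subalgebra_def)
  have sq: "(\<integral>\<^sup>+ \<omega>. ennreal ((D k \<omega>)\<^sup>2) \<partial>M) \<le> ennreal ((a k)\<^sup>2 * K)" for k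
  proof -
    interpret finite_measure_subalgebra M "F k" by unfold_locales (rule sub)
    have "(\<integral>\<^sup>+ \<omega>. ennreal ((D k \<omega>)\<^sup>2) \<partial>M) = (\<integral>\<^sup>+ \<omega>. ennreal ((a k / G k \<omega>)\<^sup>2) * ennreal ((w k \<omega>)\<^sup>2) \<partial>M)"
      unfolding D_def power_mult_distrib by (simp add: ennreal_mult[symmetric] del: times_divide_eq_left power_divide)
    also have "\<dots> = (\<integral>\<^sup>+ \<omega>. ennreal ((a k / G k \<omega>)\<^sup>2) * nn_cond_exp M (F k) (\<lambda>\<omega>. ennreal ((w k \<omega>)\<^sup>2)) \<omega> \<partial>M)"
      using G[of k] by (intro nn_cond_exp_intg[symmetric]) auto
    also have "\<dots> \<le> (\<integral>\<^sup>+ \<omega>. ennreal ((a k)\<^sup>2 * K) \<partial>M)"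
    proof (rule nn_integral_mono_AE, use var[of k] in eventually_elim)
      case (elim \<omega>)
      have "ennreal ((a k / G k \<omega>)\<^sup>2) * nn_cond_exp M (F k) (\<lambda>\<omega>. ennreal ((w k \<omega>)\<^sup>2)) \<omega>
          \<le> ennreal ((a k / G k \<omega>)\<^sup>2) * ennreal (K * (G k \<omega>)\<^sup>2)" using elim by (rule mult_left_mono) simp
      also have "\<dots> = ennreal ((a k / G k \<omega>)\<^sup>2 * (K * (G k \<omega>)\<^sup>2))" using K by (simp add: ennreal_mult)
      also have "(a k / G k \<omega>)\<^sup>2 * (K * (G k \<omega>)\<^sup>2) = (a k)\<^sup>2 * K" using G0[of k \<omega>] by (simp add: power_divide)
      finally show ?case .
    qed
    also have "\<dots> = ennreal ((a k)\<^sup>2 * K)" by (simp add: emeasure_space_1)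
    finally show ?thesis .
  qed
  have D2: "integrable M (\<lambda>\<omega>. (D k \<omega>)\<^sup>2)" for k
    by (rule integrableI_bounded) (use sq[of k] in \<open>auto intro: le_less_trans\<close>)
  have D2b: "(\<integral>\<omega>. (D k \<omega>)\<^sup>2 \<partial>M) \<le> (a k)\<^sup>2 * K" for k
  proof -
    have "ennreal (\<integral>\<omega>. (D k \<omega>)\<^sup>2 \<partial>M) \<le> ennreal ((a k)\<^sup>2 * K)"
      using sq[of k] nn_integral_eq_integral[OF D2, of k] by simp
    thus ?thesis using K by (subst (asm) ennreal_le_iff) auto
  qed
  have "AE \<omega> in M. summable (\<lambda>k. D k \<omega>)"
  proof (rule L2_martingale_convergence[OF M sub mono _ D2])
    show "D k \<in> borel_measurable (F (Suc k))" for k unfolding D_def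
      by (intro borel_measurable_times borel_measurable_divide borel_measurable_const GF w)
    show "summable (\<lambda>k. \<integral>\<omega>. (D k \<omega>)\<^sup>2 \<partial>M)"
      by (rule summable_comparison_test'[OF summable_mult2[OF a2, of K], of 0]) (simp add: D2b)
    fix k
    interpret finite_measure_subalgebra M "F k" by unfold_locales (rule sub)
    have "integrable M (\<lambda>\<omega>. a k / G k \<omega> * w k \<omega>)"
    proof (rule Bochner_Integration.integrable_bound)
      show "integrable M (\<lambda>\<omega>. a k * \<bar>w k \<omega>\<bar>)" using wi by simp
      have "a k / G k \<omega> \<le> a k" for \<omega> using a0[of k] G1[of k \<omega>] G0[of k \<omega>] mult_left_mono[OF G1[of k \<omega>] a0[of k]] by (simp add: pos_divide_le_eq)
      hence "\<bar>a k / G k \<omega> * w k \<omega>\<bar> \<le> a k * \<bar>w k \<omega>\<bar>" for \<omega>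
        using a0[of k] G0[of k \<omega>] by (simp add: abs_mult mult_right_mono less_imp_le del: times_divide_eq_left)
      thus "AE \<omega> in M. norm (a k / G k \<omega> * w k \<omega>) \<le> norm (a k * \<bar>w k \<omega>\<bar>)"
        using a0[of k] by (simp add: abs_mult)
    qed simp
    hence "AE \<omega> in M. real_cond_exp M (F k) (\<lambda>\<omega>. a k / G k \<omega> * w k \<omega>) \<omega> = a k / G k \<omega> * real_cond_exp M (F k) (w k) \<omega>"
      using G[of k] by (intro real_cond_exp_mult) auto
    thus "AE \<omega> in M. real_cond_exp M (F k) (D k) \<omega> = 0"
      unfolding D_def using mean[of k] by eventually_elim simp
  qed
  thus ?thesis unfolding D_def by simp
qed

lemma maxQ_diff_spn: "\<bar>maxQ q s - maxQ q t\<bar> \<le> spn q"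
proof -
  obtain a where a: "maxQ q s = q $ (s, a)" using maxQ_attained by blast
  obtain a' where a': "maxQ q t = q $ (t, a')" using maxQ_attained by blast
  show ?thesis unfolding a a' using spn_ge[of q "(s, a)" "(t, a')"] spn_ge[of q "(t, a')" "(s, a)"] by linarith
qed

locale rvi_process = prob_space M for M :: "'w measure" +
  fixes r :: "'s::finite \<Rightarrow> 'b::finite \<Rightarrow> real" and p :: "'s \<Rightarrow> 'b \<Rightarrow> 's \<Rightarrow> real"
    and f :: "real ^ ('s \<times> 'b) \<Rightarrow> real" and fs :: "real ^ ('s \<times> 'b) \<Rightarrow> 'x \<Rightarrow> real"
    and a b :: "nat \<Rightarrow> real" and \<eta> :: real
    and X :: "nat \<Rightarrow> 'w \<Rightarrow> 'x" and \<phi> :: "nat \<Rightarrow> 'w \<Rightarrow> 's \<times> 'b" and s' :: "nat \<Rightarrow> 'w \<Rightarrow> 's"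
    and \<xi> :: "nat \<Rightarrow> 'w \<Rightarrow> real" and Q :: "nat \<Rightarrow> 'w \<Rightarrow> real ^ ('s \<times> 'b)"
    and \<xi>0 :: real and Q0 :: "real ^ ('s \<times> 'b)"
  assumes mdp: "is_mdp p" and f_cont: "continuous_on UNIV f"
    and b_pos: "\<And>k. b k > 0"
    and phi_meas: "\<And>k. \<phi> k \<in> measurable M (count_space UNIV)"
    and s'_meas: "\<And>k. s' k \<in> measurable M (count_space UNIV)"
    and fs_meas: "\<And>k. (\<lambda>\<omega>. fs (Q k \<omega>) (X k \<omega>)) \<in> borel_measurable M"
    and xi_init: "\<And>\<omega>. \<xi> 0 \<omega> = \<xi>0"
    and Q_init: "\<And>\<omega>. Q 0 \<omega> = Q0"
    and xi_step: "\<And>k \<omega>. \<xi> (Suc k) \<omega> = \<xi> k \<omega> + a k * (fs (Q k \<omega>) (X k \<omega>) - \<xi> k \<omega>)"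
    and Q_step: "\<And>k \<omega> s\<^sub>0 a\<^sub>0. Q (Suc k) \<omega> $ (s\<^sub>0, a\<^sub>0) = Q k \<omega> $ (s\<^sub>0, a\<^sub>0)
        + b (visits \<phi> k \<omega> (s\<^sub>0, a\<^sub>0)) *
          (r s\<^sub>0 a\<^sub>0 - g_clip (rnorm r) \<eta> (\<xi> k \<omega>) + maxQ (Q k \<omega>) (s' k \<omega>) - Q k \<omega> $ (s\<^sub>0, a\<^sub>0))
          * (if (s\<^sub>0, a\<^sub>0) = \<phi> k \<omega> then 1 else 0)"
begin

abbreviation "w1 \<equiv> noise1 f fs Q X"
abbreviation "w2 \<equiv> noise2 r p \<eta> \<xi> Q s'"
abbreviation "F \<equiv> filtF M \<xi> Q w1 w2"
abbreviation "H \<equiv> filtH M \<xi> Q w1 w2 \<phi> s'"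
abbreviation "traj x \<equiv> (\<lambda>m. \<phi> m x)"

lemma w2_eq: "w2 k \<omega> $ i = maxQ (Q k \<omega>) (s' k \<omega>) - (\<Sum>y\<in>UNIV. p (fst i) (snd i) y * maxQ (Q k \<omega>) y)"
  unfolding noise2_def by simp

lemma Q_step': "Q (Suc k) \<omega> $ i = Q k \<omega> $ i + astep b (traj \<omega>) k i *
   (r (fst i) (snd i) - g_clip (rnorm r) \<eta> (\<xi> k \<omega>) + (\<Sum>y\<in>UNIV. p (fst i) (snd i) y * maxQ (Q k \<omega>) y) - Q k \<omega> $ i + w2 k \<omega> $ i)"
  using Q_step[of k \<omega> "fst i" "snd i"] unfolding w2_eq astep_def visits_eq_cnt by simp

lemma xi_step': "\<xi> (Suc k) \<omega> = \<xi> k \<omega> + a k * (f (Q k \<omega>) + w1 k \<omega> - \<xi> k \<omega>)"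
  unfolding xi_step noise1_def by simp

lemma measurable_maxQ_next:
  assumes "Q k \<in> borel_measurable N" "s' k \<in> measurable N (count_space UNIV)"
  shows "(\<lambda>\<omega>. maxQ (Q k \<omega>) (s' k \<omega>)) \<in> borel_measurable N"
  by (rule measurable_compose_countable'[OF _ assms(2)]) (auto intro: borel_measurable_maxQ assms)

lemma measurable_astep:
  assumes "\<And>m. m \<le> k \<Longrightarrow> \<phi> m \<in> measurable N (count_space UNIV)"
  shows "(\<lambda>\<omega>. astep b (traj \<omega>) k i) \<in> borel_measurable N"
proof -
  have "(\<lambda>\<omega>. b (visits \<phi> k \<omega> i)) \<in> borel_measurable N"
    by (rule measurable_compose[OF measurable_visits[OF assms]]) auto
  moreover have "(\<lambda>\<omega>. if i = \<phi> k \<omega> then 1 else (0::real)) \<in> borel_measurable N"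
    by (rule measurable_compose[OF assms, of k "\<lambda>j. if i = j then 1 else (0::real)"]) auto
  ultimately have "(\<lambda>\<omega>. b (visits \<phi> k \<omega> i) * (if i = \<phi> k \<omega> then 1 else 0)) \<in> borel_measurable N"
    by (rule borel_measurable_times)
  moreover have "astep b (traj \<omega>) k i = b (visits \<phi> k \<omega> i) * (if i = \<phi> k \<omega> then 1 else 0)" for \<omega>
    unfolding astep_def visits_eq_cnt by simp
  ultimately show ?thesis by simp
qed

lemma measurable_w2:
  assumes "Q k \<in> borel_measurable N" "s' k \<in> measurable N (count_space UNIV)"
  shows "w2 k \<in> borel_measurable N"
  unfolding borel_measurable_vec_iff w2_eq
  by (intro allI borel_measurable_diff borel_measurable_sum borel_measurable_times borel_measurable_const
      measurable_maxQ_next borel_measurable_maxQ assms)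

lemma measurable_g_clip:
  assumes [measurable]: "h \<in> borel_measurable N"
  shows "(\<lambda>\<omega>. g_clip (rnorm r) \<eta> (h \<omega>)) \<in> borel_measurable N"
  unfolding g_clip_def by measurable

lemma iterates_measurable: "\<xi> k \<in> borel_measurable M \<and> Q k \<in> borel_measurable M"
proof (induction k)
  case 0
  have "\<xi> 0 = (\<lambda>_. \<xi>0)" "Q 0 = (\<lambda>_. Q0)" using xi_init Q_init by auto
  thus ?case by simp
next
  case (Suc k)
  have "(\<lambda>\<omega>. \<xi> k \<omega> + a k * (fs (Q k \<omega>) (X k \<omega>) - \<xi> k \<omega>)) \<in> borel_measurable M"
    using Suc fs_meas by (intro borel_measurable_add borel_measurable_times borel_measurable_diff) auto
  hence 1: "\<xi> (Suc k) \<in> borel_measurable M" unfolding xi_step[symmetric] .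
  have "\<forall>i. (\<lambda>\<omega>. Q k \<omega> $ i) \<in> borel_measurable M" "\<forall>i. (\<lambda>\<omega>. w2 k \<omega> $ i) \<in> borel_measurable M"
    using Suc measurable_w2[of k M, OF _ s'_meas] unfolding borel_measurable_vec_iff[symmetric] by auto
  hence "\<forall>i. (\<lambda>\<omega>. Q (Suc k) \<omega> $ i) \<in> borel_measurable M" unfolding Q_step'
    using Suc by (intro allI borel_measurable_add borel_measurable_times borel_measurable_diff borel_measurable_sum
        borel_measurable_const measurable_g_clip borel_measurable_maxQ measurable_astep phi_meas) auto
  thus ?case using 1 unfolding borel_measurable_vec_iff by blast
qed

lemma w1_measurable: "w1 k \<in> borel_measurable M"
proof -
  have "f \<in> borel_measurable borel" by (rule borel_measurable_continuous_onI[OF f_cont])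
  hence "(\<lambda>\<omega>. f (Q k \<omega>)) \<in> borel_measurable M" using iterates_measurable[of k] measurable_compose by blast
  hence "(\<lambda>\<omega>. fs (Q k \<omega>) (X k \<omega>) - f (Q k \<omega>)) \<in> borel_measurable M" using fs_meas by (intro borel_measurable_diff)
  thus ?thesis unfolding noise1_def[abs_def] .
qed

lemma w2_measurable: "w2 k \<in> borel_measurable M"
  using measurable_w2[OF _ s'_meas] iterates_measurable by blast

definition "genF k = (\<Union>n\<in>{..k}. preimgs M (\<xi> n) \<union> preimgs M (Q n)) \<union>
      (\<Union>n\<in>{..<k}. preimgs M (w1 n) \<union> preimgs M (w2 n))"

definition "genH k = (\<Union>n\<in>{..k}. preimgs M (\<xi> n) \<union> preimgs M (Q n) \<union> preimgs_discr M (\<phi> n)) \<union>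
      (\<Union>n\<in>{..<k}. preimgs M (w1 n) \<union> preimgs M (w2 n) \<union> preimgs_discr M (s' n))"

lemma F_eq: "F k = sigma (space M) (genF k)" unfolding filtF_def genF_def ..
lemma H_eq: "H k = sigma (space M) (genH k)" unfolding filtH_def genH_def ..

lemma genF_sets: "genF k \<subseteq> sets M"
  unfolding genF_def
  by (intro Un_least UN_least preimgs_sets iterates_measurable[THEN conjunct1] iterates_measurable[THEN conjunct2] w1_measurable w2_measurable)

lemma genH_sets: "genH k \<subseteq> sets M"
  unfolding genH_def
  by (intro Un_least UN_least preimgs_sets preimgs_discr_sets phi_meas s'_meas iterates_measurable[THEN conjunct1]
      iterates_measurable[THEN conjunct2] w1_measurable w2_measurable)

lemma F_sub: "subalgebra M (F k)" unfolding F_eq by (rule subalgebra_sigma[OF genF_sets])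
lemma H_sub: "subalgebra M (H k)" unfolding H_eq by (rule subalgebra_sigma[OF genH_sets])

lemma genF_Pow: "genF k \<subseteq> Pow (space M)" using genF_sets sets.space_closed by blast
lemma genH_Pow: "genH k \<subseteq> Pow (space M)" using genH_sets sets.space_closed by blast

lemma F_mono: "j \<le> k \<Longrightarrow> sets (F j) \<subseteq> sets (F k)"
  unfolding F_eq by (rule sets_sigma_mono[OF _ genF_Pow]) (force simp: genF_def)

lemma H_mono: "j \<le> k \<Longrightarrow> sets (H j) \<subseteq> sets (H k)"
  unfolding H_eq by (rule sets_sigma_mono[OF _ genH_Pow]) (force simp: genH_def)

lemma Q_F: "n \<le> k \<Longrightarrow> Q n \<in> borel_measurable (F k)"
  unfolding F_eq by (rule measurable_sigma_preimgs[OF genF_Pow]) (auto simp: genF_def)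

lemma w1_F: "n < k \<Longrightarrow> w1 n \<in> borel_measurable (F k)"
  unfolding F_eq by (rule measurable_sigma_preimgs[OF genF_Pow]) (auto simp: genF_def)

lemma Q_H: "n \<le> k \<Longrightarrow> Q n \<in> borel_measurable (H k)"
  unfolding H_eq by (rule measurable_sigma_preimgs[OF genH_Pow]) (auto simp: genH_def)

lemma phi_H: "n \<le> k \<Longrightarrow> \<phi> n \<in> measurable (H k) (count_space UNIV)"
  unfolding H_eq by (rule measurable_sigma_preimgs_discr[OF genH_Pow]) (auto simp: genH_def)

lemma s'_H: "n < k \<Longrightarrow> s' n \<in> measurable (H k) (count_space UNIV)"
  unfolding H_eq by (rule measurable_sigma_preimgs_discr[OF genH_Pow]) (auto simp: genH_def)

lemma noise1_summable:
  assumes A1_int: "\<And>k. integrable M (w1 k)"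
    and A1_mean: "\<And>k. AE \<omega> in M. real_cond_exp M (F k) (w1 k) \<omega> = 0"
    and A1_var: "\<And>k. AE \<omega> in M. nn_cond_exp M (F k) (\<lambda>\<omega>. ennreal ((w1 k \<omega>)\<^sup>2)) \<omega> \<le> ennreal (K * (1 + (norm (Q k \<omega>))\<^sup>2))"
    and a0: "\<And>k. 0 \<le> a k" and a2: "summable (\<lambda>k. (a k)\<^sup>2)"
  shows "AE \<omega> in M. summable (\<lambda>k. a k * w1 k \<omega> / runmax (\<lambda>k. 1 + norm (Q k \<omega>)) k)"
proof -
  define G where "G k \<omega> = runmax (\<lambda>k. 1 + norm (Q k \<omega>)) k" for k \<omega>
  have Gge: "1 + norm (Q k \<omega>) \<le> G k \<omega>" for k \<omega>
    unfolding G_def by (rule runmax_ge[of "\<lambda>k. 1 + norm (Q k \<omega>)"])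
  have "AE \<omega> in M. summable (\<lambda>k. a k * w1 k \<omega> / G k \<omega>)"
  proof (rule normalized_noise_summable[where K="max K 0", OF prob_space_axioms F_sub F_mono w1_F A1_int A1_mean])
    show "G k \<in> borel_measurable (F k)" for k unfolding G_def[abs_def]
      by (intro borel_measurable_runmax borel_measurable_add borel_measurable_const measurable_compose[OF Q_F borel_measurable_norm])
    show "1 \<le> G k \<omega>" for k \<omega> using Gge[of k \<omega>] norm_ge_zero[of "Q k \<omega>"] by linarith
    fix k
    show "AE \<omega> in M. nn_cond_exp M (F k) (\<lambda>\<omega>. ennreal ((w1 k \<omega>)\<^sup>2)) \<omega> \<le> ennreal (max K 0 * (G k \<omega>)\<^sup>2)"
      using A1_var[of k]
    proof eventually_elim
      case (elim \<omega>)
      have "1 + (norm (Q k \<omega>))\<^sup>2 \<le> (1 + norm (Q k \<omega>))\<^sup>2" by (simp add: power2_eq_square algebra_simps)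
      also have "\<dots> \<le> (G k \<omega>)\<^sup>2" using Gge by (intro power_mono) auto
      finally have "K * (1 + (norm (Q k \<omega>))\<^sup>2) \<le> max K 0 * (G k \<omega>)\<^sup>2" by (intro mult_mono) auto
      thus ?case using elim by (meson ennreal_leI order_trans)
    qed
  qed (use a0 a2 in auto)
  thus ?thesis unfolding G_def .
qed

text \<open>The conditional mean of \<open>w2 k $ i\<close> is \<open>0\<close> where
  \<open>i = \<phi> k\<close>, and only there is \<open>astep\<close> nonzero. The larger history
  \<open>H k\<close> contains \<open>\<phi> k\<close>, so this factor is known when the next state
  is drawn. The size of \<open>w2\<close> is at most the span, and along every path the squared
  steps of one component sum to at most the sum of all \<open>(b k)\<^sup>2\<close>.\<close>

lemma noise2_summable:
  assumes sampling: "\<And>k y. AE \<omega> in M. real_cond_exp M (H k) (indicator {\<omega>. s' k \<omega> = y}) \<omega> = p (fst (\<phi> k \<omega>)) (snd (\<phi> k \<omega>)) y"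
    and b2: "summable (\<lambda>k. (b k)\<^sup>2)"
  shows "AE \<omega> in M. summable (\<lambda>k. astep b (traj \<omega>) k i * w2 k \<omega> $ i / runmax (\<lambda>k. 1 + spn (Q k \<omega>)) k)"
proof -
  define G where "G k \<omega> = runmax (\<lambda>k. 1 + spn (Q k \<omega>)) k" for k \<omega>
  define al where "al k \<omega> = astep b (traj \<omega>) k i" for k \<omega>
  define D where "D k \<omega> = al k \<omega> * w2 k \<omega> $ i / G k \<omega>" for k \<omega>
  \<comment> \<open>The noise is expanded over the possible next states, since sampling is expressed
    through their indicators. Subtracting the value at the reference state \<open>undefined\<close>
    changes nothing, as \<open>I - p\<close> sums to \<open>0\<close>, and makes the coefficients
    bounded.\<close>
  define A where "A k y \<omega> = al k \<omega> * ((maxQ (Q k \<omega>) y - maxQ (Q k \<omega>) undefined) / G k \<omega>)" for k y \<omega>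
  define I where "I k y \<omega> = (indicator {\<omega>. s' k \<omega> = y} \<omega> :: real)" for k y \<omega>
  have Gge: "1 + spn (Q k \<omega>) \<le> G k \<omega>" for k \<omega>
    unfolding G_def by (rule runmax_ge[of "\<lambda>k. 1 + spn (Q k \<omega>)"])
  have G0: "0 < G k \<omega>" for k \<omega> using Gge[of k \<omega>] spn_nonneg[of "Q k \<omega>"] by linarith
  have al0: "0 \<le> al k \<omega>" for k \<omega> unfolding al_def astep_def using b_pos less_imp_le by auto
  obtain B where B: "\<And>k. b k \<le> B"
    using convergent_imp_Bseq[OF convergentI[OF square_summable_imp_null[OF b2]]] unfolding Bseq_def by (auto simp: abs_le_iff)
  have B0: "0 \<le> B" using B[of 0] b_pos[of 0] by linarith
  have alB: "al k \<omega> \<le> B" for k \<omega> unfolding al_def astep_def using B B0 by simp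
  have AG: "\<bar>(maxQ (Q k \<omega>) y - maxQ (Q k \<omega>) z) / G k \<omega>\<bar> \<le> 1" for k y z \<omega>
    using maxQ_diff_spn[of "Q k \<omega>" y z] Gge[of k \<omega>] G0[of k \<omega>] by (simp add: abs_divide pos_divide_le_eq)
  have Ab: "\<bar>A k y \<omega>\<bar> \<le> al k \<omega>" for k y \<omega>
    using mult_left_mono[OF AG[of k \<omega> y undefined] al0[of k \<omega>]] al0[of k \<omega>] unfolding A_def abs_mult by simp
  have I01: "\<bar>I k y \<omega>\<bar> \<le> 1" for k y \<omega> unfolding I_def by (simp add: indicator_def)
  have DA: "D k \<omega> = (\<Sum>y\<in>UNIV. A k y \<omega> * (I k y \<omega> - p (fst i) (snd i) y))" for k \<omega>
  proof -
    define m where "m y = maxQ (Q k \<omega>) y - maxQ (Q k \<omega>) undefined" for y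
    have "(\<Sum>y\<in>UNIV. m y * I k y \<omega>) = (\<Sum>y\<in>UNIV. if s' k \<omega> = y then m y else 0)"
      unfolding I_def by (intro sum.cong) (auto simp: indicator_def)
    hence 1: "(\<Sum>y\<in>UNIV. m y * I k y \<omega>) = m (s' k \<omega>)" by simp
    have "(\<Sum>y\<in>UNIV. p (fst i) (snd i) y * m y) = (\<Sum>y\<in>UNIV. p (fst i) (snd i) y * maxQ (Q k \<omega>) y) - maxQ (Q k \<omega>) undefined"
      using mdp_avg_shift[OF mdp, of "fst i" "snd i" "maxQ (Q k \<omega>)" "- maxQ (Q k \<omega>) undefined"] unfolding m_def by simp
    hence w: "w2 k \<omega> $ i = (\<Sum>y\<in>UNIV. m y * (I k y \<omega> - p (fst i) (snd i) y))"
      using 1 unfolding w2_eq by (simp add: right_diff_distrib sum_subtractf mult.commute m_def[of "s' k \<omega>"])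
    have "D k \<omega> = (al k \<omega> / G k \<omega>) * w2 k \<omega> $ i" unfolding D_def by simp
    also have "\<dots> = (\<Sum>y\<in>UNIV. (al k \<omega> / G k \<omega>) * (m y * (I k y \<omega> - p (fst i) (snd i) y)))"
      unfolding w by (rule sum_distrib_left)
    also have "\<dots> = (\<Sum>y\<in>UNIV. A k y \<omega> * (I k y \<omega> - p (fst i) (snd i) y))"
      unfolding A_def m_def by (intro sum.cong) auto
    finally show ?thesis .
  qed
  have w2G: "\<bar>w2 k \<omega> $ i\<bar> \<le> G k \<omega>" for k \<omega>
  proof -
    have "w2 k \<omega> $ i = (\<Sum>y\<in>UNIV. p (fst i) (snd i) y * (maxQ (Q k \<omega>) (s' k \<omega>) - maxQ (Q k \<omega>) y))"
      unfolding w2_eq by (simp add: right_diff_distrib sum_subtractf sum_distrib_right[symmetric] mdp_sum[OF mdp])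
    moreover have "\<bar>\<Sum>y\<in>UNIV. p (fst i) (snd i) y * (maxQ (Q k \<omega>) (s' k \<omega>) - maxQ (Q k \<omega>) y)\<bar> \<le> spn (Q k \<omega>)"
      by (rule mdp_avg_abs_le[OF mdp maxQ_diff_spn])
    ultimately show ?thesis using Gge[of k \<omega>] by linarith
  qed
  have Dal: "\<bar>D k \<omega>\<bar> \<le> al k \<omega>" for k \<omega>
  proof -
    have "\<bar>w2 k \<omega> $ i / G k \<omega>\<bar> \<le> 1" using w2G[of k \<omega>] G0[of k \<omega>] by (simp add: abs_divide pos_divide_le_eq)
    hence "al k \<omega> * \<bar>w2 k \<omega> $ i / G k \<omega>\<bar> \<le> al k \<omega> * 1" using al0 by (intro mult_left_mono) auto
    thus ?thesis unfolding D_def using al0[of k \<omega>] by (simp add: abs_mult abs_divide)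
  qed
  have alH: "al k \<in> borel_measurable (H k)" for k unfolding al_def[abs_def]
    by (intro measurable_astep phi_H)
  have GH: "G k \<in> borel_measurable (H k)" for k unfolding G_def[abs_def]
    by (intro borel_measurable_runmax borel_measurable_add borel_measurable_const borel_measurable_spn Q_H)
  have AH: "A k y \<in> borel_measurable (H k)" for k y unfolding A_def[abs_def]
    by (intro borel_measurable_times borel_measurable_divide borel_measurable_diff borel_measurable_maxQ Q_H alH GH) auto
  have up: "g \<in> borel_measurable (H (Suc k))" if "g \<in> borel_measurable (H k)" for g :: "'w \<Rightarrow> real" and k
    using that H_mono[of k "Suc k"] H_sub by (intro measurable_from_subalg[of "H (Suc k)" "H k"]) (auto simp: subalgebra_def)
  have DH: "D k \<in> borel_measurable (H (Suc k))" for k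
  proof -
    have "w2 k \<in> borel_measurable (H (Suc k))" by (rule measurable_w2[OF Q_H s'_H]) auto
    hence "(\<lambda>\<omega>. w2 k \<omega> $ i) \<in> borel_measurable (H (Suc k))" unfolding borel_measurable_vec_iff by blast
    thus ?thesis unfolding D_def[abs_def] by (intro borel_measurable_times borel_measurable_divide up[OF alH] up[OF GH])
  qed
  have DM[measurable]: "D k \<in> borel_measurable M" for k using measurable_from_subalg[OF H_sub DH] .
  have AM[measurable]: "A k y \<in> borel_measurable M" for k y using measurable_from_subalg[OF H_sub AH] .
  have alM[measurable]: "al k \<in> borel_measurable M" for k using measurable_from_subalg[OF H_sub alH] .
  have IM[measurable]: "I k y \<in> borel_measurable M" for k y
  proof -
    have "(\<lambda>\<omega>. if s' k \<omega> = y then 1 else (0::real)) \<in> borel_measurable M"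
      by (rule measurable_compose[OF s'_meas]) simp
    moreover have "I k y = (\<lambda>\<omega>. if s' k \<omega> = y then 1 else 0)" unfolding I_def by (auto simp: indicator_def)
    ultimately show ?thesis by simp
  qed
  have bounded_int: "integrable M g" if "g \<in> borel_measurable M" "\<And>\<omega>. \<bar>g \<omega>\<bar> \<le> c" for g :: "'w \<Rightarrow> real" and c
    using that by (intro integrable_const_bound[of g c]) auto
  have al_sq: "(\<Sum>k<n. (al k \<omega>)\<^sup>2) \<le> (\<Sum>k. (b k)\<^sup>2)" for n \<omega>
    unfolding al_def sum_astep_square using b2 by (intro sum_le_suminf) auto
  have D_sq_int: "integrable M (\<lambda>\<omega>. (D k \<omega>)\<^sup>2)" for k
  proof (rule bounded_int)
    show "\<bar>(D k \<omega>)\<^sup>2\<bar> \<le> B\<^sup>2" for \<omega>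
      using power_mono[of "\<bar>D k \<omega>\<bar>" B 2] Dal[of k \<omega>] alB[of k \<omega>] by simp
  qed simp
  have "AE \<omega> in M. summable (\<lambda>k. D k \<omega>)"
  proof (rule L2_martingale_convergence[where D=D and F=H, OF prob_space_axioms H_sub H_mono DH D_sq_int])
    show "summable (\<lambda>k. \<integral>\<omega>. (D k \<omega>)\<^sup>2 \<partial>M)"
    proof (rule summableI_nonneg_bounded)
      fix n
      have "(\<Sum>k<n. \<integral>\<omega>. (D k \<omega>)\<^sup>2 \<partial>M) = (\<integral>\<omega>. (\<Sum>k<n. (D k \<omega>)\<^sup>2) \<partial>M)"
        by (intro Bochner_Integration.integral_sum[symmetric] D_sq_int)
      also have "\<dots> \<le> (\<integral>\<omega>. (\<Sum>k. (b k)\<^sup>2) \<partial>M)"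
      proof (intro integral_mono)
        fix \<omega>
        have "(D k \<omega>)\<^sup>2 \<le> (al k \<omega>)\<^sup>2" for k using power_mono[of "\<bar>D k \<omega>\<bar>" "al k \<omega>" 2] Dal[of k \<omega>] by simp
        hence "(\<Sum>k<n. (D k \<omega>)\<^sup>2) \<le> (\<Sum>k<n. (al k \<omega>)\<^sup>2)" by (intro sum_mono)
        thus "(\<Sum>k<n. (D k \<omega>)\<^sup>2) \<le> (\<Sum>k. (b k)\<^sup>2)" using al_sq[of \<omega> n] by linarith
      qed (auto intro!: Bochner_Integration.integrable_sum D_sq_int)
      finally show "(\<Sum>k<n. \<integral>\<omega>. (D k \<omega>)\<^sup>2 \<partial>M) \<le> (\<Sum>k. (b k)\<^sup>2)" by (simp add: prob_space)
    qed simp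
    fix k
    interpret finite_measure_subalgebra M "H k" by unfold_locales (rule H_sub)
    define J where "J y \<omega> = I k y \<omega> - p (fst i) (snd i) y" for y \<omega>
    have JM[measurable]: "J y \<in> borel_measurable M" for y unfolding J_def[abs_def] by simp
    have Jb: "\<bar>J y \<omega>\<bar> \<le> 1 + \<bar>p (fst i) (snd i) y\<bar>" for y \<omega> using I01[of k y \<omega>] unfolding J_def by linarith
    have AJb: "\<bar>A k y \<omega> * J y \<omega>\<bar> \<le> B * (1 + \<bar>p (fst i) (snd i) y\<bar>)" for y \<omega>
      unfolding abs_mult using Ab[of k y \<omega>] alB[of k \<omega>] Jb[of y \<omega>] B0 by (intro mult_mono) auto
    have AJ_int: "integrable M (\<lambda>\<omega>. A k y \<omega> * J y \<omega>)" for y by (rule bounded_int[OF _ AJb]) simp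
    have I_int: "integrable M (I k y)" for y by (rule bounded_int[OF _ I01]) simp
    have each: "AE \<omega> in M. real_cond_exp M (H k) (\<lambda>\<omega>. A k y \<omega> * J y \<omega>) \<omega> = 0" for y
    proof -
      have "AE \<omega> in M. real_cond_exp M (H k) (\<lambda>\<omega>. A k y \<omega> * J y \<omega>) \<omega> = A k y \<omega> * real_cond_exp M (H k) (J y) \<omega>"
        by (rule real_cond_exp_mult[OF AH JM AJ_int])
      moreover have "AE \<omega> in M. real_cond_exp M (H k) (J y) \<omega> = real_cond_exp M (H k) (I k y) \<omega> - real_cond_exp M (H k) (\<lambda>_. p (fst i) (snd i) y) \<omega>"
        unfolding J_def[abs_def] by (rule real_cond_exp_diff[OF I_int]) simp
      moreover have "AE \<omega> in M. real_cond_exp M (H k) (\<lambda>_. p (fst i) (snd i) y) \<omega> = p (fst i) (snd i) y"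
        by (rule real_cond_exp_F_meas) auto
      moreover have "AE \<omega> in M. real_cond_exp M (H k) (I k y) \<omega> = p (fst (\<phi> k \<omega>)) (snd (\<phi> k \<omega>)) y"
        using sampling[of k y] unfolding I_def[abs_def] .
      ultimately show ?thesis
      proof eventually_elim
        case (elim \<omega>)
        show ?case
        proof (cases "i = \<phi> k \<omega>")
          case True thus ?thesis using elim by simp
        next
          case False
          hence "A k y \<omega> = 0" unfolding A_def al_def astep_def by simp
          thus ?thesis using elim(1) by simp
        qed
      qed
    qed
    have "AE \<omega> in M. real_cond_exp M (H k) (\<lambda>\<omega>. \<Sum>y\<in>UNIV. A k y \<omega> * J y \<omega>) \<omega> = (\<Sum>y\<in>UNIV. real_cond_exp M (H k) (\<lambda>\<omega>. A k y \<omega> * J y \<omega>) \<omega>)"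
      by (rule real_cond_exp_sum[OF AJ_int])
    moreover have "AE \<omega> in M. \<forall>y\<in>UNIV. real_cond_exp M (H k) (\<lambda>\<omega>. A k y \<omega> * J y \<omega>) \<omega> = 0"
      by (rule AE_finite_allI) (auto simp: each)
    ultimately have "AE \<omega> in M. real_cond_exp M (H k) (\<lambda>\<omega>. \<Sum>y\<in>UNIV. A k y \<omega> * J y \<omega>) \<omega> = 0"
      by eventually_elim simp
    moreover have "D k = (\<lambda>\<omega>. \<Sum>y\<in>UNIV. A k y \<omega> * J y \<omega>)" unfolding J_def using DA by auto
    ultimately show "AE \<omega> in M. real_cond_exp M (H k) (D k) \<omega> = 0" by simp
  qed
  thus ?thesis unfolding D_def al_def G_def .
qed

end

lemma limsup_ratio_null:
  fixes a b :: "nat \<Rightarrow> real"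
  assumes "\<And>k. 0 < a k" "\<And>k. 0 < b k" and "limsup (\<lambda>k. ereal (b k / a k)) = 0"
  shows "(\<lambda>k. b k / a k) \<longlonglongrightarrow> 0"
proof (rule tendstoI)
  fix e :: real assume e: "e > 0"
  have "eventually (\<lambda>k. ereal (b k / a k) < ereal e) sequentially"
    by (rule Limsup_lessD) (use assms(3) e in simp)
  thus "eventually (\<lambda>k. dist (b k / a k) 0 < e) sequentially"
  proof eventually_elim
    case (elim k)
    have "0 < b k / a k" using assms(1,2) by simp
    thus ?case using elim by simp
  qed
qed

section \<open>Almost sure convergence\<close>

theorem theorem1:
  fixes r :: "'s::finite \<Rightarrow> 'b::finite \<Rightarrow> real"
    and p :: "'s \<Rightarrow> 'b \<Rightarrow> 's \<Rightarrow> real"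
    and f :: "real ^ ('s \<times> 'b) \<Rightarrow> real"
    and u :: real
    and fs :: "real ^ ('s \<times> 'b) \<Rightarrow> 'x \<Rightarrow> real"
    and a b :: "nat \<Rightarrow> real"
    and \<eta> :: real
    and M :: "'w measure"
    and X :: "nat \<Rightarrow> 'w \<Rightarrow> 'x"
    and \<phi> :: "nat \<Rightarrow> 'w \<Rightarrow> 's \<times> 'b"
    and s' :: "nat \<Rightarrow> 'w \<Rightarrow> 's"
    and \<xi> :: "nat \<Rightarrow> 'w \<Rightarrow> real"
    and Q :: "nat \<Rightarrow> 'w \<Rightarrow> real ^ ('s \<times> 'b)"
    and \<xi>0 :: real
    and Q0 :: "real ^ ('s \<times> 'b)"
  assumes mdp: "is_mdp p"
    and ergodic: "\<And>\<pi>. stationary_policy \<pi> \<Longrightarrow> ergodic_chain (policy_chain p \<pi>)"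
    \<comment> \<open>conditions on f\<close>
    and f_lip: "\<exists>C. C-lipschitz_on UNIV f"
    and u_pos: "u > 0"
    and f_e: "f ones = u"
    and f_shift: "\<And>x c. f (x + c *\<^sub>R ones) = f x + c * u"
    and f_hom: "\<And>x c. f (c *\<^sub>R x) = c * f x"
    \<comment> \<open>step sizes and clipping parameter\<close>
    and a_pos: "\<And>k. a k > 0"
    and b_pos: "\<And>k. b k > 0"
    and eta_pos: "\<eta> > 0"
    \<comment> \<open>probability space and random variables\<close>
    and M: "prob_space M"
    and phi_meas: "\<And>k. \<phi> k \<in> measurable M (count_space UNIV)"
    and s'_meas: "\<And>k. s' k \<in> measurable M (count_space UNIV)"
    and fs_meas: "\<And>k. (\<lambda>\<omega>. fs (Q k \<omega>) (X k \<omega>)) \<in> borel_measurable M"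
    \<comment> \<open>the iteration\<close>
    and xi_init: "\<And>\<omega>. \<xi> 0 \<omega> = \<xi>0"
    and Q_init: "\<And>\<omega>. Q 0 \<omega> = Q0"
    and xi_step: "\<And>k \<omega>. \<xi> (Suc k) \<omega> = \<xi> k \<omega> + a k * (fs (Q k \<omega>) (X k \<omega>) - \<xi> k \<omega>)"
    and Q_step: "\<And>k \<omega> s\<^sub>0 a\<^sub>0. Q (Suc k) \<omega> $ (s\<^sub>0, a\<^sub>0) = Q k \<omega> $ (s\<^sub>0, a\<^sub>0)
        + b (visits \<phi> k \<omega> (s\<^sub>0, a\<^sub>0)) *
          (r s\<^sub>0 a\<^sub>0 - g_clip (rnorm r) \<eta> (\<xi> k \<omega>) + maxQ (Q k \<omega>) (s' k \<omega>) - Q k \<omega> $ (s\<^sub>0, a\<^sub>0))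
          * (if (s\<^sub>0, a\<^sub>0) = \<phi> k \<omega> then 1 else 0)"
    \<comment> \<open>the next state s'_k is sampled from p(. | phi_k), given the past\<close>
    and sampling: "\<And>k y. AE \<omega> in M.
        real_cond_exp M (filtH M \<xi> Q (noise1 f fs Q X) (noise2 r p \<eta> \<xi> Q s') \<phi> s' k)
          (indicator {\<omega>. s' k \<omega> = y}) \<omega> = p (fst (\<phi> k \<omega>)) (snd (\<phi> k \<omega>)) y"
    \<comment> \<open>(A1)\<close>
    and A1_int: "\<And>k. integrable M (noise1 f fs Q X k)"
    and A1_mean: "\<And>k. AE \<omega> in M.
        real_cond_exp M (filtF M \<xi> Q (noise1 f fs Q X) (noise2 r p \<eta> \<xi> Q s') k)
          (noise1 f fs Q X k) \<omega> = 0"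
    and A1_var: "\<exists>K. \<forall>k. AE \<omega> in M.
        nn_cond_exp M (filtF M \<xi> Q (noise1 f fs Q X) (noise2 r p \<eta> \<xi> Q s') k)
          (\<lambda>\<omega>. ennreal ((noise1 f fs Q X k \<omega>)\<^sup>2)) \<omega> \<le> ennreal (K * (1 + (norm (Q k \<omega>))\<^sup>2))"
    \<comment> \<open>(A2)\<close>
    and A2: "\<exists>s m. \<forall>s0 \<pi>. stationary_policy \<pi> \<longrightarrow>
        (\<exists>t\<le>m. nstep (policy_chain p \<pi>) t s0 s > 0)"
    \<comment> \<open>(A3)\<close>
    and A3a: "stepsize_cond a"
    and A3b: "stepsize_cond b"
    \<comment> \<open>(A4)\<close>
    and A4: "limsup (\<lambda>k. ereal (b k / a k)) = 0"
    \<comment> \<open>(A5)\<close>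
    and A5_visits: "\<exists>\<Delta>>0. AE \<omega> in M. \<forall>sa.
        liminf (\<lambda>k. ereal (real (visits \<phi> k \<omega> sa) / real (k + 1))) \<ge> ereal \<Delta>"
    and A5_ratio: "\<And>x. x > 0 \<Longrightarrow> AE \<omega> in M. \<forall>sa sa'.
        convergent (\<lambda>k.
          (\<Sum>m = visits \<phi> k \<omega> sa'..visits \<phi> (Nprime b \<phi> k x \<omega>) \<omega> sa'. b m) /
          (\<Sum>m = visits \<phi> k \<omega> sa..visits \<phi> (Nprime b \<phi> k x \<omega>) \<omega> sa. b m))"
  shows "\<exists>q. rvi_solution r p f q \<and> (\<forall>q'. rvi_solution r p f q' \<longrightarrow> q' = q)
           \<and> (\<forall>s0. f q = opt_avg_reward r p s0)
           \<and> (AE \<omega> in M. (\<lambda>k. Q k \<omega>) \<longlonglongrightarrow> q \<and> (\<lambda>k. \<xi> k \<omega>) \<longlonglongrightarrow> f q)"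
proof -
  interpret prob_space M by (rule M)
  have irr: "policy_irreducible p"
    using ergodic unfolding policy_irreducible_def ergodic_chain_def by blast
  obtain C where C: "C-lipschitz_on UNIV f" using f_lip by blast
  have f_lip': "\<bar>f x - f y\<bar> \<le> C * norm (x - y)" for x y
    using lipschitz_onD[OF C, of x y] by (simp add: dist_norm)
  have C0: "0 \<le> C" by (rule lipschitz_on_nonneg[OF C])
  from rvi_solution_exists_unique[where f=f and r=r, OF mdp irr u_pos f_shift]
  obtain q where q: "rvi_solution r p f q" and uniq: "\<forall>q'. rvi_solution r p f q' \<longrightarrow> q' = q"
    and opt: "\<forall>s0. f q = opt_avg_reward r p s0" and rho: "\<bar>f q\<bar> \<le> rnorm r" by (elim exE conjE)
  interpret rvi_process M r p f fs a b \<eta> X \<phi> s' \<xi> Q \<xi>0 Q0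
    by (unfold_locales) (use mdp lipschitz_on_continuous_on[OF C] b_pos phi_meas s'_meas fs_meas xi_init Q_init xi_step Q_step in auto)
  have a2: "summable (\<lambda>k. (a k)\<^sup>2)" and b2: "summable (\<lambda>k. (b k)\<^sup>2)" and a_div: "\<not> summable a"
    using A3a A3b unfolding stepsize_cond_def by auto
  have ba: "(\<lambda>k. b k / a k) \<longlonglongrightarrow> 0" by (rule limsup_ratio_null[OF a_pos b_pos A4])
  obtain K where K: "\<forall>k. AE \<omega> in M. nn_cond_exp M (F k) (\<lambda>\<omega>. ennreal ((w1 k \<omega>)\<^sup>2)) \<omega> \<le> ennreal (K * (1 + (norm (Q k \<omega>))\<^sup>2))"
    using A1_var by blast
  have n1: "AE \<omega> in M. summable (\<lambda>k. a k * w1 k \<omega> / runmax (\<lambda>k. 1 + norm (Q k \<omega>)) k)"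
    by (rule noise1_summable[OF A1_int A1_mean K[rule_format] less_imp_le[OF a_pos] a2])
  have "AE \<omega> in M. \<forall>i\<in>UNIV. summable (\<lambda>k. astep b (traj \<omega>) k i * w2 k \<omega> $ i / runmax (\<lambda>k. 1 + spn (Q k \<omega>)) k)"
    by (rule AE_finite_allI) (auto intro: noise2_summable[OF sampling b2])
  hence n2: "AE \<omega> in M. \<forall>i. summable (\<lambda>k. astep b (traj \<omega>) k i * w2 k \<omega> $ i / runmax (\<lambda>k. 1 + spn (Q k \<omega>)) k)" by simp
  obtain \<Delta> where \<Delta>: "\<Delta> > 0" "AE \<omega> in M. \<forall>sa. liminf (\<lambda>k. ereal (real (visits \<phi> k \<omega> sa) / real (k + 1))) \<ge> ereal \<Delta>"
    using A5_visits by blast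
  \<comment> \<open>The assumption holds almost surely for each \<open>x\<close> separately; a
    sequence of \<open>x\<close> tending to \<open>0\<close> is enough and leaves a single null
    set.\<close>
  have ratio: "AE \<omega> in M. \<forall>N. \<forall>sa sa'. convergent (\<lambda>k.
          (\<Sum>m = visits \<phi> k \<omega> sa'..visits \<phi> (Nprime b \<phi> k (inverse (real (Suc N))) \<omega>) \<omega> sa'. b m) /
          (\<Sum>m = visits \<phi> k \<omega> sa..visits \<phi> (Nprime b \<phi> k (inverse (real (Suc N))) \<omega>) \<omega> sa. b m))"
    by (rule AE_all_countable[THEN iffD2], intro allI, rule A5_ratio) simp
  have "AE \<omega> in M. (\<lambda>k. Q k \<omega>) \<longlonglongrightarrow> q \<and> (\<lambda>k. \<xi> k \<omega>) \<longlonglongrightarrow> f q"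
    using n1 n2 \<Delta>(2) ratio
  proof eventually_elim
    case (elim \<omega>)
    have "\<forall>i. eventually (\<lambda>k. \<Delta> / 2 < real (visits \<phi> k \<omega> i) / real (k + 1)) sequentially"
    proof
      fix i
      have "ereal (\<Delta> / 2) < ereal \<Delta>" using \<Delta>(1) by simp
      also have "\<dots> \<le> liminf (\<lambda>k. ereal (real (visits \<phi> k \<omega> i) / real (k + 1)))" using elim(3) by blast
      finally have "eventually (\<lambda>k. ereal (\<Delta> / 2) < ereal (real (visits \<phi> k \<omega> i) / real (k + 1))) sequentially"
        by (rule less_LiminfD)
      thus "eventually (\<lambda>k. \<Delta> / 2 < real (visits \<phi> k \<omega> i) / real (k + 1)) sequentially" by simp
    qed
    hence "eventually (\<lambda>k. \<forall>i\<in>UNIV. \<Delta> / 2 < real (visits \<phi> k \<omega> i) / real (k + 1)) sequentially"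
      by (intro eventually_ball_finite) auto
    then obtain K1 where K1: "\<And>k i. K1 \<le> k \<Longrightarrow> \<Delta> / 2 < real (visits \<phi> k \<omega> i) / real (k + 1)"
      unfolding eventually_sequentially by blast
    \<comment> \<open>\<open>\<Delta> / 2\<close> turns the bound on the lower limit into one valid
      from some time on; \<open>Suc K1\<close> because \<open>cnt\<close> at \<open>n\<close> counts
      the visits up to time \<open>n - 1\<close>.\<close>
    interpret S: async_steps "traj \<omega>" b "\<Delta> / 2" "Suc K1"
    proof
      fix n i assume n: "Suc K1 \<le> n"
      then obtain k where k: "n = Suc k" "K1 \<le> k" by (cases n) auto
      show "\<Delta> / 2 * real n \<le> real (cnt (traj \<omega>) n i)"
        using K1[OF k(2), of i] unfolding k(1) visits_eq_cnt by (simp add: pos_less_divide_eq)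
    qed (use b_pos A3b \<Delta>(1) in auto)
    have Np_eq: "Nprime b \<phi> k x \<omega> = S.Np x k" for k x
      unfolding Nprime_def S.Np_def visits_eq_cnt bstep_def ..
    interpret P: rvi_path r p f u C \<eta> q a "astep b (traj \<omega>)" "\<lambda>k. \<xi> k \<omega>" "\<lambda>k. Q k \<omega>" "\<lambda>k. w1 k \<omega>" "\<lambda>k i. w2 k \<omega> $ i" "bstep b (traj \<omega>)"
    proof
      show "bstep b (traj \<omega>) k = (\<Sum>i\<in>UNIV. astep b (traj \<omega>) k i)" for k by (rule sum_astep[symmetric])
      show "(\<lambda>k. bstep b (traj \<omega>) k / a (Suc k)) \<longlonglongrightarrow> 0" by (rule S.step_ratio[OF a_pos ba])
      show "\<exists>K. \<forall>k0\<ge>K. \<forall>k\<ge>k0. sum (bstep b (traj \<omega>)) {k0..<k} \<le> T \<longrightarrow>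
         (\<forall>i j. \<bar>(\<Sum>l\<in>{k0..<k}. astep b (traj \<omega>) l i) - (\<Sum>l\<in>{k0..<k}. astep b (traj \<omega>) l j)\<bar> \<le> \<epsilon>)" if "\<epsilon> > 0" for T \<epsilon>
        by (rule S.masses_equalize[OF _ that]) (use elim(4) in \<open>simp only: Np_eq visits_eq_cnt\<close>)
      show "a \<longlonglongrightarrow> 0" by (rule square_summable_imp_null[OF a2])
    qed (fact mdp irr q rho f_lip' C0 f_shift u_pos eta_pos a_pos a_div S.al0 S.be_lim S.al_div Q_step' xi_step' elim(1) elim(2)[rule_format])+
    show ?case by (rule P.path_convergence)
  qed
  thus ?thesis using q uniq opt by blast
qed

end
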